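(* Let $d\ge 2$, $\epsilon>0$, $0\le\eta<1/(2d(d-1))$, and let $g:\mathbb{R}\to\mathbb{R}$ satisfy $g(t)=O(t^{\eta})$ as $t\to\infty$. There exist $p_0>0$ sufficiently small and $A$ sufficiently large such that for all positive integers $n_1,\dots,n_d$ with geometric mean $N=(\prod_i n_i)^{1/d}$ and sum $S=\sum_i n_i$, and all $0<p\le p_0$ with $Np^{1/d}\ge A$ and $S\le g(1/p)N$, setting $M=c_dNp^{1/d}$: (i) $(1-\epsilon)M\le \mathbb{E}[L(\mathcal{G}(K_{n_1,\dots,n_d},p))]\le(1+\epsilon)M$; (ii) every median of $L(\mathcal{G}(K_{n_1,\dots,n_d},p))$ lies in $[(1-\epsilon)M,(1+\epsilon)M]$; (iii) there is an absolute constant $C>0$ such that $\Pr[L(\mathcal{G}(K_{n_1,\dots,n_d},p))\le(1-\epsilon)M]\le\exp(-C\epsilon^2M)$ and $\Pr[L(\mathcal{G}(K_{n_1,\dots,n_d},p))\ge(1+\epsilon)M]\le\exp(-C\frac{\epsilon^2}{1+\epsilon}M)$.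
   Context: $K_{n_1,\dots,n_d}$ is the complete $d$-partite hyper-graph with color classes $[n_1],\dots,[n_d]$ (disjoint, natural order) and edge set $[n_1]\times\cdots\times[n_d]$. $\mathcal{G}(K_{n_1,\dots,n_d},p)$ is the distribution of the random hyper-subgraph in which each edge is present independently with probability $p$. A non-crossing hyper-matching is a set of pairwise vertex-disjoint edges that are pairwise comparable in the componentwise order $(v_i)\preceq(v_i')\iff v_i\le v_i'\ \forall i$; $L(G)$ is its maximum size in $G$, and $L(\mathcal{F})$ is $L(G)$ for $G\sim\mathcal{F}$. $c_d=\lim_{m\to\infty}H_d(m)/m^{1/d}$, where $H_d(m)$ is the length of the longest chain (componentwise order) among $m$ independent uniform points in $[0,1]^d$. *)

theory Defs
  imports "HOL-Probability.Probability" "HOL-Probability.Product_PMF" "HOL-Library.Landau_Symbols"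
begin

(* d-tuples are functions nat => 'a of which only the coordinates 0, ..., d - 1 matter;
   the i-th entry of a tuple in the literature is the value at i - 1 here. *)

definition comp_le :: "nat \<Rightarrow> (nat \<Rightarrow> 'a::ord) \<Rightarrow> (nat \<Rightarrow> 'a) \<Rightarrow> bool" where
  "comp_le d x y \<longleftrightarrow> (\<forall>i<d. x i \<le> y i)"

definition comparable :: "nat \<Rightarrow> (nat \<Rightarrow> 'a::ord) \<Rightarrow> (nat \<Rightarrow> 'a) \<Rightarrow> bool" where
  "comparable d x y \<longleftrightarrow> comp_le d x y \<or> comp_le d y x"


definition complete_edges :: "nat \<Rightarrow> (nat \<Rightarrow> nat) \<Rightarrow> (nat \<Rightarrow> nat) set" where
  "complete_edges d n = (\<Pi>\<^sub>E i\<in>{..<d}. {1..n i})"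

(* Vertices carry the index of their color class, so that the classes are disjoint. *)

definition edge_vertices :: "nat \<Rightarrow> (nat \<Rightarrow> nat) \<Rightarrow> (nat \<times> nat) set" where
  "edge_vertices d e = (\<lambda>i. (i, e i)) ` {..<d}"

definition noncrossing_matching :: "nat \<Rightarrow> (nat \<Rightarrow> nat) set \<Rightarrow> bool" where
  "noncrossing_matching d F \<longleftrightarrow>
     pairwise (\<lambda>e f. disjnt (edge_vertices d e) (edge_vertices d f) \<and> comparable d e f) F"

(* A sub-hypergraph of the complete d-partite hypergraph is given by its (finite) edge set. *)

definition max_noncrossing :: "nat \<Rightarrow> (nat \<Rightarrow> nat) set \<Rightarrow> nat" where
  "max_noncrossing d G = Max (card ` {F. F \<subseteq> G \<and> noncrossing_matching d F})"

definition random_hypergraph :: "nat \<Rightarrow> (nat \<Rightarrow> nat) \<Rightarrow> real \<Rightarrow> (nat \<Rightarrow> nat) set pmf" where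
  "random_hypergraph d n p =
     map_pmf (\<lambda>\<omega>. {e \<in> complete_edges d n. \<omega> e})
       (Pi_pmf (complete_edges d n) False (\<lambda>_. bernoulli_pmf p))"

definition L_pmf :: "nat \<Rightarrow> (nat \<Rightarrow> nat) \<Rightarrow> real \<Rightarrow> real pmf" where
  "L_pmf d n p = map_pmf (\<lambda>G. real (max_noncrossing d G)) (random_hypergraph d n p)"

definition is_median :: "real pmf \<Rightarrow> real \<Rightarrow> bool" where
  "is_median D m \<longleftrightarrow> measure_pmf.prob D {..m} \<ge> 1/2 \<and> measure_pmf.prob D {m..} \<ge> 1/2"


definition uniform_points :: "nat \<Rightarrow> nat \<Rightarrow> (nat \<Rightarrow> nat \<Rightarrow> real) measure" where
  "uniform_points d m =
     (\<Pi>\<^sub>M j\<in>{..<m}. \<Pi>\<^sub>M i\<in>{..<d}. uniform_measure lborel {0..1})"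

definition longest_chain :: "nat \<Rightarrow> nat \<Rightarrow> (nat \<Rightarrow> nat \<Rightarrow> real) \<Rightarrow> nat" where
  "longest_chain d m x =
     Max (card ` {J. J \<subseteq> {..<m} \<and> pairwise (\<lambda>j k. comparable d (x j) (x k)) J})"

(* The limit of H_d(m) / m^(1/d) is taken in probability. *)

definition chain_limit :: "nat \<Rightarrow> real \<Rightarrow> bool" where
  "chain_limit d c \<longleftrightarrow>
     (\<forall>\<delta>>0. (\<lambda>m. measure (uniform_points d m)
        {x \<in> space (uniform_points d m).
           \<bar>real (longest_chain d m x) / real m powr (1 / real d) - c\<bar> > \<delta>}) \<longlonglongrightarrow> 0)"

definition chain_const :: "nat \<Rightarrow> real" where
  "chain_const d = (THE c. chain_limit d c)"

end

theory Submission imports Defs begin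

text \<open>
  A non-crossing matching is a chain of edges that increases strictly in every coordinate, so
  \<open>L\<close> is a self-bounding function of the independent edge indicators: deleting an edge decreases
  it by at most one, and at most \<open>L\<close> edges are critical. The entropy method then shows that
  the moment generating function of \<open>L\<close> is at most that of a Poisson variable with the same
  mean. This gives both tails with absolute constants, and reduces everything to
  \<open>E L = (1 + o(1)) c N p\<^sup>1\<^sup>/\<^sup>d\<close>.

  Let \<open>c\<close> be the supremum of \<open>E L / (N \<lambda>\<^sup>1\<^sup>/\<^sup>d)\<close> over all grids and all \<open>p\<close>, where
  \<open>\<lambda> = - ln (1 - p)\<close>; it is finite by a first moment bound on the number of chains. The upper
  bound on the mean is then immediate. For the lower bound, a nearly extremal grid is transferred
  to any grid with the same expected number of edges and long sides: on the common refinement of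
  the two, both random edge sets are images of a single one, and few pairs of edges share a vertex.
  Diagonal blocks and superadditivity extend this to large grids; the bound on \<open>S\<close> makes the
  sides of the blocks long.

  That \<open>c\<close> is the limit constant of the uniform point model follows by rounding the points
  to a fine grid, on which a Poisson number of points occupies the cells independently.
\<close>

section \<open>Bernoulli random subsets\<close>

text \<open>The supremum takes the place of a limit theorem for superadditive quantities. One grid
  whose ratio is within a factor 1 - e of the supremum is fixed, and all error terms depend on it
  only through its expected volume v, the product of its sides times its \<lambda>. Its shape and
  edge probability bear no relation to those of the target, so tiling alone cannot reproduce it;
  hence the comparison of grids. That comparison costs the gap between weak and strict order, which
  is in expectation at most v^2 times the sum of the reciprocal sides of a block: v stays fixed
  while the sides grow. The parameter \<lambda> is used because merging k cells multiplies it by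
  exactly k, so that N \<lambda>^(1/d) does not change under refinement; for small p it may be
  exchanged for p. The tails need the mean only up to a small fraction of \<epsilon>, and once M is
  large they confine every median.\<close>

definition bernoulli_subset :: "'a set \<Rightarrow> real \<Rightarrow> 'a set pmf" where
  "bernoulli_subset S p = map_pmf (\<lambda>\<omega>. {e \<in> S. \<omega> e}) (Pi_pmf S False (\<lambda>_. bernoulli_pmf p))"

lemma set_pmf_bernoulli_subset: "set_pmf (bernoulli_subset S p) \<subseteq> Pow S"
  by (auto simp: bernoulli_subset_def)

lemma AE_bernoulli_subsetI: "(\<And>X. X \<subseteq> S \<Longrightarrow> P X) \<Longrightarrow> AE X in bernoulli_subset S p. P X"
  using set_pmf_bernoulli_subset[of S p] by (auto simp: AE_measure_pmf_iff)

lemma finite_set_pmf_bernoulli_subset: "finite S \<Longrightarrow> finite (set_pmf (bernoulli_subset S p))"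
  by (rule finite_subset[OF set_pmf_bernoulli_subset]) simp

lemma integrable_bernoulli_subset [simp, intro]:
  fixes f :: "'a set \<Rightarrow> real"
  shows "finite S \<Longrightarrow> integrable (measure_pmf (bernoulli_subset S p)) f"
  by (intro integrable_measure_pmf_finite finite_set_pmf_bernoulli_subset)

lemma prob_bernoulli_subset_subset:
  assumes "finite S" "0 \<le> p" "p \<le> 1"
  shows "measure_pmf.prob (bernoulli_subset S p) {X. X \<subseteq> T} = (1 - p) ^ card (S - T)"
proof -
  have "measure_pmf.prob (bernoulli_subset S p) {X. X \<subseteq> T} =
      measure_pmf.prob (Pi_pmf S False (\<lambda>_. bernoulli_pmf p)) (Pi S (\<lambda>e. if e \<in> T then UNIV else {False}))"
    unfolding bernoulli_subset_def
    by (simp, intro arg_cong[where f="measure _"]) (auto split: if_splits)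
  also have "\<dots> = (\<Prod>e\<in>S. if e \<in> T then 1 else 1 - p)"
    using assms by (subst measure_Pi_pmf_Pi) (auto intro!: prod.cong simp: measure_pmf_single)
  also have "\<dots> = (1 - p) ^ card (S - T)"
    using assms by (simp add: prod.If_cases Diff_eq)
  finally show ?thesis .
qed

lemma prob_bernoulli_subset_superset:
  assumes "finite S" "0 \<le> p" "p \<le> 1" "A \<subseteq> S"
  shows "measure_pmf.prob (bernoulli_subset S p) {X. A \<subseteq> X} = p ^ card A"
proof -
  have "measure_pmf.prob (bernoulli_subset S p) {X. A \<subseteq> X} =
      measure_pmf.prob (Pi_pmf S False (\<lambda>_. bernoulli_pmf p)) (Pi S (\<lambda>e. if e \<in> A then {True} else UNIV))"
    unfolding bernoulli_subset_def using assms(4)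
    by (simp, intro arg_cong[where f="measure _"]) (auto split: if_splits)
  also have "\<dots> = (\<Prod>e\<in>S. if e \<in> A then p else 1)"
    using assms by (subst measure_Pi_pmf_Pi) (auto intro!: prod.cong simp: measure_pmf_single)
  also have "\<dots> = p ^ card A"
    using assms by (simp add: prod.If_cases Int_absorb1)
  finally show ?thesis .
qed

text \<open>Moebius inversion on the subset lattice: the mass at \<open>T\<close> is the probability
  of lying inside \<open>T\<close> minus the masses at the proper subsets of \<open>T\<close>, which
  agree by induction. Identities between laws are thereby reduced to computing the probability that
  a random set avoids a given set.\<close>

lemma random_set_pmf_eqI:
  assumes fin: "finite S" and P: "set_pmf P \<subseteq> Pow S" and Q: "set_pmf Q \<subseteq> Pow S"
    and eq: "\<And>T. T \<subseteq> S \<Longrightarrow> measure_pmf.prob P {X. X \<subseteq> T} = measure_pmf.prob Q {X. X \<subseteq> T}"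
  shows "P = Q"
proof -
  have *: "pmf P T = pmf Q T" if "T \<subseteq> S" for T
  proof -
    have "finite T" using that fin finite_subset by blast
    then show ?thesis using that
    proof (induction T rule: finite_psubset_induct)
      case (psubset T)
      have "Pow T = insert T {X. X \<subset> T}" by auto
      moreover have "finite {X. X \<subset> T}"
        by (rule finite_subset[of _ "Pow T"]) (use psubset in auto)
      ultimately have dec: "measure_pmf.prob R {X. X \<subseteq> T} = pmf R T + (\<Sum>X\<in>{X. X \<subset> T}. pmf R X)"
        for R :: "'a set pmf"
        by (simp add: Pow_def measure_measure_pmf_finite)
      have "(\<Sum>X\<in>{X. X \<subset> T}. pmf P X) = (\<Sum>X\<in>{X. X \<subset> T}. pmf Q X)"
        by (rule sum.cong) (use psubset in auto)
      then show ?case using eq[OF psubset.prems] dec[of P] dec[of Q] by simp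
    qed
  qed
  show ?thesis
  proof (rule pmf_eqI)
    fix T
    show "pmf P T = pmf Q T"
    proof (cases "T \<subseteq> S")
      case False
      then have "T \<notin> set_pmf P" "T \<notin> set_pmf Q" using P Q by auto
      then show ?thesis by (simp add: set_pmf_iff)
    qed (rule *)
  qed
qed

lemma bernoulli_subset_eqI:
  assumes "finite S" "0 \<le> p" "p \<le> 1" "set_pmf P \<subseteq> Pow S"
    and "\<And>T. T \<subseteq> S \<Longrightarrow> measure_pmf.prob P {X. X \<subseteq> T} = (1 - p) ^ card (S - T)"
  shows "P = bernoulli_subset S p"
  by (rule random_set_pmf_eqI[OF assms(1,4) set_pmf_bernoulli_subset])
     (simp add: assms(5) prob_bernoulli_subset_subset[OF assms(1,2,3)])

lemma bernoulli_subset_Int: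
  assumes "finite S" "0 \<le> p" "p \<le> 1"
  shows "map_pmf (\<lambda>X. X \<inter> T) (bernoulli_subset S p) = bernoulli_subset (S \<inter> T) p"
proof (rule bernoulli_subset_eqI)
  fix U assume "U \<subseteq> S \<inter> T"
  have "{X. X \<inter> T \<subseteq> U} = {X. X \<subseteq> U \<union> - T}" by auto
  then have "measure_pmf.prob (map_pmf (\<lambda>X. X \<inter> T) (bernoulli_subset S p)) {X. X \<subseteq> U}
    = (1 - p) ^ card (S - (U \<union> - T))"
    using assms by (simp add: vimage_def prob_bernoulli_subset_subset)
  also have "S - (U \<union> - T) = S \<inter> T - U" by auto
  finally show "measure_pmf.prob (map_pmf (\<lambda>X. X \<inter> T) (bernoulli_subset S p)) {X. X \<subseteq> U}
    = (1 - p) ^ card (S \<inter> T - U)" .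
qed (use assms set_pmf_bernoulli_subset[of S p] in auto)

text \<open>A point is missed by the image exactly when all of its \<open>k\<close> preimages are
  missed, and different fibres are independent. Fibres of equal size keep the image law
  homogeneous.\<close>

lemma bernoulli_subset_image:
  assumes "finite S" "0 \<le> q" "q \<le> 1"
    and fib: "\<And>y. y \<in> h ` S \<Longrightarrow> card {x \<in> S. h x = y} = k"
  shows "map_pmf (\<lambda>X. h ` X) (bernoulli_subset S q) = bernoulli_subset (h ` S) (1 - (1 - q) ^ k)"
proof (rule bernoulli_subset_eqI)
  fix T assume "T \<subseteq> h ` S"
  have "measure_pmf.prob (map_pmf (\<lambda>X. h ` X) (bernoulli_subset S q)) {X. X \<subseteq> T}
    = (1 - q) ^ card (S - h -` T)"
    using assms by (simp add: vimage_def image_subset_iff_subset_vimage prob_bernoulli_subset_subset)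
  also have "card (S - h -` T) = (\<Sum>y\<in>h ` S - T. card {x \<in> S. h x = y})"
  proof -
    have "S - h -` T = (\<Union>y\<in>h ` S - T. {x \<in> S. h x = y})" by auto
    then show ?thesis using assms(1) by (simp only:) (rule card_UN_disjoint, auto)
  qed
  also have "\<dots> = k * card (h ` S - T)" using fib by simp
  finally show "measure_pmf.prob (map_pmf (\<lambda>X. h ` X) (bernoulli_subset S q)) {X. X \<subseteq> T}
    = (1 - (1 - (1 - q) ^ k)) ^ card (h ` S - T)" by (simp add: power_mult)
next
  show "set_pmf (map_pmf (\<lambda>X. h ` X) (bernoulli_subset S q)) \<subseteq> Pow (h ` S)"
    using set_pmf_bernoulli_subset[of S q] by auto
qed (use assms in \<open>auto simp: power_le_one\<close>)

lemma bernoulli_subset_image_inj: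
  assumes "finite S" "0 \<le> q" "q \<le> 1" "inj_on h S"
  shows "map_pmf (\<lambda>X. h ` X) (bernoulli_subset S q) = bernoulli_subset (h ` S) q"
proof -
  have "card {x \<in> S. h x = y} = 1" if "y \<in> h ` S" for y
  proof -
    from that obtain x where x: "x \<in> S" "y = h x" by auto
    then have "{x \<in> S. h x = y} = {x}" using assms(4) by (auto simp: inj_on_def)
    then show ?thesis by simp
  qed
  from bernoulli_subset_image[OF assms(1-3) this] show ?thesis by simp
qed

lemma bernoulli_subset_Un:
  assumes "finite S" "0 \<le> p" "p \<le> 1" "0 \<le> q" "q \<le> 1"
  shows "map_pmf (\<lambda>(X, Y). X \<union> Y) (pair_pmf (bernoulli_subset S p) (bernoulli_subset S q))
    = bernoulli_subset S (1 - (1 - p) * (1 - q))"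
proof (rule bernoulli_subset_eqI)
  fix T assume "T \<subseteq> S"
  have eq: "(\<lambda>(X, Y). X \<union> Y) -` {X. X \<subseteq> T} = {X. X \<subseteq> T} \<times> {X. X \<subseteq> T}" by auto
  have "finite T" using \<open>T \<subseteq> S\<close> assms(1) by (rule finite_subset)
  then have cnt: "countable {X. X \<subseteq> T}" by (simp add: countable_finite flip: Pow_def)
  have "measure_pmf.prob (map_pmf (\<lambda>(X, Y). X \<union> Y) (pair_pmf (bernoulli_subset S p) (bernoulli_subset S q)))
      {X. X \<subseteq> T} = measure_pmf.prob (pair_pmf (bernoulli_subset S p) (bernoulli_subset S q))
        ({X. X \<subseteq> T} \<times> {X. X \<subseteq> T})"
    by (simp only: measure_map_pmf eq)
  also have "\<dots> = (1 - p) ^ card (S - T) * (1 - q) ^ card (S - T)"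
    using assms by (simp add: measure_pmf_prob_product cnt prob_bernoulli_subset_subset)
  finally show "measure_pmf.prob (map_pmf (\<lambda>(X, Y). X \<union> Y)
      (pair_pmf (bernoulli_subset S p) (bernoulli_subset S q))) {X. X \<subseteq> T}
    = (1 - (1 - (1 - p) * (1 - q))) ^ card (S - T)" by (simp add: power_mult_distrib)
next
  show "set_pmf (map_pmf (\<lambda>(X, Y). X \<union> Y) (pair_pmf (bernoulli_subset S p) (bernoulli_subset S q)))
    \<subseteq> Pow S"
    using set_pmf_bernoulli_subset[of S] by fastforce
next
  have "0 \<le> (1 - p) * (1 - q)" "(1 - p) * (1 - q) \<le> 1"
    using assms by (auto intro!: mult_nonneg_nonneg mult_le_one)
  then show "0 \<le> 1 - (1 - p) * (1 - q)" "1 - (1 - p) * (1 - q) \<le> 1" by simp_all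
qed (use assms in auto)

section \<open>Expectations over Bernoulli subsets\<close>

lemma expectation_bernoulli_subset_mono:
  fixes f g :: "'a set \<Rightarrow> real"
  assumes "finite S" "\<And>X. X \<subseteq> S \<Longrightarrow> f X \<le> g X"
  shows "measure_pmf.expectation (bernoulli_subset S p) f \<le> measure_pmf.expectation (bernoulli_subset S p) g"
  by (rule integral_mono_AE)
     (use assms in \<open>auto intro: AE_bernoulli_subsetI\<close>)

text \<open>Sprinkling: the union with an independent Bernoulli(\<open>q\<close>) set, where
  \<open>1 - r = (1 - p) * (1 - q)\<close>, raises the density from \<open>p\<close> to
  \<open>r\<close> and can only increase \<open>f\<close>. Solving for \<open>q\<close> divides by
  \<open>1 - p\<close>, hence the separate case.\<close>

lemma expectation_bernoulli_subset_mono_prob: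
  fixes f :: "'a set \<Rightarrow> real"
  assumes S: "finite S" and p: "0 \<le> p" "p \<le> r" "r \<le> 1"
    and mono: "\<And>X Y. X \<subseteq> Y \<Longrightarrow> Y \<subseteq> S \<Longrightarrow> f X \<le> f Y"
  shows "measure_pmf.expectation (bernoulli_subset S p) f \<le> measure_pmf.expectation (bernoulli_subset S r) f"
proof (cases "p = 1")
  case True
  then show ?thesis using p by simp
next
  case False
  define q where "q = (r - p) / (1 - p)"
  have q: "0 \<le> q" "q \<le> 1" "r = 1 - (1 - p) * (1 - q)"
    using p False by (auto simp: q_def field_simps)
  let ?PQ = "pair_pmf (bernoulli_subset S p) (bernoulli_subset S q)"
  have fin: "finite (set_pmf ?PQ)" using finite_set_pmf_bernoulli_subset[OF S] by simp
  have "measure_pmf.expectation (bernoulli_subset S p) f = measure_pmf.expectation (map_pmf fst ?PQ) f"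
    by (simp add: map_fst_pair_pmf)
  also have "\<dots> = measure_pmf.expectation ?PQ (\<lambda>z. f (fst z))" by simp
  also have "\<dots> \<le> measure_pmf.expectation ?PQ (\<lambda>z. f ((\<lambda>(X, Y). X \<union> Y) z))"
  proof (rule integral_mono_AE)
    show "AE z in ?PQ. f (fst z) \<le> f ((\<lambda>(X, Y). X \<union> Y) z)"
      using set_pmf_bernoulli_subset[of S] by (fastforce intro!: AE_pmfI mono)
  qed (auto intro!: integrable_measure_pmf_finite fin)
  also have "\<dots> = measure_pmf.expectation (bernoulli_subset S r) f"
    using bernoulli_subset_Un[OF S, of p q] p q by (simp flip: integral_map_pmf)
  finally show ?thesis .
qed

lemma expectation_bernoulli_subset_insert:
  fixes f :: "'a set \<Rightarrow> real"
  assumes S: "finite S" "s \<notin> S" and p: "0 \<le> p" "p \<le> 1"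
  shows "measure_pmf.expectation (bernoulli_subset (insert s S) p) f =
    p * measure_pmf.expectation (bernoulli_subset S p) (\<lambda>X. f (insert s X)) +
    (1 - p) * measure_pmf.expectation (bernoulli_subset S p) f"
proof -
  have "bernoulli_subset (insert s S) p =
      bernoulli_pmf p \<bind> (\<lambda>b. map_pmf (\<lambda>X. if b then insert s X else X) (bernoulli_subset S p))"
    unfolding bernoulli_subset_def Pi_pmf_insert'[OF S] map_bind_pmf pmf.map_comp o_def
    by (intro bind_pmf_cong refl)
       (auto simp: map_pmf_def bind_assoc_pmf bind_return_pmf S(2) split: if_splits intro!: bind_pmf_cong arg_cong[where f=return_pmf])
  then have "measure_pmf.expectation (bernoulli_subset (insert s S) p) f =
      (\<Sum>b\<in>UNIV. pmf (bernoulli_pmf p) b *\<^sub>R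
        measure_pmf.expectation (map_pmf (\<lambda>X. if b then insert s X else X) (bernoulli_subset S p)) f)"
    using finite_set_pmf_bernoulli_subset[OF S(1)] by (simp only:) (rule pmf_expectation_bind, auto)
  then show ?thesis using p by (simp add: UNIV_bool)
qed

section \<open>Concentration of self-bounding functions\<close>

text \<open>The Bregman divergence of x ln x: the gap at x between that function and its tangent at
  y.\<close>

definition excess :: "real \<Rightarrow> real \<Rightarrow> real" where
  "excess x y = x * ln (x / y) - x + y"

text \<open>\<open>excess\<close> is jointly convex and homogeneous of degree one, so its tangent
  plane at \<open>(a, b)\<close> passes through the origin and supports it everywhere. In this
  linear form Jensen's inequality reduces to linearity of the expectation.\<close>

lemma excess_ge_linear:
  assumes "x > 0" "y > 0" "a > 0" "b > 0"
  shows "excess x y \<ge> x * ln (a / b) + y * (1 - a / b)"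
proof -
  \<comment> \<open>The claimed gap equals \<open>x * (w - 1 - ln w)\<close>.\<close>
  define w where "w = y * a / (x * b)"
  have w: "w > 0" using assms by (simp add: w_def)
  have "ln w = ln y + ln a - ln x - ln b"
    using assms by (simp add: w_def ln_div ln_mult)
  then have "x * ln w = x * (ln y + ln a - ln x - ln b)" by simp
  moreover have "x * w = y * a / b" using assms by (simp add: w_def field_simps)
  moreover have "x * (w - 1 - ln w) \<ge> 0"
    using ln_le_minus_one[OF w] assms by simp
  ultimately show ?thesis
    using assms by (simp add: excess_def ln_div algebra_simps)
qed

lemma excess_nonneg: "x > 0 \<Longrightarrow> y > 0 \<Longrightarrow> excess x y \<ge> 0"
  using excess_ge_linear[of x y 1 1] by simp

lemma expectation_bernoulli_subset_pos:
  fixes f :: "'a set \<Rightarrow> real"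
  assumes "finite S" "\<And>X. X \<subseteq> S \<Longrightarrow> f X > 0"
  shows "measure_pmf.expectation (bernoulli_subset S p) f > 0"
proof -
  have "measure_pmf.expectation (bernoulli_subset S p) f \<noteq> 0"
  proof
    assume 0: "measure_pmf.expectation (bernoulli_subset S p) f = 0"
    have "AE X in bernoulli_subset S p. f X \<ge> 0"
      by (intro AE_bernoulli_subsetI assms(2)[THEN less_imp_le])
    then have "AE X in bernoulli_subset S p. f X = 0"
      using 0 assms(1) by (simp add: integral_nonneg_eq_0_iff_AE)
    then have "\<forall>X\<in>set_pmf (bernoulli_subset S p). f X = 0" by (simp add: AE_measure_pmf_iff)
    moreover obtain X where "X \<in> set_pmf (bernoulli_subset S p)"
      using set_pmf_not_empty[of "bernoulli_subset S p"] by blast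
    ultimately show False using assms(2)[of X] set_pmf_bernoulli_subset[of S p] by auto
  qed
  moreover have "measure_pmf.expectation (bernoulli_subset S p) f \<ge> 0"
    by (intro integral_nonneg_AE AE_bernoulli_subsetI assms(2)[THEN less_imp_le])
  ultimately show ?thesis by simp
qed

text \<open>The modified logarithmic Sobolev inequality. In the induction, the two-point entropy of the
  conditional means is passed to the inside by convexity of \<open>excess\<close>.\<close>

lemma entropy_bernoulli_subset:
  fixes f :: "'a set \<Rightarrow> real"
  assumes "finite S" "0 \<le> p" "p \<le> 1" "\<And>X. X \<subseteq> S \<Longrightarrow> f X > 0"
  shows "measure_pmf.expectation (bernoulli_subset S p) (\<lambda>X. f X * ln (f X)) -
      measure_pmf.expectation (bernoulli_subset S p) f * ln (measure_pmf.expectation (bernoulli_subset S p) f)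
    \<le> measure_pmf.expectation (bernoulli_subset S p) (\<lambda>X. \<Sum>s\<in>X. excess (f X) (f (X - {s})))"
  using assms(1,4)
proof (induction S arbitrary: f rule: finite_induct)
  case empty
  have "bernoulli_subset {} p = (return_pmf {} :: 'a set pmf)"
    by (simp add: bernoulli_subset_def)
  then show ?case by simp
next
  case (insert s S)
  let ?E = "measure_pmf.expectation (bernoulli_subset S p)"
  define f1 where "f1 = (\<lambda>X. f (insert s X))"
  define u1 u0 u where "u1 = ?E f1" and "u0 = ?E f" and "u = p * u1 + (1 - p) * u0"
  have pos1: "f1 X > 0" if "X \<subseteq> S" for X unfolding f1_def by (rule insert.prems) (use that in auto)
  have pos0: "f X > 0" if "X \<subseteq> S" for X by (rule insert.prems) (use that in auto)
  have u: "u1 > 0" "u0 > 0"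
    unfolding u1_def u0_def using insert.hyps pos1 pos0 by (auto intro!: expectation_bernoulli_subset_pos)
  have "u > 0"
  proof (cases "p = 0")
    case False
    then have "0 < p * u1" "0 \<le> (1 - p) * u0" using u assms(2,3) by auto
    then show ?thesis by (simp add: u_def)
  qed (use u in \<open>simp add: u_def\<close>)
  \<comment> \<open>The slack of the two-point inequality is exactly \<open>excess u u0\<close>,
    because \<open>u - u0 = p * (u1 - u0)\<close>.\<close>
  have "excess u u0 \<ge> 0" using \<open>u > 0\<close> u by (intro excess_nonneg)
  then have two_point: "p * (u1 * ln u1) + (1 - p) * (u0 * ln u0) - u * ln u \<le> p * excess u1 u0"
    using u \<open>u > 0\<close> by (simp add: excess_def ln_div u_def algebra_simps)
  \<comment> \<open>A linear form in \<open>(u1, u0)\<close> whose coefficients depend only on their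
    ratio: the means can be pulled out, and the supporting plane is then applied inside the
    expectation.\<close>
  have "excess u1 u0 = u1 * ln (u1 / u0) + u0 * (1 - u1 / u0)"
    using u by (simp add: excess_def field_simps)
  also have "\<dots> = ?E (\<lambda>X. f1 X * ln (u1 / u0) + f X * (1 - u1 / u0))"
    using insert.hyps by (simp add: u1_def u0_def)
  also have "\<dots> \<le> ?E (\<lambda>X. excess (f1 X) (f X))"
    using insert.hyps u pos1 pos0
    by (intro expectation_bernoulli_subset_mono excess_ge_linear) auto
  finally have convex: "p * excess u1 u0 \<le> p * ?E (\<lambda>X. excess (f1 X) (f X))"
    using assms(2) by (rule mult_left_mono)
  have IH1: "p * (?E (\<lambda>X. f1 X * ln (f1 X)) - u1 * ln u1)
      \<le> p * ?E (\<lambda>X. \<Sum>t\<in>X. excess (f1 X) (f1 (X - {t})))"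
    unfolding u1_def using insert.IH[OF pos1] assms(2) by (rule mult_left_mono)
  have IH0: "(1 - p) * (?E (\<lambda>X. f X * ln (f X)) - u0 * ln u0)
      \<le> (1 - p) * ?E (\<lambda>X. \<Sum>t\<in>X. excess (f X) (f (X - {t})))"
    unfolding u0_def using insert.IH[OF pos0] assms(3) by (intro mult_left_mono) auto
  have split: "?E (\<lambda>X. \<Sum>t\<in>insert s X. excess (f (insert s X)) (f (insert s X - {t})))
      = ?E (\<lambda>X. excess (f1 X) (f X)) + ?E (\<lambda>X. \<Sum>t\<in>X. excess (f1 X) (f1 (X - {t})))"
  proof -
    have "?E (\<lambda>X. \<Sum>t\<in>insert s X. excess (f (insert s X)) (f (insert s X - {t})))
      = ?E (\<lambda>X. excess (f1 X) (f X) + (\<Sum>t\<in>X. excess (f1 X) (f1 (X - {t}))))"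
    proof (rule integral_cong_AE)
      have "(\<Sum>t\<in>insert s X. excess (f (insert s X)) (f (insert s X - {t})))
        = excess (f1 X) (f X) + (\<Sum>t\<in>X. excess (f1 X) (f1 (X - {t})))" if "X \<subseteq> S" for X
      proof -
        have "s \<notin> X" "finite X" using that insert.hyps finite_subset by auto
        moreover have "insert s X - {t} = insert s (X - {t})" if "t \<in> X" for t
          using that \<open>s \<notin> X\<close> by auto
        ultimately show ?thesis by (simp add: f1_def)
      qed
      then show "AE X in bernoulli_subset S p.
          (\<Sum>t\<in>insert s X. excess (f (insert s X)) (f (insert s X - {t})))
          = excess (f1 X) (f X) + (\<Sum>t\<in>X. excess (f1 X) (f1 (X - {t})))"
        by (rule AE_bernoulli_subsetI)
    qed auto
    also have "\<dots> = ?E (\<lambda>X. excess (f1 X) (f X)) + ?E (\<lambda>X. \<Sum>t\<in>X. excess (f1 X) (f1 (X - {t})))"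
      using insert.hyps by simp
    finally show ?thesis .
  qed
  show ?case
    unfolding expectation_bernoulli_subset_insert[OF insert.hyps(1,2) assms(2,3)] split
    using IH1 IH0 two_point convex
    unfolding u_def[unfolded u1_def u0_def f1_def, symmetric] f1_def[symmetric] u1_def[symmetric] u0_def[symmetric]
    unfolding u_def by (simp add: f1_def algebra_simps)
qed

section \<open>From the entropy inequality to the moment generating function\<close>

lemma ratio_exp_minus_one_tendsto_0:
  fixes K :: "real \<Rightarrow> real"
  assumes "K 0 = 0" "(K has_real_derivative 0) (at 0)"
  shows "((\<lambda>l. K l / (exp l - 1)) \<longlongrightarrow> 0) (at 0)"
proof -
  have "((\<lambda>l. K l / l) \<longlongrightarrow> 0) (at 0)"
    using assms by (simp add: DERIV_def)
  moreover have "((\<lambda>l. (exp l - 1) / l) \<longlongrightarrow> (1::real)) (at 0)"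
    using DERIV_exp[of 0] by (simp add: DERIV_def)
  ultimately have "((\<lambda>l. (K l / l) / ((exp l - 1) / l)) \<longlongrightarrow> 0 / 1) (at 0)"
    by (intro tendsto_divide) auto
  moreover have "eventually (\<lambda>l. (K l / l) / ((exp l - 1) / l) = K l / (exp l - 1)) (at 0)"
    by (auto simp: eventually_at_filter)
  ultimately show ?thesis by (auto intro: Lim_transform_eventually)
qed

text \<open>The hypothesis says that \<open>K l / (exp l - 1)\<close> is antimonotone on either side of its limit
  \<open>0\<close> at \<open>l = 0\<close>.\<close>

lemma nonpos_of_exp_diff_inequality:
  fixes K K' :: "real \<Rightarrow> real"
  assumes "K 0 = 0" "K' 0 = 0" and der: "\<And>l. (K has_real_derivative K' l) (at l)"
    and ineq: "\<And>l. (1 - exp (- l)) * K' l \<le> K l"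
  shows "K l \<le> 0"
proof -
  define R where "R = (\<lambda>l. K l / (exp l - 1))"
  have lim: "(R \<longlongrightarrow> 0) (at 0)"
    unfolding R_def using assms(1,2) der[of 0] by (intro ratio_exp_minus_one_tendsto_0) auto
  have R': "\<exists>y. (R has_real_derivative y) (at l) \<and> y \<le> 0" if "l \<noteq> 0" for l
  proof -
    have R_der: "(R has_real_derivative (K' l * (exp l - 1) - K l * exp l) / ((exp l - 1) * (exp l - 1))) (at l)"
      unfolding R_def using that by (auto intro!: derivative_eq_intros der)
    \<comment> \<open>Multiplied by \<open>exp l\<close>, the hypothesis becomes the sign of the
      numerator in the derivative of \<open>R\<close>.\<close>
    have "exp l * ((1 - exp (- l)) * K' l) \<le> exp l * K l"
      using ineq by (intro mult_left_mono) auto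
    moreover have "exp l * ((1 - exp (- l)) * K' l) = K' l * (exp l - 1)"
      by (simp add: exp_minus field_simps)
    ultimately have "K' l * (exp l - 1) - K l * exp l \<le> 0"
      by (metis diff_le_0_iff_le mult.commute)
    with R_der show ?thesis
      by (intro exI[of _ "(K' l * (exp l - 1) - K l * exp l) / ((exp l - 1) * (exp l - 1))"])
         (auto intro: divide_nonpos_nonneg)
  qed
  consider "l = 0" | "l > 0" | "l < 0" by linarith
  then show ?thesis
  proof cases
    case 1 then show ?thesis using assms by simp
  next
    case 2
    have "R l \<le> R s" if "0 < s" "s < l" for s
      using that R' by (intro DERIV_nonpos_imp_nonincreasing[of s l R]) auto
    then have "eventually (\<lambda>s. R l \<le> R s) (at_right 0)"
      using 2 by (auto simp: eventually_at_right_field)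
    moreover have "(R \<longlongrightarrow> 0) (at_right 0)" using lim by (rule filterlim_mono) (auto intro: at_le)
    ultimately have "R l \<le> 0" by (intro tendsto_lowerbound[of R 0 "at_right 0"]) auto
    then show ?thesis using 2 by (simp add: R_def divide_le_0_iff)
  next
    case 3
    have "R s \<le> R l" if "l < s" "s < 0" for s
      using that R' by (intro DERIV_nonpos_imp_nonincreasing[of l s R]) auto
    then have "eventually (\<lambda>s. R s \<le> R l) (at_left 0)"
      using 3 by (auto simp: eventually_at_left_field)
    moreover have "(R \<longlongrightarrow> 0) (at_left 0)" using lim by (rule filterlim_mono) (auto intro: at_le)
    ultimately have "R l \<ge> 0" by (intro tendsto_upperbound[of R 0 "at_left 0"]) auto
    then show ?thesis using 3 by (simp add: R_def zero_le_divide_iff)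
  qed
qed

text \<open>The usual condition bounds the sum of the decrements of \<open>Z\<close> by
  \<open>Z\<close> itself. With all decrements 0 or 1, that sum is the number of critical elements.
  Natural subtraction is avoided by writing a decrement of one with \<open>Suc\<close>.\<close>

definition self_bounding :: "'a set \<Rightarrow> ('a set \<Rightarrow> nat) \<Rightarrow> bool" where
  "self_bounding S Z \<longleftrightarrow> (\<forall>X\<subseteq>S. (\<forall>s\<in>X. Z (X - {s}) = Z X \<or> Suc (Z (X - {s})) = Z X) \<and>
     card {s \<in> X. Z (X - {s}) \<noteq> Z X} \<le> Z X)"

text \<open>The Herbst argument: the entropy inequality for \<open>exp (l * Z)\<close> becomes a
  differential inequality for its mean \<open>F l\<close>. The sign of \<open>l\<close> is free, so
  both tails follow from one bound.\<close>

lemma self_bounding_mgf: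
  fixes Z :: "'a set \<Rightarrow> nat"
  assumes S: "finite S" and p: "0 \<le> p" "p \<le> 1" and Z: "self_bounding S Z"
  shows "measure_pmf.expectation (bernoulli_subset S p) (\<lambda>X. exp (l * real (Z X)))
    \<le> exp (measure_pmf.expectation (bernoulli_subset S p) (\<lambda>X. real (Z X)) * (exp l - 1))"
proof -
  let ?E = "measure_pmf.expectation (bernoulli_subset S p)"
  define mu where "mu = ?E (\<lambda>X. real (Z X))"
  define F where "F = (\<lambda>l. ?E (\<lambda>X. exp (l * real (Z X))))"
  define F' where "F' = (\<lambda>l. ?E (\<lambda>X. real (Z X) * exp (l * real (Z X))))"
  have Fpos: "F l > 0" for l unfolding F_def using S by (intro expectation_bernoulli_subset_pos) auto
  \<comment> \<open>As a finite sum the expectation can be differentiated term by term in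
    \<open>l\<close>.\<close>
  have sums: "?E f = (\<Sum>X\<in>Pow S. pmf (bernoulli_subset S p) X * f X)" for f
    using S set_pmf_bernoulli_subset[of S p] by (subst integral_measure_pmf[of "Pow S"]) auto
  have F_der: "(F has_real_derivative F' l) (at l)" for l
    unfolding F_def F'_def sums by (auto intro!: derivative_eq_intros sum.cong)
  have ent: "(1 - exp (- l)) * F' l \<le> F l * ln (F l)" for l
  proof -
    define f where "f = (\<lambda>X. exp (l * real (Z X)))"
    have phi: "l - 1 + exp (- l) \<ge> 0"
      using exp_ge_add_one_self[of "- l"] by simp
    have "l * F' l - F l * ln (F l) = ?E (\<lambda>X. f X * ln (f X)) - ?E f * ln (?E f)"
    proof -
      have "l * F' l = ?E (\<lambda>X. l * (real (Z X) * exp (l * real (Z X))))" by (simp add: F'_def)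
      then show ?thesis by (simp add: F_def f_def mult_ac)
    qed
    also have "\<dots> \<le> ?E (\<lambda>X. \<Sum>s\<in>X. excess (f X) (f (X - {s})))"
      using S p by (intro entropy_bernoulli_subset) (auto simp: f_def)
    also have "\<dots> \<le> ?E (\<lambda>X. (l - 1 + exp (- l)) * (real (Z X) * exp (l * real (Z X))))"
    proof (rule expectation_bernoulli_subset_mono[OF S])
      fix X assume X: "X \<subseteq> S"
      have "finite X" using X S finite_subset by auto
      \<comment> \<open>Removing a critical element multiplies \<open>f\<close> by exactly
        \<open>exp (- l)\<close>, so all critical elements contribute the same amount.\<close>
      have "excess (f X) (f (X - {s})) = (if Z (X - {s}) \<noteq> Z X then f X * (l - 1 + exp (- l)) else 0)"
        if "s \<in> X" for s
      proof (cases "Z (X - {s}) = Z X")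
        case True
        then show ?thesis by (simp add: excess_def f_def)
      next
        case False
        then have "Suc (Z (X - {s})) = Z X" using Z X that unfolding self_bounding_def by blast
        then have eq: "real (Z X) = real (Z (X - {s})) + 1" by simp
        have "f (X - {s}) = f X * exp (- l)" by (simp add: f_def eq algebra_simps flip: exp_add)
        moreover have "f X / f (X - {s}) = exp l" by (simp add: f_def eq algebra_simps flip: exp_diff)
        then have "ln (f X / f (X - {s})) = l" by simp
        ultimately show ?thesis using False by (simp add: excess_def algebra_simps)
      qed
      then have "(\<Sum>s\<in>X. excess (f X) (f (X - {s})))
          = real (card {s \<in> X. Z (X - {s}) \<noteq> Z X}) * (f X * (l - 1 + exp (- l)))"
        using \<open>finite X\<close> by (simp add: sum.If_cases Collect_conj_eq)
      also have "\<dots> \<le> real (Z X) * (f X * (l - 1 + exp (- l)))"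
        using Z X phi by (intro mult_right_mono) (auto simp: self_bounding_def f_def)
      finally show "(\<Sum>s\<in>X. excess (f X) (f (X - {s})))
          \<le> (l - 1 + exp (- l)) * (real (Z X) * exp (l * real (Z X)))"
        by (simp add: f_def mult_ac)
    qed
    also have "\<dots> = (l - 1 + exp (- l)) * F' l"
      by (simp add: F'_def)
    finally show ?thesis by (simp add: algebra_simps)
  qed
  \<comment> \<open>The Poisson term \<open>mu * (exp l - 1)\<close> satisfies the differential
    inequality for \<open>ln (F l)\<close> with equality, so subtracting it preserves the
    inequality, and it makes the derivative vanish at 0.\<close>
  define K where "K = (\<lambda>l. ln (F l) - mu * (exp l - 1))"
  have "K l \<le> 0"
  proof (rule nonpos_of_exp_diff_inequality[where K = K and K' = "\<lambda>l. F' l / F l - mu * exp l"])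
    show "K 0 = 0" by (simp add: K_def F_def)
    show "F' 0 / F 0 - mu * exp 0 = 0" by (simp add: F'_def F_def mu_def)
    show "(K has_real_derivative F' l / F l - mu * exp l) (at l)" for l
      unfolding K_def using Fpos[of l]
      by (auto intro!: derivative_eq_intros F_der simp: field_simps)
    show "(1 - exp (- l)) * (F' l / F l - mu * exp l) \<le> K l" for l
      using ent[of l] Fpos[of l] by (simp add: K_def exp_minus field_simps)
  qed
  then have "ln (F l) \<le> mu * (exp l - 1)" by (simp add: K_def)
  then have "F l \<le> exp (mu * (exp l - 1))" using Fpos[of l] by (metis exp_le_cancel_iff exp_ln)
  then show ?thesis by (simp add: F_def mu_def)
qed

section \<open>Tail bounds for self-bounding functions\<close>

lemma chernoff_bernoulli_subset:
  fixes Z :: "'a set \<Rightarrow> real"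
  assumes S: "finite S"
  shows "measure_pmf.prob (bernoulli_subset S p) {X. Z X \<ge> a}
    \<le> measure_pmf.expectation (bernoulli_subset S p) (\<lambda>X. exp (Z X)) / exp a"
proof -
  have "{X. Z X \<ge> a} = {X \<in> space (bernoulli_subset S p). exp (Z X) \<ge> exp a}" by simp
  also have "measure_pmf.prob (bernoulli_subset S p) \<dots>
      \<le> measure_pmf.expectation (bernoulli_subset S p) (\<lambda>X. exp (Z X)) / exp a"
    using S by (intro integral_Markov_inequality_measure[where A = "{}"]) auto
  finally show ?thesis .
qed

lemma self_bounding_upper_tail:
  fixes Z :: "'a set \<Rightarrow> nat"
  assumes S: "finite S" and p: "0 \<le> p" "p \<le> 1" and Z: "self_bounding S Z"
    and mu: "measure_pmf.expectation (bernoulli_subset S p) (\<lambda>X. real (Z X)) \<le> mu" "mu > 0" and t: "t \<ge> 0"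
  shows "measure_pmf.prob (bernoulli_subset S p) {X. real (Z X) \<ge> mu + t} \<le> exp (- (t\<^sup>2 / (4 * (mu + t))))"
proof -
  \<comment> \<open>Not the optimal exponent, but it lies in \<open>[0, 1]\<close>, where
    \<open>exp l - 1\<close> is at most \<open>l + l\<^sup>2\<close>; the choice gives a clean bound
    for small and large \<open>t\<close> alike.\<close>
  define l where "l = t / (2 * (mu + t))"
  have l: "0 \<le> l" "l \<le> 1" using mu t by (auto simp: l_def field_simps)
  have "measure_pmf.prob (bernoulli_subset S p) {X. real (Z X) \<ge> mu + t}
      \<le> measure_pmf.prob (bernoulli_subset S p) {X. l * real (Z X) \<ge> l * (mu + t)}"
    using l by (intro measure_pmf.finite_measure_mono) (auto intro: mult_left_mono)
  also have "\<dots> \<le> exp (measure_pmf.expectation (bernoulli_subset S p) (\<lambda>X. real (Z X)) * (exp l - 1))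
      / exp (l * (mu + t))"
    by (rule order.trans[OF chernoff_bernoulli_subset[OF S]])
       (intro divide_right_mono self_bounding_mgf S p Z, simp)
  also have "\<dots> \<le> exp (mu * (l + l\<^sup>2)) / exp (l * (mu + t))"
    using mu l exp_bound[of l] by (intro divide_right_mono) (auto intro!: mult_mono)
  also have "\<dots> = exp (mu * l\<^sup>2 - l * t)" by (simp add: algebra_simps flip: exp_diff)
  also have "\<dots> \<le> exp (- (t\<^sup>2 / (4 * (mu + t))))"
  proof -
    have "mu * l\<^sup>2 - l * t = l * (mu * t / (2 * (mu + t)) - t)"
      by (simp add: l_def power2_eq_square algebra_simps)
    also have "\<dots> \<le> l * (t / 2 - t)"
      using mu t l by (intro mult_left_mono) (auto simp: field_simps)
    also have "\<dots> = - (t\<^sup>2 / (4 * (mu + t)))" by (simp add: l_def power2_eq_square)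
    finally show ?thesis by simp
  qed
  finally show ?thesis .
qed

lemma exp_minus_le_quadratic:
  fixes x :: real
  assumes "x \<ge> 0"
  shows "exp (- x) \<le> 1 - x + x\<^sup>2 / 2"
proof -
  define h where "h = (\<lambda>x::real. 1 - x + x\<^sup>2 / 2 - exp (- x))"
  have "h 0 \<le> h x"
    using assms
  proof (rule DERIV_nonneg_imp_nondecreasing)
    fix y :: real
    have "(h has_real_derivative - 1 + y + exp (- y)) (at y)"
      unfolding h_def by (auto intro!: derivative_eq_intros)
    moreover have "- 1 + y + exp (- y) \<ge> 0" using exp_ge_add_one_self[of "- y"] by simp
    ultimately show "\<exists>z. (h has_real_derivative z) (at y) \<and> 0 \<le> z" by blast
  qed
  then show ?thesis by (simp add: h_def)
qed

lemma self_bounding_lower_tail: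
  fixes Z :: "'a set \<Rightarrow> nat"
  assumes S: "finite S" and p: "0 \<le> p" "p \<le> 1" and Z: "self_bounding S Z"
    and mu: "mu = measure_pmf.expectation (bernoulli_subset S p) (\<lambda>X. real (Z X))" "mu > 0" and t: "t \<ge> 0"
  shows "measure_pmf.prob (bernoulli_subset S p) {X. real (Z X) \<le> mu - t} \<le> exp (- (t\<^sup>2 / (2 * mu)))"
proof -
  \<comment> \<open>The minimiser of \<open>mu * l\<^sup>2 / 2 - l * t\<close>.\<close>
  define l where "l = t / mu"
  have l: "0 \<le> l" using mu t by (auto simp: l_def)
  have "measure_pmf.prob (bernoulli_subset S p) {X. real (Z X) \<le> mu - t}
      \<le> measure_pmf.prob (bernoulli_subset S p) {X. (- l) * real (Z X) \<ge> (- l) * (mu - t)}"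
    using l by (intro measure_pmf.finite_measure_mono) (auto intro: mult_left_mono)
  also have "\<dots> \<le> exp (mu * (exp (- l) - 1)) / exp ((- l) * (mu - t))"
    unfolding mu(1)
    by (rule order.trans[OF chernoff_bernoulli_subset[OF S]])
       (intro divide_right_mono self_bounding_mgf S p Z, simp)
  also have "\<dots> \<le> exp (mu * (- l + l\<^sup>2 / 2)) / exp ((- l) * (mu - t))"
    using mu l exp_minus_le_quadratic[of l] by (intro divide_right_mono) (auto intro!: mult_left_mono)
  also have "\<dots> = exp (mu * l\<^sup>2 / 2 - l * t)" by (simp add: algebra_simps flip: exp_diff)
  also have "mu * l\<^sup>2 / 2 - l * t = - (t\<^sup>2 / (2 * mu))"
    using mu by (simp add: l_def power2_eq_square field_simps)
  finally show ?thesis .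
qed

section \<open>Non-crossing matchings as strict chains\<close>

definition strictly_below :: "nat \<Rightarrow> (nat \<Rightarrow> nat) \<Rightarrow> (nat \<Rightarrow> nat) \<Rightarrow> bool" where
  "strictly_below d e f \<longleftrightarrow> (\<forall>i<d. e i < f i)"

lemma noncrossing_matching_iff:
  "noncrossing_matching d F \<longleftrightarrow> pairwise (\<lambda>e f. strictly_below d e f \<or> strictly_below d f e) F"
proof -
  have "disjnt (edge_vertices d e) (edge_vertices d f) \<and> comparable d e f \<longleftrightarrow>
      strictly_below d e f \<or> strictly_below d f e" for e f :: "nat \<Rightarrow> nat"
  proof -
    have "disjnt (edge_vertices d e) (edge_vertices d f) \<longleftrightarrow> (\<forall>i<d. e i \<noteq> f i)"
      by (auto simp: disjnt_def edge_vertices_def)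
    then show ?thesis
      unfolding strictly_below_def comparable_def comp_le_def by (metis leD le_neq_implies_less less_imp_le)
  qed
  then show ?thesis by (simp add: noncrossing_matching_def)
qed

lemma noncrossing_matchingD:
  "noncrossing_matching d F \<Longrightarrow> e \<in> F \<Longrightarrow> f \<in> F \<Longrightarrow> e \<noteq> f \<Longrightarrow> strictly_below d e f \<or> strictly_below d f e"
  by (auto simp: noncrossing_matching_iff pairwise_def)

lemma noncrossing_matching_subset:
  "noncrossing_matching d F \<Longrightarrow> F' \<subseteq> F \<Longrightarrow> noncrossing_matching d F'"
  unfolding noncrossing_matching_def by (rule pairwise_subset)

lemma finite_noncrossing_subsets: "finite G \<Longrightarrow> finite {F. F \<subseteq> G \<and> noncrossing_matching d F}"
  by (rule finite_subset[of _ "Pow G"]) auto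

lemma card_le_max_noncrossing:
  assumes "finite G" "F \<subseteq> G" "noncrossing_matching d F"
  shows "card F \<le> max_noncrossing d G"
  unfolding max_noncrossing_def using assms
  by (intro Max_ge finite_imageI finite_noncrossing_subsets) auto

lemma max_noncrossing_obtains:
  assumes "finite G"
  obtains F where "F \<subseteq> G" "noncrossing_matching d F" "card F = max_noncrossing d G" "finite F"
proof -
  have "{} \<in> {F. F \<subseteq> G \<and> noncrossing_matching d F}"
    by (simp add: noncrossing_matching_def)
  then have "max_noncrossing d G \<in> card ` {F. F \<subseteq> G \<and> noncrossing_matching d F}"
    unfolding max_noncrossing_def using assms
    by (intro Max_in finite_imageI finite_noncrossing_subsets) blast+
  then obtain F where "F \<subseteq> G" "noncrossing_matching d F" "card F = max_noncrossing d G" by auto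
  then show ?thesis using assms finite_subset by (intro that[of F]) auto
qed

lemma max_noncrossing_mono:
  assumes "finite Y" "X \<subseteq> Y"
  shows "max_noncrossing d X \<le> max_noncrossing d Y"
proof -
  obtain F where "F \<subseteq> X" "noncrossing_matching d F" "card F = max_noncrossing d X"
    using max_noncrossing_obtains[of X d] assms finite_subset by metis
  then show ?thesis using card_le_max_noncrossing[of Y F d] assms by auto
qed

text \<open>Fix one maximum matching \<open>F\<close>. Deleting an edge outside \<open>F\<close>
  leaves \<open>F\<close> intact, and deleting an edge of \<open>F\<close> leaves a matching with
  one edge less. So every critical edge lies in \<open>F\<close>, whose size is the value of the
  function.\<close>

lemma self_bounding_max_noncrossing:
  assumes "finite S"
  shows "self_bounding S (max_noncrossing d)"
  unfolding self_bounding_def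
proof (intro allI impI conjI ballI)
  fix X assume "X \<subseteq> S"
  then have X: "finite X" using assms finite_subset by auto
  obtain F where F: "F \<subseteq> X" "noncrossing_matching d F" "card F = max_noncrossing d X" "finite F"
    using max_noncrossing_obtains[OF X] by metis
  have le: "max_noncrossing d (X - {s}) \<le> max_noncrossing d X" for s
    by (rule max_noncrossing_mono) (use X in auto)
  have ge: "card (F - {s}) \<le> max_noncrossing d (X - {s})" for s
    by (rule card_le_max_noncrossing) (use F X noncrossing_matching_subset[of d F] in auto)
  show "max_noncrossing d (X - {s}) = max_noncrossing d X \<or>
      Suc (max_noncrossing d (X - {s})) = max_noncrossing d X" for s
    using le[of s] ge[of s] F(3) card_Diff1_le[of F s] card_Suc_Diff1[OF F(4), of s]
    by (cases "s \<in> F") auto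
  have "{s \<in> X. max_noncrossing d (X - {s}) \<noteq> max_noncrossing d X} \<subseteq> F"
  proof safe
    fix s assume "max_noncrossing d (X - {s}) \<noteq> max_noncrossing d X"
    then show "s \<in> F" using le[of s] ge[of s] F(3) by (cases "s \<in> F") auto
  qed
  from card_mono[OF F(4) this]
  show "card {s \<in> X. max_noncrossing d (X - {s}) \<noteq> max_noncrossing d X} \<le> max_noncrossing d X"
    unfolding F(3) .
qed

lemma strictly_below_irrefl: "0 < d \<Longrightarrow> \<not> strictly_below d e e"
  by (auto simp: strictly_below_def)

lemma max_noncrossing_image_ge:
  assumes d: "0 < d" and X: "finite X"
    and h: "\<And>e f. e \<in> X \<Longrightarrow> f \<in> X \<Longrightarrow> strictly_below d e f \<Longrightarrow> strictly_below d (h e) (h f)"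
  shows "max_noncrossing d X \<le> max_noncrossing d (h ` X)"
proof -
  obtain F where F: "F \<subseteq> X" "noncrossing_matching d F" "card F = max_noncrossing d X" "finite F"
    using max_noncrossing_obtains[OF X] by metis
  have *: "strictly_below d (h e) (h f) \<or> strictly_below d (h f) (h e)"
    if "e \<in> F" "f \<in> F" "e \<noteq> f" for e f
    using noncrossing_matchingD[OF F(2) that] h that F(1) by blast
  then have "inj_on h F"
    using strictly_below_irrefl[OF d] by (intro inj_onI) metis
  moreover have "noncrossing_matching d (h ` F)"
    using * by (auto simp: noncrossing_matching_iff pairwise_def)
  ultimately show ?thesis
    using card_le_max_noncrossing[of "h ` X" "h ` F" d] X F by (simp add: card_image image_mono)
qed

text \<open>The elements carry an arbitrary type because the notion is used twice: for edges of a
  refined grid mapped to a coarse one, and for indices of sample points mapped to their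
  cells.\<close>

definition conflicts :: "nat \<Rightarrow> ('a \<Rightarrow> nat \<Rightarrow> nat) \<Rightarrow> 'a set \<Rightarrow> ('a \<times> 'a) set" where
  "conflicts d h X = {(x, y). x \<in> X \<and> y \<in> X \<and> x \<noteq> y \<and> (\<exists>i<d. h x i = h y i)}"

text \<open>Lift a maximum matching of the \<open>h0\<close>-image to representatives in
  \<open>X\<close> and discard the first member of every conflicting pair. The survivors are weakly
  ordered under \<open>h1\<close> and agree in no coordinate, hence are strictly ordered.\<close>

lemma max_noncrossing_le_conflicts:
  assumes d: "0 < d" and X: "finite X"
    and h: "\<And>e f. e \<in> X \<Longrightarrow> f \<in> X \<Longrightarrow> strictly_below d (h0 e) (h0 f) \<Longrightarrow> comp_le d (h1 e) (h1 f)"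
  shows "max_noncrossing d (h0 ` X) \<le> max_noncrossing d (h1 ` X) + card (conflicts d h1 X)"
proof -
  obtain F0 where F0: "F0 \<subseteq> h0 ` X" "noncrossing_matching d F0" "card F0 = max_noncrossing d (h0 ` X)"
      "finite F0"
    using max_noncrossing_obtains[of "h0 ` X" d] X by blast
  obtain F where F: "F \<subseteq> X" "inj_on h0 F" "F0 = h0 ` F"
    using subset_image_inj F0(1) by metis
  have finC: "finite (conflicts d h1 X)"
    by (rule finite_subset[of _ "X \<times> X"]) (use X in \<open>auto simp: conflicts_def\<close>)
  define F1 where "F1 = F - fst ` conflicts d h1 X"
  have *: "strictly_below d (h1 e) (h1 f) \<or> strictly_below d (h1 f) (h1 e)"
    if "e \<in> F1" "f \<in> F1" "e \<noteq> f" for e f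
  proof -
    have ef: "e \<in> F" "f \<in> F" "e \<in> X" "f \<in> X" using that F by (auto simp: F1_def)
    then have "h0 e \<noteq> h0 f" using that F(2) by (auto simp: inj_on_def)
    then have "strictly_below d (h0 e) (h0 f) \<or> strictly_below d (h0 f) (h0 e)"
      using noncrossing_matchingD[OF F0(2)] ef F(3) by auto
    then have le: "comp_le d (h1 e) (h1 f) \<or> comp_le d (h1 f) (h1 e)" using h ef by blast
    have "(e, f) \<notin> conflicts d h1 X" using that(1) by (force simp: F1_def)
    then have "h1 e i \<noteq> h1 f i" if "i < d" for i
      using ef \<open>e \<noteq> f\<close> that by (auto simp: conflicts_def)
    then show ?thesis using le unfolding strictly_below_def comp_le_def by (metis le_neq_implies_less)
  qed
  then have "inj_on h1 F1"
    using strictly_below_irrefl[OF d] by (intro inj_onI) metis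
  moreover have "noncrossing_matching d (h1 ` F1)"
    using * by (auto simp: noncrossing_matching_iff pairwise_def)
  ultimately have "card F1 \<le> max_noncrossing d (h1 ` X)"
    using card_le_max_noncrossing[of "h1 ` X" "h1 ` F1" d] X F
    by (metis Diff_subset F1_def card_image finite_imageI image_mono subset_trans)
  moreover have "card F \<le> card F1 + card (fst ` conflicts d h1 X)"
    unfolding F1_def using finC by (metis card_Diff_subset_Int add.commute diff_card_le_card_Diff le_diff_conv finite_imageI)
  moreover have "card (fst ` conflicts d h1 X) \<le> card (conflicts d h1 X)"
    by (rule card_image_le[OF finC])
  moreover have "card F0 = card F" using F by (simp add: card_image)
  ultimately show ?thesis using F0(3) by linarith
qed

text \<open>Superadditivity: chains chosen in successive blocks concatenate to one chain.\<close>

lemma sum_max_noncrossing_blocks_le: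
  fixes T :: nat
  assumes d: "0 < d" and X: "finite X"
    and B: "\<And>s t e f. s < t \<Longrightarrow> t < T \<Longrightarrow> e \<in> B s \<Longrightarrow> f \<in> B t \<Longrightarrow> strictly_below d e f"
  shows "(\<Sum>t<T. max_noncrossing d (X \<inter> B t)) \<le> max_noncrossing d X"
proof -
  have "\<forall>t. \<exists>F. F \<subseteq> X \<inter> B t \<and> noncrossing_matching d F \<and> card F = max_noncrossing d (X \<inter> B t) \<and> finite F"
    using max_noncrossing_obtains X by (metis finite_Int)
  then obtain F where F: "\<And>t. F t \<subseteq> X \<inter> B t" "\<And>t. noncrossing_matching d (F t)"
      "\<And>t. card (F t) = max_noncrossing d (X \<inter> B t)" "\<And>t. finite (F t)"
    by metis
  have sb: "strictly_below d e f" if "s < t" "t < T" "e \<in> F s" "f \<in> F t" for s t e f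
    using B[OF that(1,2)] that F(1) by blast
  have disj: "F s \<inter> F t = {}" if "s < t" "t < T" for s t
    using sb[OF that] strictly_below_irrefl[OF d] by blast
  have "F s \<inter> F t = {}" if "s < T" "t < T" "s \<noteq> t" for s t
    using disj[of s t] disj[of t s] that
    by (cases s t rule: linorder_cases) (simp_all add: Int_commute)
  then have "(\<Sum>t<T. card (F t)) = card (\<Union>t<T. F t)"
    using F(4) by (intro card_UN_disjoint[symmetric]) auto
  moreover have "noncrossing_matching d (\<Union>t<T. F t)"
    unfolding noncrossing_matching_iff pairwise_def
  proof (intro ballI impI)
    fix e f assume "e \<in> (\<Union>t<T. F t)" "f \<in> (\<Union>t<T. F t)" "e \<noteq> f"
    then obtain s t where st: "s < T" "t < T" "e \<in> F s" "f \<in> F t" by auto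
    consider "s < t" | "t < s" | "s = t" by linarith
    then show "strictly_below d e f \<or> strictly_below d f e"
      using st sb \<open>e \<noteq> f\<close> noncrossing_matchingD[OF F(2)] by cases blast+
  qed
  moreover have "(\<Union>t<T. F t) \<subseteq> X" using F(1) by auto
  ultimately show ?thesis using card_le_max_noncrossing[OF X, of "\<Union>t<T. F t" d] F(3) by simp
qed

text \<open>Every subset of a maximum matching is again a matching. This trades an exponential
  moment of the maximum for a count with an explicit mean.\<close>

lemma two_power_max_noncrossing_le:
  assumes "finite X"
  shows "2 ^ max_noncrossing d X \<le> card {F. F \<subseteq> X \<and> noncrossing_matching d F}"
proof -
  obtain F where F: "F \<subseteq> X" "noncrossing_matching d F" "card F = max_noncrossing d X" "finite F"
    using max_noncrossing_obtains[OF assms] by metis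
  have "2 ^ max_noncrossing d X = card (Pow F)" using F by (simp add: card_Pow)
  also have "\<dots> \<le> card {F. F \<subseteq> X \<and> noncrossing_matching d F}"
    using F noncrossing_matching_subset[OF F(2)]
    by (intro card_mono finite_noncrossing_subsets assms) auto
  finally show ?thesis .
qed

section \<open>Counting non-crossing matchings and the first moment bound\<close>

lemma finite_complete_edges [simp, intro]: "finite (complete_edges d n)"
  by (simp add: complete_edges_def finite_PiE)

lemma complete_edges_iff:
  "e \<in> complete_edges d n \<longleftrightarrow> e \<in> extensional {..<d} \<and> (\<forall>i<d. 1 \<le> e i \<and> e i \<le> n i)"
  unfolding complete_edges_def PiE_iff by simp blast

lemma card_complete_edges: "card (complete_edges d n) = (\<Prod>i<d. n i)"
  by (simp add: complete_edges_def card_PiE)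

lemma card_less_image_noncrossing:
  assumes "noncrossing_matching d F" "e \<in> F" "i < d"
  shows "card {a \<in> (\<lambda>f. f i) ` F. a < e i} = card {f \<in> F. strictly_below d f e}"
proof -
  have "f i < e i \<longleftrightarrow> strictly_below d f e" if "f \<in> F" for f
    using noncrossing_matchingD[OF assms(1,2) that] assms(3)
    by (cases "e = f") (auto simp: strictly_below_def)
  then have "{a \<in> (\<lambda>f. f i) ` F. a < e i} = (\<lambda>f. f i) ` {f \<in> F. strictly_below d f e}" by auto
  moreover have "inj_on (\<lambda>f. f i) F"
    using noncrossing_matchingD[OF assms(1)] assms(3)
    by (auto simp: inj_on_def strictly_below_def) (metis less_irrefl)
  then have "inj_on (\<lambda>f. f i) {f \<in> F. strictly_below d f e}" by (rule inj_on_subset) auto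
  ultimately show ?thesis by (simp add: card_image)
qed

lemma card_less_inj:
  fixes a b :: nat
  assumes "finite A" "a \<in> A" "b \<in> A" "card {x \<in> A. x < a} = card {x \<in> A. x < b}"
  shows "a = b"
proof -
  have *: "\<not> a < b" if "a \<in> A" "card {x \<in> A. x < a} = card {x \<in> A. x < b}" for a b
  proof
    assume "a < b"
    then have "{x \<in> A. x < a} \<subset> {x \<in> A. x < b}" using that by auto
    then have "card {x \<in> A. x < a} < card {x \<in> A. x < b}"
      by (rule psubset_card_mono[rotated]) (use assms(1) in simp)
    then show False using that(2) by simp
  qed
  show ?thesis using *[of a b] *[of b a] assms by (metis linorder_neqE_nat)
qed

text \<open>An edge of a non-crossing matching has the same rank in each of its projections.\<close>

lemma noncrossing_eq_if_projections_eq: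
  assumes d: "0 < d" and F: "F \<subseteq> complete_edges d n" "noncrossing_matching d F"
    and G: "G \<subseteq> complete_edges d n" "noncrossing_matching d G"
    and eq: "\<And>i. i < d \<Longrightarrow> (\<lambda>e. e i) ` F = (\<lambda>e. e i) ` G"
  shows "F \<subseteq> G"
proof
  fix e assume e: "e \<in> F"
  have fin: "finite F" "finite G" using F G finite_subset by (auto intro: finite_subset)
  \<comment> \<open>The candidate is matched with \<open>e\<close> in coordinate 0 only; equal ranks
    then force agreement in all coordinates.\<close>
  obtain g where g: "g \<in> G" "g 0 = e 0" using eq[OF d] e by (metis (no_types, lifting) imageE imageI)
  have "g i = e i" if "i < d" for i
  proof (rule card_less_inj[where A = "(\<lambda>e. e i) ` F"])
    show "finite ((\<lambda>e. e i) ` F)" using fin by simp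
    show "g i \<in> (\<lambda>e. e i) ` F" using eq[OF that] g by auto
    show "e i \<in> (\<lambda>e. e i) ` F" using e by auto
    show "card {x \<in> (\<lambda>e. e i) ` F. x < g i} = card {x \<in> (\<lambda>e. e i) ` F. x < e i}"
      using card_less_image_noncrossing[OF G(2) g(1) that] card_less_image_noncrossing[OF G(2) g(1) d]
        card_less_image_noncrossing[OF F(2) e that] card_less_image_noncrossing[OF F(2) e d]
        eq[OF that] eq[OF d] g(2) by simp
  qed
  moreover have "g \<in> complete_edges d n" "e \<in> complete_edges d n" using g e F G by auto
  ultimately have "g = e"
    unfolding complete_edges_def by (intro PiE_ext[of g "{..<d}" _ e]) auto
  then show "e \<in> G" using g by simp
qed

lemma sum_Pow_power_card:
  fixes x :: real
  assumes "finite S"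
  shows "(\<Sum>A\<in>Pow S. x ^ card A) = (1 + x) ^ card S"
  using prod_add[OF assms, of "\<lambda>_. x" "\<lambda>_. 1"] by (simp add: add.commute)

text \<open>A matching is determined by its \<open>d\<close> projections, which all have its
  cardinality. Dropping the requirement of equal cardinalities decouples the coordinates, and each
  factor is a binomial sum. The weights stay free so that they can be adapted to the class
  sizes.\<close>

lemma sum_noncrossing_le_prod:
  fixes x :: "nat \<Rightarrow> real"
  assumes d: "0 < d" and x: "\<And>i. x i \<ge> 0"
  shows "(\<Sum>F | F \<subseteq> complete_edges d n \<and> noncrossing_matching d F. (\<Prod>i<d. x i) ^ card F)
    \<le> (\<Prod>i<d. (1 + x i) ^ n i)"
proof -
  let ?C = "{F. F \<subseteq> complete_edges d n \<and> noncrossing_matching d F}"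
  let ?P = "\<Pi>\<^sub>E i\<in>{..<d}. Pow {1..n i}"
  define \<pi> where "\<pi> = (\<lambda>F::(nat \<Rightarrow> nat) set. \<lambda>i\<in>{..<d}. (\<lambda>e. e i) ` F)"
  have "inj_on \<pi> ?C"
  proof (rule inj_onI)
    fix F G assume FG: "F \<in> ?C" "G \<in> ?C" "\<pi> F = \<pi> G"
    have "(\<lambda>e. e i) ` F = (\<lambda>e. e i) ` G" if "i < d" for i
      using fun_cong[OF FG(3), of i] that by (simp add: \<pi>_def)
    then show "F = G"
      using noncrossing_eq_if_projections_eq[OF d, of F n G] noncrossing_eq_if_projections_eq[OF d, of G n F] FG
      by auto
  qed
  have card_eq: "card ((\<lambda>e. e i) ` F) = card F" if "F \<in> ?C" "i < d" for F i
    by (rule card_image, rule inj_onI)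
       (use noncrossing_matchingD[of d F] that in \<open>auto simp: strictly_below_def; metis less_irrefl\<close>)
  have "(\<Sum>F\<in>?C. (\<Prod>i<d. x i) ^ card F) = (\<Sum>F\<in>?C. \<Prod>i<d. x i ^ card (\<pi> F i))"
    by (intro sum.cong) (auto simp: \<pi>_def card_eq prod_power_distrib)
  also have "\<dots> = (\<Sum>A\<in>\<pi> ` ?C. \<Prod>i<d. x i ^ card (A i))"
    using \<open>inj_on \<pi> ?C\<close> by (simp add: sum.reindex)
  also have "\<dots> \<le> (\<Sum>A\<in>?P. \<Prod>i<d. x i ^ card (A i))"
  proof (rule sum_mono2)
    show "\<pi> ` ?C \<subseteq> ?P"
    proof (rule image_subsetI)
      fix F assume "F \<in> ?C"
      then have "e i \<in> {1..n i}" if "e \<in> F" "i < d" for e i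
        using that unfolding complete_edges_def by (auto dest!: subsetD PiE_mem)
      then show "\<pi> F \<in> ?P" unfolding \<pi>_def by auto
    qed
  qed (use x in \<open>auto intro!: prod_nonneg finite_PiE\<close>)
  also have "\<dots> = (\<Prod>i<d. \<Sum>A\<in>Pow {1..n i}. x i ^ card A)"
    by (simp add: prod_sum_PiE)
  also have "\<dots> = (\<Prod>i<d. (1 + x i) ^ n i)"
    by (simp add: sum_Pow_power_card)
  finally show ?thesis .
qed

definition geom_mean :: "nat \<Rightarrow> (nat \<Rightarrow> nat) \<Rightarrow> real" where
  "geom_mean d n = real (\<Prod>i<d. n i) powr (1 / real d)"

definition mean_noncrossing :: "nat \<Rightarrow> (nat \<Rightarrow> nat) \<Rightarrow> real \<Rightarrow> real" where
  "mean_noncrossing d n p = measure_pmf.expectation (bernoulli_subset (complete_edges d n) p)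
     (\<lambda>X. real (max_noncrossing d X))"

lemma geom_mean_power: "0 < d \<Longrightarrow> geom_mean d n ^ d = real (\<Prod>i<d. n i)"
proof -
  assume d: "0 < d"
  define P where "P = real (\<Prod>i<d. n i)"
  have "P \<ge> 0" by (simp only: P_def of_nat_0_le_iff)
  then have "(P powr (1 / real d)) ^ d = P"
    using d by (cases "P = 0") (simp_all add: powr_powr flip: powr_realpow)
  then show ?thesis by (simp only: geom_mean_def P_def)
qed

text \<open>The expected number of matchings in the random hypergraph is at most
  \<open>exp (d * M)\<close>, where \<open>M\<close> is the natural scale, while \<open>2\<close> to
  the maximum is at most that number. Taking logarithms inside the mean gives the claim.\<close>

lemma mean_noncrossing_le:
  assumes d: "0 < d" and n: "\<And>i. i < d \<Longrightarrow> n i > 0" and p: "0 < p" "p \<le> 1"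
  shows "ln 2 * mean_noncrossing d n p \<le> real d * (geom_mean d n * p powr (1 / real d))"
proof -
  let ?G = "complete_edges d n"
  let ?E = "measure_pmf.expectation (bernoulli_subset ?G p)"
  let ?C = "{F. F \<subseteq> ?G \<and> noncrossing_matching d F}"
  define M where "M = geom_mean d n * p powr (1 / real d)"
  have M: "M \<ge> 0" by (simp add: M_def geom_mean_def)
  \<comment> \<open>Chosen so that the weights multiply to \<open>p\<close> and each factor
    \<open>(1 + x i) ^ n i\<close> is at most \<open>exp M\<close>.\<close>
  define x where "x = (\<lambda>i. M / real (n i))"
  have "M ^ d = real (\<Prod>i<d. n i) * p"
    using d p by (simp add: M_def power_mult_distrib geom_mean_power powr_realpow[symmetric] powr_powr
      del: of_nat_prod)
  then have px: "(\<Prod>i<d. x i) = p" using n by (simp add: x_def prod_dividef)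
  have finC: "finite ?C" by (intro finite_noncrossing_subsets) simp
  have "?E (\<lambda>X. 2 powr real (max_noncrossing d X)) \<le> ?E (\<lambda>X. \<Sum>F\<in>?C. indicator {X. F \<subseteq> X} X)"
  proof (rule expectation_bernoulli_subset_mono)
    fix X assume X: "X \<subseteq> ?G"
    then have fX: "finite X" by (rule finite_subset) simp
    have "2 powr real (max_noncrossing d X) = real (2 ^ max_noncrossing d X)" by (simp add: powr_realpow)
    also have "\<dots> \<le> real (card {F. F \<subseteq> X \<and> noncrossing_matching d F})"
      using two_power_max_noncrossing_le[OF fX] by (simp only: of_nat_le_iff)
    also have "{F. F \<subseteq> X \<and> noncrossing_matching d F} = ?C \<inter> {F. F \<subseteq> X}" using X by auto
    also have "real (card \<dots>) = (\<Sum>F\<in>?C. indicator {X. F \<subseteq> X} X)"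
      using finC by (simp add: indicator_def sum.If_cases)
    finally show "2 powr real (max_noncrossing d X) \<le> (\<Sum>F\<in>?C. indicator {X. F \<subseteq> X} X)" .
  qed simp
  also have "\<dots> = (\<Sum>F\<in>?C. p ^ card F)"
    using p by (subst Bochner_Integration.integral_sum) (auto intro!: sum.cong simp: prob_bernoulli_subset_superset)
  also have "\<dots> \<le> (\<Prod>i<d. (1 + x i) ^ n i)"
    using sum_noncrossing_le_prod[OF d, of x n, unfolded px] M by (simp add: x_def)
  also have "\<dots> \<le> (\<Prod>i<d. exp M)"
  proof (rule prod_mono)
    fix i assume "i \<in> {..<d}"
    then have "n i > 0" using n by simp
    have "(1 + x i) ^ n i \<le> exp (x i) ^ n i"
      using M by (intro power_mono exp_ge_add_one_self) (auto simp: x_def)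
    also have "\<dots> = exp M" using \<open>n i > 0\<close> by (simp add: x_def flip: exp_of_nat_mult)
    finally show "0 \<le> (1 + x i) ^ n i \<and> (1 + x i) ^ n i \<le> exp M" using M by (simp add: x_def)
  qed
  also have "\<dots> = exp (real d * M)" by (simp add: exp_of_nat_mult)
  finally have exp_bound: "?E (\<lambda>X. 2 powr real (max_noncrossing d X)) \<le> exp (real d * M)" .
  \<comment> \<open>Jensen's inequality by hand: the tangent line bound for the exponential at the
    centred variable \<open>ln 2 * L - d * M\<close>.\<close>
  have "1 + ln 2 * mean_noncrossing d n p - real d * M
      = ?E (\<lambda>X. 1 + (ln 2 * real (max_noncrossing d X) - real d * M))"
    by (simp add: mean_noncrossing_def)
  also have "\<dots> \<le> ?E (\<lambda>X. 2 powr real (max_noncrossing d X) * exp (- (real d * M)))"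
  proof (rule expectation_bernoulli_subset_mono)
    fix X assume "X \<subseteq> ?G"
    show "1 + (ln 2 * real (max_noncrossing d X) - real d * M)
        \<le> 2 powr real (max_noncrossing d X) * exp (- (real d * M))"
      using exp_ge_add_one_self[of "ln 2 * real (max_noncrossing d X) - real d * M"]
      by (simp add: powr_def exp_diff exp_minus field_simps)
  qed simp
  also have "\<dots> \<le> exp (real d * M) * exp (- (real d * M))"
    using exp_bound by simp
  finally show ?thesis by (simp add: exp_minus M_def)
qed

section \<open>The mean size of a longest non-crossing matching\<close>

text \<open>Merges \<open>k i\<close> consecutive vertices of class \<open>i\<close> into one. The
  shifts by 1 are due to vertices being numbered from 1, while division groups numbers starting from
  0.\<close>

definition coarsen :: "nat \<Rightarrow> (nat \<Rightarrow> nat) \<Rightarrow> (nat \<Rightarrow> nat) \<Rightarrow> nat \<Rightarrow> nat" where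
  "coarsen d k e = (\<lambda>i\<in>{..<d}. (e i - 1) div k i + 1)"

lemma card_div_fibre:
  assumes "k > 0" "1 \<le> y" "y \<le> m"
  shows "card {a \<in> {1..m * k}. (a - 1) div k + 1 = y} = (k::nat)"
proof -
  have "{a \<in> {1..m * k}. (a - 1) div k + 1 = y} = {(y - 1) * k + 1 .. (y - 1) * k + k}"
  proof safe
    fix a assume a: "a \<in> {1..m * k}" "y = (a - 1) div k + 1"
    have "(a - 1) div k * k \<le> a - 1" "a - 1 < ((a - 1) div k) * k + k"
      using dividend_less_div_times[OF assms(1), of "a - 1"] by auto
    moreover have "1 \<le> a" using a(1) by simp
    ultimately show "a \<in> {((a - 1) div k + 1 - 1) * k + 1 .. ((a - 1) div k + 1 - 1) * k + k}"
      by (simp only: add_diff_cancel_right' atLeastAtMost_iff) linarith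
  next
    fix a assume a: "a \<in> {(y - 1) * k + 1 .. (y - 1) * k + k}"
    have "(y - 1) * k + k = y * k" using assms(2) by (cases y) auto
    also have "\<dots> \<le> m * k" using assms(3) by simp
    finally show "a \<in> {1..m * k}" using a by auto
    have "(a - 1) div k = y - 1"
      by (rule div_nat_eqI) (use a assms(1) in \<open>auto simp: algebra_simps\<close>)
    then show "(a - 1) div k + 1 = y" using assms(2) by simp
  qed
  then show ?thesis by simp
qed

lemma coarsen_in_complete_edges:
  assumes "\<And>i. i < d \<Longrightarrow> k i > 0" "e \<in> complete_edges d (\<lambda>i. m i * k i)"
  shows "coarsen d k e \<in> complete_edges d m"
proof -
  have "(e i - 1) div k i + 1 \<in> {1..m i}" if "i < d" for i
  proof -
    have "e i \<in> {1..m i * k i}" using assms(2) that by (simp add: complete_edges_iff)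
    then have "e i - 1 < m i * k i" by auto
    then have "(e i - 1) div k i < m i" using assms(1)[OF that] by (simp add: less_mult_imp_div_less)
    then show ?thesis by simp
  qed
  then show ?thesis by (simp add: coarsen_def complete_edges_iff)
qed

lemma card_coarsen_fibre:
  assumes "\<And>i. i < d \<Longrightarrow> k i > 0" "y \<in> complete_edges d m"
  shows "card {e \<in> complete_edges d (\<lambda>i. m i * k i). coarsen d k e = y} = (\<Prod>i<d. k i)"
proof -
  have y: "y \<in> extensional {..<d}" "\<And>i. i < d \<Longrightarrow> y i \<in> {1..m i}"
    using assms(2) by (auto simp: complete_edges_iff)
  have "{e \<in> complete_edges d (\<lambda>i. m i * k i). coarsen d k e = y}
      = (\<Pi>\<^sub>E i\<in>{..<d}. {a \<in> {1..m i * k i}. (a - 1) div k i + 1 = y i})"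
  proof (intro set_eqI)
    fix e
    have "coarsen d k e = y \<longleftrightarrow> (\<forall>i<d. (e i - 1) div k i + 1 = y i)"
      using y(1) by (auto simp: coarsen_def fun_eq_iff extensional_def)
    then show "e \<in> {e \<in> complete_edges d (\<lambda>i. m i * k i). coarsen d k e = y} \<longleftrightarrow>
        e \<in> (\<Pi>\<^sub>E i\<in>{..<d}. {a \<in> {1..m i * k i}. (a - 1) div k i + 1 = y i})"
      by (simp add: complete_edges_iff PiE_iff Ball_def) blast
  qed
  then have "card {e \<in> complete_edges d (\<lambda>i. m i * k i). coarsen d k e = y}
      = (\<Prod>i<d. card {a \<in> {1..m i * k i}. (a - 1) div k i + 1 = y i})"
    by (simp only: card_PiE[OF finite_lessThan])
  also have "\<dots> = (\<Prod>i<d. k i)"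
    by (intro prod.cong refl card_div_fibre) (use assms(1) y(2) in auto)
  finally show ?thesis .
qed

lemma bernoulli_subset_coarsen:
  assumes k: "\<And>i. i < d \<Longrightarrow> k i > 0" and q: "0 \<le> q" "q \<le> 1"
  shows "map_pmf (\<lambda>X. coarsen d k ` X) (bernoulli_subset (complete_edges d (\<lambda>i. m i * k i)) q)
    = bernoulli_subset (complete_edges d m) (1 - (1 - q) ^ (\<Prod>i<d. k i))"
proof -
  let ?F = "complete_edges d (\<lambda>i. m i * k i)"
  have "y \<in> coarsen d k ` ?F" if "y \<in> complete_edges d m" for y
  proof -
    have "(\<Prod>i<d. k i) > 0" using k by (simp add: prod_pos)
    then have "card {e \<in> ?F. coarsen d k e = y} > 0" using card_coarsen_fibre[where d = d and k = k, OF k that] by simp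
    then have "{e \<in> ?F. coarsen d k e = y} \<noteq> {}" using card_gt_0_iff by blast
    then show ?thesis by blast
  qed
  then have "coarsen d k ` ?F = complete_edges d m"
    using coarsen_in_complete_edges[where d = d and k = k, OF k] by blast
  then show ?thesis
    using bernoulli_subset_image[of ?F q "coarsen d k" "\<Prod>i<d. k i"] card_coarsen_fibre[where d = d and k = k, OF k] q by simp
qed

text \<open>Each coarse coordinate value takes a fraction \<open>1 / m i\<close> of all fine edges;
  clearing the denominator keeps the identity in the naturals.\<close>

lemma card_coarsen_slice:
  assumes k: "\<And>i. i < d \<Longrightarrow> k i > 0" and i: "i < d" and v: "v \<in> {1..m i}"
  shows "card {e \<in> complete_edges d (\<lambda>i. m i * k i). coarsen d k e i = v} * m i = (\<Prod>j<d. m j * k j)"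
proof -
  have "{e \<in> complete_edges d (\<lambda>i. m i * k i). coarsen d k e i = v}
      = (\<Pi>\<^sub>E j\<in>{..<d}. if j = i then {a \<in> {1..m i * k i}. (a - 1) div k i + 1 = v} else {1..m j * k j})"
  proof (intro set_eqI)
    fix e
    have "(\<forall>j<d. 1 \<le> e j \<and> e j \<le> m j * k j) \<and> (e i - 1) div k i + 1 = v \<longleftrightarrow>
      (\<forall>j<d. e j \<in> (if j = i then {a \<in> {1..m i * k i}. (a - 1) div k i + 1 = v} else {1..m j * k j}))"
      using i by auto
    then show "e \<in> {e \<in> complete_edges d (\<lambda>i. m i * k i). coarsen d k e i = v} \<longleftrightarrow>
      e \<in> (\<Pi>\<^sub>E j\<in>{..<d}. if j = i then {a \<in> {1..m i * k i}. (a - 1) div k i + 1 = v} else {1..m j * k j})"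
      using i by (simp add: complete_edges_iff coarsen_def PiE_iff Ball_def) blast
  qed
  then have "card {e \<in> complete_edges d (\<lambda>i. m i * k i). coarsen d k e i = v}
      = (\<Prod>j<d. if j = i then card {a \<in> {1..m i * k i}. (a - 1) div k i + 1 = v} else m j * k j)"
    by (simp only: card_PiE[OF finite_lessThan]) (intro prod.cong, auto)
  also have "\<dots> = (\<Prod>j<d. if j = i then k i else m j * k j)"
    using card_div_fibre[of "k i" v "m i"] k[OF i] v by (simp only: atLeastAtMost_iff)
  also have "\<dots> = k i * (\<Prod>j\<in>{..<d} - {i}. m j * k j)"
    using i by (subst prod.remove[of _ i]) (auto intro!: prod.cong)
  finally show ?thesis
    using i by (subst prod.remove[of _ i]) (auto simp: algebra_simps)
qed

text \<open>Union bound over the coordinate in which two edges collide: for each fine edge, a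
  fraction \<open>1 / m i\<close> of all edges shares its coarse coordinate
  \<open>i\<close>.\<close>

lemma card_conflicts_coarsen_le:
  assumes k: "\<And>i. i < d \<Longrightarrow> k i > 0" and m: "\<And>i. i < d \<Longrightarrow> m i > 0"
  shows "real (card (conflicts d (coarsen d k) (complete_edges d (\<lambda>i. m i * k i))))
    \<le> (real (\<Prod>i<d. m i * k i))\<^sup>2 * (\<Sum>i<d. 1 / real (m i))"
proof -
  let ?F = "complete_edges d (\<lambda>i. m i * k i)"
  let ?P = "\<Prod>i<d. m i * k i"
  let ?C = "\<lambda>i. Sigma ?F (\<lambda>e. {f \<in> ?F. coarsen d k f i = coarsen d k e i})"
  have "card (conflicts d (coarsen d k) ?F) \<le> card (\<Union>i<d. ?C i)"
    by (intro card_mono finite_UN_I finite_SigmaI) (auto simp: conflicts_def)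
  also have "\<dots> \<le> (\<Sum>i<d. card (?C i))" by (rule card_UN_le) simp
  finally have "real (card (conflicts d (coarsen d k) ?F)) \<le> (\<Sum>i<d. real (card (?C i)))"
    by (simp flip: of_nat_sum)
  also have "\<dots> = (\<Sum>i<d. (real ?P)\<^sup>2 * (1 / real (m i)))"
  proof (rule sum.cong)
    fix i assume "i \<in> {..<d}"
    then have i: "i < d" by simp
    have "real (card {f \<in> ?F. coarsen d k f i = coarsen d k e i}) = real ?P / real (m i)" if "e \<in> ?F" for e
    proof -
      have "coarsen d k e \<in> complete_edges d m" using coarsen_in_complete_edges[where d = d and k = k, OF k that] .
      then have "coarsen d k e i \<in> {1..m i}" using i by (simp add: complete_edges_iff)
      then have "real (card {f \<in> ?F. coarsen d k f i = coarsen d k e i}) * real (m i) = real ?P"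
        using card_coarsen_slice[where d = d and k = k, OF k i] by (simp only: of_nat_mult[symmetric])
      then show ?thesis using m[OF i] by (simp only: eq_divide_eq) simp
    qed
    then have "real (card (?C i)) = (\<Sum>e\<in>?F. real ?P / real (m i))"
      by (subst card_SigmaI) auto
    also have "\<dots> = (real ?P)\<^sup>2 * (1 / real (m i))"
      by (simp only: sum_constant card_complete_edges power2_eq_square) (simp del: of_nat_prod)
    finally show "real (card (?C i)) = (real ?P)\<^sup>2 * (1 / real (m i))" .
  qed simp
  finally show ?thesis by (simp only: sum_distrib_left)
qed

text \<open>A conflict consists of two distinct edges, both present with probability
  \<open>p\<^sup>2\<close>.\<close>

lemma expectation_conflicts_le:
  assumes S: "finite S" and p: "0 \<le> p" "p \<le> 1"
  shows "measure_pmf.expectation (bernoulli_subset S p) (\<lambda>X. real (card (conflicts d h X)))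
    \<le> p\<^sup>2 * real (card (conflicts d h S))"
proof -
  have finC: "finite (conflicts d h S)"
    by (rule finite_subset[of _ "S \<times> S"]) (use S in \<open>auto simp: conflicts_def\<close>)
  have "measure_pmf.expectation (bernoulli_subset S p) (\<lambda>X. real (card (conflicts d h X)))
      \<le> measure_pmf.expectation (bernoulli_subset S p)
          (\<lambda>X. \<Sum>z\<in>conflicts d h S. indicator {X. {fst z, snd z} \<subseteq> X} X)"
  proof (rule expectation_bernoulli_subset_mono[OF S])
    fix X assume "X \<subseteq> S"
    then have "conflicts d h X = conflicts d h S \<inter> {z. {fst z, snd z} \<subseteq> X}"
      by (auto simp: conflicts_def)
    then show "real (card (conflicts d h X)) \<le> (\<Sum>z\<in>conflicts d h S. indicator {X. {fst z, snd z} \<subseteq> X} X)"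
      using finC by (simp add: indicator_def sum.If_cases)
  qed
  also have "\<dots> = (\<Sum>z\<in>conflicts d h S. measure_pmf.prob (bernoulli_subset S p) {X. {fst z, snd z} \<subseteq> X})"
    using S by (subst Bochner_Integration.integral_sum) auto
  also have "\<dots> = (\<Sum>z\<in>conflicts d h S. p\<^sup>2)"
  proof (rule sum.cong)
    fix z assume "z \<in> conflicts d h S"
    then have "{fst z, snd z} \<subseteq> S" "fst z \<noteq> snd z" by (auto simp: conflicts_def)
    then show "measure_pmf.prob (bernoulli_subset S p) {X. {fst z, snd z} \<subseteq> X} = p\<^sup>2"
      using prob_bernoulli_subset_superset[OF S p, of "{fst z, snd z}"] by (simp add: power2_eq_square)
  qed simp
  finally show ?thesis by (simp add: mult.commute)
qed

text \<open>The two grids are compared on their common refinement: a strict chain of the first grid lifts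
  to a strict chain of the refinement, which is weakly increasing in the second grid.\<close>

lemma mean_noncrossing_change_grid:
  assumes d: "0 < d" and n: "\<And>i. i < d \<Longrightarrow> n i > 0" and b: "\<And>i. i < d \<Longrightarrow> b i > 0"
    and q: "0 \<le> q" "q \<le> 1"
  shows "mean_noncrossing d n (1 - (1 - q) ^ (\<Prod>i<d. b i))
      - (q * real (\<Prod>i<d. n i) * real (\<Prod>i<d. b i))\<^sup>2 * (\<Sum>i<d. 1 / real (b i))
    \<le> mean_noncrossing d b (1 - (1 - q) ^ (\<Prod>i<d. n i))"
proof -
  define F where "F = complete_edges d (\<lambda>i. n i * b i)"
  \<comment> \<open>The same edge set read in two ways: as the \<open>n\<close>-grid with sides
    subdivided by \<open>b\<close>, and as the \<open>b\<close>-grid with sides subdivided by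
    \<open>n\<close>.\<close>
  have F': "F = complete_edges d (\<lambda>i. b i * n i)" by (simp add: F_def mult.commute)
  have finF: "finite F" by (simp add: F_def)
  let ?E = "measure_pmf.expectation (bernoulli_subset F q)"
  have 1: "mean_noncrossing d n (1 - (1 - q) ^ (\<Prod>i<d. b i))
      = ?E (\<lambda>X. real (max_noncrossing d (coarsen d b ` X)))"
  proof -
    have "map_pmf (\<lambda>X. coarsen d b ` X) (bernoulli_subset F q)
        = bernoulli_subset (complete_edges d n) (1 - (1 - q) ^ (\<Prod>i<d. b i))"
      unfolding F_def by (rule bernoulli_subset_coarsen) (use b q in auto)
    from this[symmetric] show ?thesis by (simp only: mean_noncrossing_def) simp
  qed
  have 2: "mean_noncrossing d b (1 - (1 - q) ^ (\<Prod>i<d. n i))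
      = ?E (\<lambda>X. real (max_noncrossing d (coarsen d n ` X)))"
  proof -
    have "map_pmf (\<lambda>X. coarsen d n ` X) (bernoulli_subset F q)
        = bernoulli_subset (complete_edges d b) (1 - (1 - q) ^ (\<Prod>i<d. n i))"
      unfolding F' by (rule bernoulli_subset_coarsen) (use n q in auto)
    from this[symmetric] show ?thesis by (simp only: mean_noncrossing_def) simp
  qed
  have "?E (\<lambda>X. real (max_noncrossing d (coarsen d b ` X)))
      \<le> ?E (\<lambda>X. real (max_noncrossing d (coarsen d n ` X)) + real (card (conflicts d (coarsen d n) X)))"
  proof (rule expectation_bernoulli_subset_mono[OF finF])
    fix X assume X: "X \<subseteq> F"
    have "max_noncrossing d (coarsen d b ` X)
        \<le> max_noncrossing d (coarsen d n ` X) + card (conflicts d (coarsen d n) X)"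
    proof (rule max_noncrossing_le_conflicts[OF d])
      show "finite X" using X finF finite_subset by auto
      fix e f assume "strictly_below d (coarsen d b e) (coarsen d b f)"
      then have "(e i - 1) div b i < (f i - 1) div b i" if "i < d" for i
        using that by (auto simp: strictly_below_def coarsen_def)
      then have "e i - 1 \<le> f i - 1" if "i < d" for i
        using that by (metis div_le_mono leD nat_le_linear)
      then show "comp_le d (coarsen d n e) (coarsen d n f)"
        by (auto simp: comp_le_def coarsen_def div_le_mono)
    qed
    then show "real (max_noncrossing d (coarsen d b ` X))
        \<le> real (max_noncrossing d (coarsen d n ` X)) + real (card (conflicts d (coarsen d n) X))"
      by simp
  qed
  also have "\<dots> = ?E (\<lambda>X. real (max_noncrossing d (coarsen d n ` X)))
      + ?E (\<lambda>X. real (card (conflicts d (coarsen d n) X)))"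
    using finF by simp
  also have "?E (\<lambda>X. real (card (conflicts d (coarsen d n) X)))
      \<le> q\<^sup>2 * real (card (conflicts d (coarsen d n) F))"
    by (rule expectation_conflicts_le[OF finF q])
  also have "\<dots> \<le> q\<^sup>2 * ((real (\<Prod>i<d. b i * n i))\<^sup>2 * (\<Sum>i<d. 1 / real (b i)))"
    unfolding F' using card_conflicts_coarsen_le[where d = d and k = n and m = b, OF n b] by (intro mult_left_mono) auto
  also have "\<dots> = (q * real (\<Prod>i<d. n i) * real (\<Prod>i<d. b i))\<^sup>2 * (\<Sum>i<d. 1 / real (b i))"
    by (simp only: prod.distrib of_nat_mult power_mult_distrib mult_ac)
  finally show ?thesis unfolding 1 2 by simp
qed

section \<open>Monotonicity and superadditivity of the mean\<close>

lemma mean_noncrossing_mono_prob: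
  assumes "0 \<le> p" "p \<le> r" "r \<le> 1"
  shows "mean_noncrossing d n p \<le> mean_noncrossing d n r"
  unfolding mean_noncrossing_def
proof (rule expectation_bernoulli_subset_mono_prob[OF _ assms])
  fix X Y :: "(nat \<Rightarrow> nat) set" assume "X \<subseteq> Y" "Y \<subseteq> complete_edges d n"
  moreover from this have "finite Y" using finite_complete_edges finite_subset by blast
  ultimately show "real (max_noncrossing d X) \<le> real (max_noncrossing d Y)"
    using max_noncrossing_mono by simp
qed simp

text \<open>The translates of the small grid by multiples \<open>t * b\<close> are strictly ordered
  along the diagonal, and each carries a copy of the small random hypergraph. Linearity of
  expectation adds up their contributions.\<close>

lemma mean_noncrossing_blocks:
  assumes d: "0 < d" and p: "0 \<le> p" "p \<le> 1" and T: "\<And>i. i < d \<Longrightarrow> T * b i \<le> n i"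
  shows "real T * mean_noncrossing d b p \<le> mean_noncrossing d n p"
proof -
  define sh where "sh = (\<lambda>t e. \<lambda>i\<in>{..<d}. e i + t * b i)"
  define B where "B = (\<lambda>t. sh t ` complete_edges d b)"
  let ?E = "measure_pmf.expectation (bernoulli_subset (complete_edges d n) p)"
  have mem: "1 \<le> e i \<and> e i \<le> b i" if "e \<in> complete_edges d b" "i < d" for e i
    using that by (simp add: complete_edges_iff)
  have B_sub: "B t \<subseteq> complete_edges d n" if "t < T" for t
  proof -
    have "e i + t * b i \<le> n i" if "e \<in> complete_edges d b" "i < d" for e i
    proof -
      have "e i + t * b i \<le> Suc t * b i" using mem[OF that] by simp
      also have "\<dots> \<le> T * b i" using \<open>t < T\<close> by (intro mult_right_mono) auto
      finally show ?thesis using T[OF that(2)] by simp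
    qed
    then show ?thesis using mem by (auto simp: B_def sh_def complete_edges_iff trans_le_add1)
  qed
  have block: "mean_noncrossing d b p \<le> ?E (\<lambda>X. real (max_noncrossing d (X \<inter> B t)))" if "t < T" for t
  proof -
    have "inj_on (sh t) (complete_edges d b)"
    proof (rule inj_onI)
      fix e f assume ef: "e \<in> complete_edges d b" "f \<in> complete_edges d b" "sh t e = sh t f"
      have "e i = f i" if "i < d" for i
        using fun_cong[OF ef(3), of i] that by (simp add: sh_def)
      then show "e = f" using ef unfolding complete_edges_def by (intro PiE_ext[of e "{..<d}" _ f]) auto
    qed
    then have law: "map_pmf (\<lambda>X. sh t ` X) (bernoulli_subset (complete_edges d b) p) = bernoulli_subset (B t) p"
      unfolding B_def using p by (intro bernoulli_subset_image_inj) auto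
    have "mean_noncrossing d b p
        \<le> measure_pmf.expectation (bernoulli_subset (complete_edges d b) p)
            (\<lambda>X. real (max_noncrossing d (sh t ` X)))"
      unfolding mean_noncrossing_def
    proof (rule expectation_bernoulli_subset_mono)
      fix X assume "X \<subseteq> complete_edges d b"
      then have "finite X" using finite_complete_edges finite_subset by blast
      then have "max_noncrossing d X \<le> max_noncrossing d (sh t ` X)"
        by (intro max_noncrossing_image_ge d) (auto simp: strictly_below_def sh_def)
      then show "real (max_noncrossing d X) \<le> real (max_noncrossing d (sh t ` X))" by simp
    qed simp
    also have "\<dots> = measure_pmf.expectation (bernoulli_subset (B t) p) (\<lambda>X. real (max_noncrossing d X))"
      unfolding law[symmetric] by simp
    also have "B t = complete_edges d n \<inter> B t" using B_sub[OF that] by auto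
    also have "measure_pmf.expectation (bernoulli_subset (complete_edges d n \<inter> B t) p)
        (\<lambda>X. real (max_noncrossing d X)) = ?E (\<lambda>X. real (max_noncrossing d (X \<inter> B t)))"
      using p by (subst bernoulli_subset_Int[symmetric]) auto
    finally show ?thesis .
  qed
  have "real T * mean_noncrossing d b p \<le> (\<Sum>t<T. ?E (\<lambda>X. real (max_noncrossing d (X \<inter> B t))))"
    using block sum_mono[of "{..<T}" "\<lambda>_. mean_noncrossing d b p"] by simp
  also have "\<dots> = ?E (\<lambda>X. \<Sum>t<T. real (max_noncrossing d (X \<inter> B t)))" by simp
  also have "\<dots> \<le> ?E (\<lambda>X. real (max_noncrossing d X))"
  proof (rule expectation_bernoulli_subset_mono)
    fix X assume "X \<subseteq> complete_edges d n"
    then have "finite X" using finite_complete_edges finite_subset by blast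
    then have "(\<Sum>t<T. max_noncrossing d (X \<inter> B t)) \<le> max_noncrossing d X"
    proof (rule sum_max_noncrossing_blocks_le[OF d])
      fix s t e f assume st: "s < t" "t < T" and ef: "e \<in> B s" "f \<in> B t"
      obtain e' f' where e': "e' \<in> complete_edges d b" "e = sh s e'" and f': "f' \<in> complete_edges d b" "f = sh t f'"
        using ef by (auto simp: B_def)
      show "strictly_below d e f"
        unfolding strictly_below_def
      proof (intro allI impI)
        fix i assume i: "i < d"
        have "e i \<le> Suc s * b i" using mem[OF e'(1) i] i by (simp add: e'(2) sh_def)
        also have "\<dots> \<le> t * b i" using st by (intro mult_right_mono) auto
        also have "\<dots> < f i" using mem[OF f'(1) i] i by (simp add: f'(2) sh_def)
        finally show "e i < f i" .
      qed
    qed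
    then show "(\<Sum>t<T. real (max_noncrossing d (X \<inter> B t))) \<le> real (max_noncrossing d X)"
      by (simp flip: of_nat_sum)
  qed simp
  finally show ?thesis by (simp add: mean_noncrossing_def)
qed

text \<open>The intensity of a Poisson process that hits a unit cell with probability \<open>p\<close>.\<close>

definition intensity :: "real \<Rightarrow> real" where
  "intensity p = - ln (1 - p)"

lemma intensity_ge: "0 \<le> p \<Longrightarrow> p < 1 \<Longrightarrow> p \<le> intensity p"
  using ln_le_minus_one[of "1 - p"] by (simp add: intensity_def)

lemma intensity_pos: "0 < p \<Longrightarrow> p < 1 \<Longrightarrow> 0 < intensity p"
  using intensity_ge[of p] by simp

section \<open>The extremal constant\<close>

lemma geom_mean_pos: "(\<And>i. i < d \<Longrightarrow> n i > 0) \<Longrightarrow> geom_mean d n > 0"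
  by (auto simp: geom_mean_def)

text \<open>Refining a grid by factors \<open>k i\<close> multiplies the number of edges by their
  product and divides the matching \<open>intensity\<close> by it, so the denominator is invariant
  under the passage to refinements.\<close>

definition chain_sup :: "nat \<Rightarrow> real" where
  "chain_sup d = Sup {mean_noncrossing d n p / (geom_mean d n * intensity p powr (1 / real d)) | n p.
     (\<forall>i<d. n i > 0) \<and> 0 < p \<and> p < 1}"

lemma bdd_above_mean_noncrossing_ratio:
  assumes d: "0 < d"
  shows "bdd_above {mean_noncrossing d n p / (geom_mean d n * intensity p powr (1 / real d)) | n p.
     (\<forall>i<d. n i > 0) \<and> 0 < p \<and> p < 1}"
proof (rule bdd_aboveI)
  fix x assume "x \<in> {mean_noncrossing d n p / (geom_mean d n * intensity p powr (1 / real d)) | n p.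
     (\<forall>i<d. n i > 0) \<and> 0 < p \<and> p < 1}"
  then obtain n p where x: "x = mean_noncrossing d n p / (geom_mean d n * intensity p powr (1 / real d))"
    and n: "\<And>i. i < d \<Longrightarrow> n i > 0" and p: "0 < p" "p < 1" by auto
  have pos: "geom_mean d n * intensity p powr (1 / real d) > 0"
    using geom_mean_pos[of d n] n intensity_pos[OF p] by simp
  have "ln 2 * mean_noncrossing d n p \<le> real d * (geom_mean d n * p powr (1 / real d))"
    using mean_noncrossing_le[OF d n p(1)] p by simp
  also have "\<dots> \<le> real d * (geom_mean d n * intensity p powr (1 / real d))"
    using intensity_ge[of p] p geom_mean_pos[of d n] n by (intro mult_left_mono powr_mono2) (auto intro: less_imp_le)
  finally have "mean_noncrossing d n p \<le> real d / ln 2 * (geom_mean d n * intensity p powr (1 / real d))"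
    by (simp add: field_simps)
  then show "x \<le> real d / ln 2" unfolding x using pos by (subst pos_divide_le_eq)
qed

lemma mean_noncrossing_le_chain_sup:
  assumes d: "0 < d" and n: "\<And>i. i < d \<Longrightarrow> n i > 0" and p: "0 < p" "p < 1"
  shows "mean_noncrossing d n p \<le> chain_sup d * (geom_mean d n * intensity p powr (1 / real d))"
proof -
  have pos: "geom_mean d n * intensity p powr (1 / real d) > 0"
    using geom_mean_pos[of d n] n intensity_pos[OF p] by simp
  have "mean_noncrossing d n p / (geom_mean d n * intensity p powr (1 / real d)) \<le> chain_sup d"
    unfolding chain_sup_def using n p
    by (intro cSup_upper bdd_above_mean_noncrossing_ratio d) blast
  then show ?thesis using pos by (subst (asm) pos_divide_le_eq)
qed

lemma mean_noncrossing_pos: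
  assumes n: "\<And>i. i < d \<Longrightarrow> n i > 0" and p: "0 < p" "p \<le> 1"
  shows "mean_noncrossing d n p > 0"
proof -
  define e where "e = (\<lambda>i\<in>{..<d}. 1::nat)"
  have e: "{e} \<subseteq> complete_edges d n" using n by (auto simp: e_def complete_edges_iff Suc_le_eq)
  have "p = measure_pmf.expectation (bernoulli_subset (complete_edges d n) p) (indicator {X. {e} \<subseteq> X})"
    using prob_bernoulli_subset_superset[OF finite_complete_edges, of p "{e}"] e p by simp
  also have "\<dots> \<le> mean_noncrossing d n p"
    unfolding mean_noncrossing_def
  proof (rule expectation_bernoulli_subset_mono)
    fix X assume "X \<subseteq> complete_edges d n"
    then have "finite X" using finite_complete_edges finite_subset by blast
    then have "card {e} \<le> max_noncrossing d X" if "{e} \<subseteq> X"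
      using that by (intro card_le_max_noncrossing) (auto simp: noncrossing_matching_def)
    then show "indicator {X. {e} \<subseteq> X} X \<le> real (max_noncrossing d X)"
      by (auto simp: indicator_def)
  qed simp
  finally show ?thesis using p by simp
qed

lemma chain_sup_pos:
  assumes d: "0 < d"
  shows "chain_sup d > 0"
proof -
  have "0 < mean_noncrossing d (\<lambda>_. 1) (1/2)" by (rule mean_noncrossing_pos) auto
  also have "\<dots> \<le> chain_sup d * (geom_mean d (\<lambda>_. 1) * intensity (1/2) powr (1 / real d))"
    by (rule mean_noncrossing_le_chain_sup[OF d]) auto
  finally have "0 < chain_sup d * (geom_mean d (\<lambda>_. 1) * intensity (1/2) powr (1 / real d))" .
  moreover have "geom_mean d (\<lambda>_. 1) * intensity (1/2) powr (1 / real d) > 0"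
    using geom_mean_pos[of d "\<lambda>_. 1"] intensity_pos[of "1/2"] by simp
  ultimately show ?thesis by (rule zero_less_mult_pos2)
qed

lemma chain_sup_approx:
  assumes d: "0 < d" and e: "0 < e"
  obtains n p where "\<And>i. i < d \<Longrightarrow> n i > 0" "0 < p" "p < 1"
    "mean_noncrossing d n p \<ge> (1 - e) * chain_sup d * (geom_mean d n * intensity p powr (1 / real d))"
proof -
  let ?R = "{mean_noncrossing d n p / (geom_mean d n * intensity p powr (1 / real d)) | n p.
     (\<forall>i<d. n i > 0) \<and> 0 < p \<and> p < 1}"
  have "(1 - e) * chain_sup d < chain_sup d" using chain_sup_pos[OF d] e by simp
  moreover have "mean_noncrossing d (\<lambda>_. 1) (1/2) / (geom_mean d (\<lambda>_. 1) * intensity (1/2) powr (1 / real d)) \<in> ?R"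
    by (intro CollectI exI[of _ "\<lambda>_. 1"] exI[of _ "1/2"]) auto
  then have "?R \<noteq> {}" by blast
  ultimately have "\<exists>x\<in>?R. (1 - e) * chain_sup d < x"
    unfolding chain_sup_def using less_cSup_iff[OF _ bdd_above_mean_noncrossing_ratio[OF d]] by blast
  then obtain n p where np: "\<And>i. i < d \<Longrightarrow> n i > 0" "0 < p" "p < 1"
    "(1 - e) * chain_sup d < mean_noncrossing d n p / (geom_mean d n * intensity p powr (1 / real d))"
    by auto
  have "geom_mean d n * intensity p powr (1 / real d) > 0"
    using geom_mean_pos[of d n] np(1) intensity_pos[OF np(2,3)] by simp
  then show ?thesis using np by (intro that[of n p]) (auto simp: pos_less_divide_eq)
qed

text \<open>Let \<open>a\<close> be the scale of a nearly extremal grid. The target is cut into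
  about \<open>M / a\<close> diagonal blocks proportional to it, each of expected volume at least
  \<open>v = a ^ d\<close>. By comparison with the extremal grid each block contributes about
  \<open>c * a\<close>, in total about \<open>c * M\<close>. The constants depend only on the
  extremal grid and on \<delta>.\<close>

lemma mean_noncrossing_lower:
  assumes d: "0 < d" and \<delta>: "0 < \<delta>" "\<delta> \<le> 1"
  shows "\<exists>B>0. \<exists>A>0. \<forall>n p. 0 < p \<and> p < 1 \<and> geom_mean d n * p powr (1 / real d) \<ge> A \<and>
      (\<forall>i<d. real (n i) \<ge> B * (geom_mean d n * p powr (1 / real d))) \<longrightarrow>
      mean_noncrossing d n p \<ge> (1 - \<delta>) * chain_sup d * (geom_mean d n * p powr (1 / real d))"
proof -
  \<comment> \<open>A block loses \<open>2 * e\<close> (near-extremality and conflicts), the number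
    of blocks another \<open>2 * e\<close> (enlargement and rounding), and
    \<open>(1 - 2 * e) * (1 - 2 * e)\<close> is at least \<open>1 - 4 * e\<close>.\<close>
  define e where "e = \<delta> / 4"
  have e: "0 < e" "e \<le> 1/4" using \<delta> by (auto simp: e_def)
  let ?c = "chain_sup d"
  have c: "?c > 0" by (rule chain_sup_pos[OF d])
  obtain n0 q0 where n0: "\<And>i. i < d \<Longrightarrow> n0 i > 0" and q0: "0 < q0" "q0 < 1"
    and app: "mean_noncrossing d n0 q0 \<ge> (1 - e) * ?c * (geom_mean d n0 * intensity q0 powr (1 / real d))"
    using chain_sup_approx[OF d e(1)] by metis
  define a where "a = geom_mean d n0 * intensity q0 powr (1 / real d)"
  define v where "v = real (\<Prod>i<d. n0 i) * intensity q0"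
  have a: "a > 0" unfolding a_def using geom_mean_pos[of d n0] n0 intensity_pos[OF q0] by simp
  have ad: "a ^ d = v"
    unfolding a_def v_def power_mult_distrib geom_mean_power[OF d]
    using intensity_pos[OF q0] d by (simp add: powr_powr flip: powr_realpow)
  have v: "v > 0" using a ad by (metis zero_less_power)
  \<comment> \<open>The first term makes rounding the block sides cost at most a factor
    \<open>1 + e\<close>; the second makes the expected number of conflicts in a block at most
    \<open>e * c * a\<close>.\<close>
  define B where "B = max (1 / (a * e)) (v\<^sup>2 * real d / (e * ?c * a\<^sup>2))"
  \<comment> \<open>With \<open>M\<close> at least \<open>a / e\<close>, rounding down the number of
    blocks loses at most an \<open>e\<close>-fraction of \<open>M\<close>.\<close>
  define A where "A = a / e"
  have B: "B > 0" "B \<ge> 1 / (a * e)" "B \<ge> v\<^sup>2 * real d / (e * ?c * a\<^sup>2)"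
    unfolding B_def using a e by (auto simp: less_max_iff_disj)
  have A: "A > 0" using a e by (simp add: A_def)
  have main: "mean_noncrossing d n p \<ge> (1 - \<delta>) * ?c * (geom_mean d n * p powr (1 / real d))"
    if p: "0 < p" "p < 1" and M_ge: "geom_mean d n * p powr (1 / real d) \<ge> A"
      and n_ge: "\<forall>i<d. real (n i) \<ge> B * (geom_mean d n * p powr (1 / real d))" for n p
  proof -
    define M where "M = geom_mean d n * p powr (1 / real d)"
    have M: "M \<ge> A" "M > 0" using M_ge A by (auto simp: M_def)
    have n_ge: "real (n i) \<ge> B * M" if "i < d" for i using n_ge that by (simp add: M_def)
    have Md: "M ^ d = real (\<Prod>i<d. n i) * p"
      unfolding M_def power_mult_distrib geom_mean_power[OF d]
      using p d by (simp add: powr_powr flip: powr_realpow)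
    \<comment> \<open>Ideal block sides, enlarged by \<open>1 + e\<close> so that after rounding
      down the block volume still reaches \<open>v / p\<close>.\<close>
    define \<beta> where "\<beta> = (\<lambda>i. real (n i) * a * (1 + e) / M)"
    define b where "b = (\<lambda>i. nat \<lfloor>\<beta> i\<rfloor>)"
    define T where "T = nat \<lfloor>M / (a * (1 + e))\<rfloor>"
    have \<beta>_ge: "\<beta> i \<ge> B * a * (1 + e)" if "i < d" for i
    proof -
      have "(B * M) * (a * (1 + e)) \<le> real (n i) * (a * (1 + e))"
        using n_ge[OF that] a e by (intro mult_right_mono) auto
      then show ?thesis using M(2) by (simp add: \<beta>_def pos_le_divide_eq mult_ac)
    qed
    have \<beta>0: "\<beta> i \<ge> 0" for i using M a e by (simp add: \<beta>_def)
    have b_le: "real (b i) \<le> \<beta> i" for i using \<beta>0 by (simp add: b_def)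
    have b_ge: "real (b i) \<ge> \<beta> i / (1 + e)" if "i < d" for i
    proof -
      have "1 / e * (1 + e) \<le> B * a * (1 + e)"
        using B(2) a e by (intro mult_right_mono) (auto simp: field_simps)
      then have "(1 + e) / e \<le> \<beta> i" using \<beta>_ge[OF that] by simp
      then have "\<beta> i / (1 + e) \<le> \<beta> i - 1" using e by (simp add: field_simps)
      also have "\<dots> \<le> real (b i)" using \<beta>0[of i] by (simp add: b_def)
      finally show ?thesis .
    qed
    have b_ge': "real (b i) \<ge> B * a" if "i < d" for i
    proof -
      have "B * a = B * a * (1 + e) / (1 + e)" using e by simp
      also have "\<dots> \<le> \<beta> i / (1 + e)" using \<beta>_ge[OF that] e by (intro divide_right_mono) auto
      finally show ?thesis using b_ge[OF that] by simp
    qed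
    have Ba: "B * a > 0" using B a by simp
    have b: "b i > 0" if "i < d" for i using b_ge'[OF that] Ba by (cases "b i") auto
    define P where "P = real (\<Prod>i<d. b i)"
    have P: "P > 0" unfolding P_def of_nat_0_less_iff by (rule prod_pos) (use b in auto)
    have vol: "p * P \<ge> v"
    proof -
      have "v = p * (\<Prod>i<d. \<beta> i / (1 + e))"
      proof -
        have "(\<Prod>i<d. \<beta> i / (1 + e)) = (\<Prod>i<d. real (n i) * (a / M))"
          using e by (simp add: \<beta>_def)
        also have "\<dots> = real (\<Prod>i<d. n i) * (a / M) ^ d"
          by (simp only: prod.distrib prod_constant card_lessThan of_nat_prod)
        finally have "p * (\<Prod>i<d. \<beta> i / (1 + e)) = (real (\<Prod>i<d. n i) * p) * (a / M) ^ d"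
          by (simp only: mult_ac)
        also have "\<dots> = v" unfolding Md[symmetric] ad[symmetric] using M by (simp add: power_divide)
        finally show ?thesis ..
      qed
      also have "\<dots> \<le> p * (\<Prod>i<d. real (b i))"
        using b_ge \<beta>0 e p by (intro mult_left_mono prod_mono) auto
      finally show ?thesis by (simp add: P_def)
    qed
    \<comment> \<open>The fine density: merging the \<open>P\<close> cells over one edge of the
      extremal grid gives exactly \<open>q0\<close>, while merging the other way gives a density of
      at most \<open>v / P\<close>, hence at most \<open>p\<close>.\<close>
    define q where "q = 1 - exp (- intensity q0 / P)"
    have iq: "intensity q0 > 0" by (rule intensity_pos[OF q0])
    have q: "0 \<le> q" "q \<le> 1" using iq P by (auto simp: q_def)
    have q_le: "q \<le> intensity q0 / P"
      using exp_ge_add_one_self[of "- intensity q0 / P"] by (simp add: q_def)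
    have pw: "(1 - q) ^ k = exp (- real k * intensity q0 / P)" for k
      by (simp add: q_def flip: exp_of_nat_mult)
    have "(1 - q) ^ (\<Prod>i<d. b i) = exp (- intensity q0)"
      unfolding pw P_def[symmetric] using P by simp
    also have "\<dots> = 1 - q0" using q0 by (simp add: intensity_def)
    finally have law1: "1 - (1 - q) ^ (\<Prod>i<d. b i) = q0" by simp
    have law2: "1 - (1 - q) ^ (\<Prod>i<d. n0 i) = 1 - exp (- v / P)"
      unfolding pw v_def by simp
    have "1 - exp (- v / P) \<le> v / P" using exp_ge_add_one_self[of "- v / P"] by simp
    also have "\<dots> \<le> p" using vol P by (simp add: field_simps)
    finally have p_ge: "1 - (1 - q) ^ (\<Prod>i<d. n0 i) \<le> p" by (simp only: law2)
    have p_ge0: "0 \<le> 1 - (1 - q) ^ (\<Prod>i<d. n0 i)" unfolding law2 using v P by simp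
    have "(q * real (\<Prod>i<d. n0 i) * P)\<^sup>2 * (\<Sum>i<d. 1 / real (b i)) \<le> v\<^sup>2 * (real d / (B * a))"
    proof (rule mult_mono)
      have "q * real (\<Prod>i<d. n0 i) * P \<le> intensity q0 / P * real (\<Prod>i<d. n0 i) * P"
        using q_le P by (intro mult_right_mono) (auto simp del: of_nat_prod)
      also have "\<dots> = v" using P by (simp add: v_def)
      finally show "(q * real (\<Prod>i<d. n0 i) * P)\<^sup>2 \<le> v\<^sup>2"
        using q P by (intro power_mono) (auto simp del: of_nat_prod)
      have "(\<Sum>i<d. 1 / real (b i)) \<le> (\<Sum>i<d. 1 / (B * a))"
        using b_ge' Ba b by (intro sum_mono divide_left_mono) auto
      then show "(\<Sum>i<d. 1 / real (b i)) \<le> real d / (B * a)" by simp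
    qed (auto intro: sum_nonneg)
    also have "\<dots> \<le> e * ?c * a"
    proof -
      have "v\<^sup>2 * real d \<le> B * (e * ?c * a\<^sup>2)"
        using B(3) e c a by (simp add: pos_divide_le_eq)
      then show ?thesis using Ba by (simp add: pos_divide_le_eq power2_eq_square mult_ac)
    qed
    finally have err: "(q * real (\<Prod>i<d. n0 i) * P)\<^sup>2 * (\<Sum>i<d. 1 / real (b i)) \<le> e * ?c * a" .
    have "(1 - 2 * e) * ?c * a = (1 - e) * ?c * a - e * ?c * a" by (simp add: algebra_simps)
    also have "\<dots> \<le> mean_noncrossing d n0 q0 - (q * real (\<Prod>i<d. n0 i) * P)\<^sup>2 * (\<Sum>i<d. 1 / real (b i))"
      using app err unfolding a_def[symmetric] by linarith
    also have "\<dots> \<le> mean_noncrossing d b (1 - (1 - q) ^ (\<Prod>i<d. n0 i))"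
      using mean_noncrossing_change_grid[of d n0 b q, OF d n0 b q] unfolding law1 P_def[symmetric] by simp
    also have "\<dots> \<le> mean_noncrossing d b p"
      using p_ge p_ge0 p by (intro mean_noncrossing_mono_prob) auto
    finally have block: "(1 - 2 * e) * ?c * a \<le> mean_noncrossing d b p" .
    have T_le: "real T \<le> M / (a * (1 + e))" using M a e by (simp add: T_def)
    have "T * b i \<le> n i" if "i < d" for i
    proof -
      have "real (T * b i) \<le> M / (a * (1 + e)) * \<beta> i"
        unfolding of_nat_mult using T_le b_le[of i] M a e by (intro mult_mono) auto
      also have "\<dots> = real (n i)" using M a e by (simp add: \<beta>_def)
      finally show ?thesis by (simp only: of_nat_le_iff)
    qed
    then have blocks: "real T * mean_noncrossing d b p \<le> mean_noncrossing d n p"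
      using p by (intro mean_noncrossing_blocks d) auto
    have "(1 - 2 * e) * M \<le> real T * a"
    proof -
      have "M / (a * (1 + e)) - 1 \<le> real T" unfolding T_def by linarith
      then have "(M / (a * (1 + e)) - 1) * a \<le> real T * a" using a by (intro mult_right_mono) auto
      moreover have "(M / (a * (1 + e)) - 1) * a = M / (1 + e) - a" using a by (simp add: left_diff_distrib)
      moreover have "M * (1 - e) \<le> M / (1 + e)"
      proof -
        have "M * (1 - e) * (1 + e) \<le> M" using M by (simp add: algebra_simps)
        then show ?thesis using e by (simp add: pos_le_divide_eq)
      qed
      moreover have "a \<le> e * M" using M(1) e by (simp add: A_def field_simps)
      ultimately show ?thesis by (simp add: algebra_simps)
    qed
    then have "((1 - 2 * e) * ?c) * ((1 - 2 * e) * M) \<le> ((1 - 2 * e) * ?c) * (real T * a)"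
      using c e by (intro mult_left_mono) auto
    also have "\<dots> = real T * ((1 - 2 * e) * ?c * a)" by simp
    also have "\<dots> \<le> real T * mean_noncrossing d b p" using block by (intro mult_left_mono) auto
    also note blocks
    finally have "((1 - 2 * e) * (1 - 2 * e)) * (?c * M) \<le> mean_noncrossing d n p" by (simp add: mult_ac)
    moreover have "(1 - \<delta>) * (?c * M) \<le> ((1 - 2 * e) * (1 - 2 * e)) * (?c * M)"
      using c M by (intro mult_right_mono) (auto simp: e_def algebra_simps)
    ultimately show ?thesis by (simp add: M_def mult_ac)
  qed
  show ?thesis using B(1) A main by blast
qed

section \<open>Poissonization\<close>

lemma nn_integral_poisson_pmf_power:
  assumes v: "0 < v" and x: "0 \<le> x"
  shows "(\<integral>\<^sup>+k. ennreal (x ^ k) \<partial>poisson_pmf v) = ennreal (exp (v * (x - 1)))"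
proof -
  have "(\<lambda>k. exp (- v) * ((v * x) ^ k /\<^sub>R fact k)) sums (exp (- v) * exp (v * x))"
    by (intro sums_mult exp_converges)
  also have "exp (- v) * exp (v * x) = exp (v * (x - 1))"
    by (simp add: algebra_simps flip: exp_add)
  also have "(\<lambda>k. exp (- v) * ((v * x) ^ k /\<^sub>R fact k)) = (\<lambda>k. v ^ k / fact k * exp (- v) * x ^ k)"
    by (simp add: fun_eq_iff power_mult_distrib field_simps)
  finally have "(\<Sum>k. ennreal (v ^ k / fact k * exp (- v) * x ^ k)) = ennreal (exp (v * (x - 1)))"
    using v x by (intro suminf_ennreal_eq) auto
  then show ?thesis
    using v x by (simp add: nn_integral_measure_pmf nn_integral_count_space_nat ennreal_mult''[symmetric])
qed

text \<open>The default \<open>undefined\<close> makes samples extensional functions, the form in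
  which \<open>cells\<close> records sample points.\<close>

definition random_points :: "'a set \<Rightarrow> nat \<Rightarrow> (nat \<Rightarrow> 'a) pmf" where
  "random_points S k = Pi_pmf {..<k} undefined (\<lambda>_. pmf_of_set S)"

definition random_point_set :: "'a set \<Rightarrow> nat \<Rightarrow> 'a set pmf" where
  "random_point_set S k = map_pmf (\<lambda>x. x ` {..<k}) (random_points S k)"

lemma set_pmf_random_points:
  assumes "finite S" "S \<noteq> {}"
  shows "set_pmf (random_points S k) = (\<Pi>\<^sub>E j\<in>{..<k}. S)"
  unfolding random_points_def using assms
  by (subst set_Pi_pmf) (auto simp: PiE_dflt_def PiE_iff extensional_def)

lemma prob_random_point_set_subset:
  assumes S: "finite S" "S \<noteq> {}" and T: "T \<subseteq> S"
  shows "measure_pmf.prob (random_point_set S k) {X. X \<subseteq> T} = (real (card T) / real (card S)) ^ k"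
proof -
  have "measure_pmf.prob (random_point_set S k) {X. X \<subseteq> T}
      = measure_pmf.prob (random_points S k) (Pi {..<k} (\<lambda>_. T))"
    unfolding random_point_set_def measure_map_pmf by (intro arg_cong[where f = "measure _"]) auto
  also have "\<dots> = (real (card T) / real (card S)) ^ k"
    unfolding random_points_def using S T
    by (subst measure_Pi_pmf_Pi) (auto simp: measure_pmf_of_set Int_absorb1)
  finally show ?thesis .
qed

text \<open>Poissonization: a Poisson number of uniform points occupies the cells independently.\<close>

lemma poisson_random_point_set:
  assumes S: "finite S" "S \<noteq> {}" and v: "0 < v"
  shows "bind_pmf (poisson_pmf v) (random_point_set S) = bernoulli_subset S (1 - exp (- v / real (card S)))"
proof (rule bernoulli_subset_eqI)
  have card: "real (card S) > 0" using S by (simp add: card_gt_0_iff)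
  show "0 \<le> 1 - exp (- v / real (card S))" using v card by simp
  show "set_pmf (bind_pmf (poisson_pmf v) (random_point_set S)) \<subseteq> Pow S"
    using set_pmf_random_points[OF S] by (fastforce simp: random_point_set_def)
  fix T assume T: "T \<subseteq> S"
  define r where "r = real (card T) / real (card S)"
  have "emeasure (bind_pmf (poisson_pmf v) (random_point_set S)) {X. X \<subseteq> T}
      = (\<integral>\<^sup>+k. ennreal (r ^ k) \<partial>poisson_pmf v)"
    unfolding emeasure_bind_pmf
    by (simp add: measure_pmf.emeasure_eq_measure prob_random_point_set_subset[OF S T] r_def)
  also have "\<dots> = ennreal (exp (v * (r - 1)))"
    by (rule nn_integral_poisson_pmf_power[OF v]) (simp add: r_def)
  finally have "measure_pmf.prob (bind_pmf (poisson_pmf v) (random_point_set S)) {X. X \<subseteq> T}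
      = exp (v * (r - 1))"
    by (simp add: measure_pmf.emeasure_eq_measure)
  also have "real (card (S - T)) = real (card S) - real (card T)"
    using S T card_mono[OF S(1) T] finite_subset[OF T] by (simp add: card_Diff_subset of_nat_diff)
  then have "r - 1 = - (real (card (S - T)) / real (card S))"
    using card by (simp add: r_def diff_divide_distrib)
  then have "v * (r - 1) = real (card (S - T)) * (- v / real (card S))" by simp
  finally show "measure_pmf.prob (bind_pmf (poisson_pmf v) (random_point_set S)) {X. X \<subseteq> T}
      = (1 - (1 - exp (- v / real (card S)))) ^ card (S - T)"
    by (simp only: exp_of_nat_mult) simp
qed (use S in auto)

text \<open>Coupling: the first \<open>k\<close> of \<open>l\<close> random points have the law of
  \<open>k\<close> random points, and \<open>U\<close> is closed under supersets.\<close>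

lemma prob_random_point_set_mono:
  assumes k: "k \<le> l" and U: "\<And>X Y. X \<subseteq> Y \<Longrightarrow> X \<in> U \<Longrightarrow> Y \<in> U"
  shows "measure_pmf.prob (random_point_set S k) U \<le> measure_pmf.prob (random_point_set S l) U"
proof -
  have "random_point_set S k = map_pmf (\<lambda>x. (\<lambda>j. if j \<in> {..<k} then x j else undefined) ` {..<k}) (random_points S l)"
    unfolding random_point_set_def random_points_def using k
    by (subst Pi_pmf_subset[of "{..<l}" "{..<k}"]) (auto simp: pmf.map_comp o_def)
  also have "\<dots> = map_pmf (\<lambda>x. x ` {..<k}) (random_points S l)"
    by (intro map_pmf_cong refl image_cong) auto
  finally have "measure_pmf.prob (random_point_set S k) U = measure_pmf.prob (random_points S l) {x. x ` {..<k} \<in> U}"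
    by (simp add: vimage_def)
  also have "\<dots> \<le> measure_pmf.prob (random_points S l) {x. x ` {..<l} \<in> U}"
  proof (rule measure_pmf.finite_measure_mono)
    have "x ` {..<k} \<subseteq> x ` {..<l}" for x :: "nat \<Rightarrow> 'a" using k by auto
    then show "{x :: nat \<Rightarrow> 'a. x ` {..<k} \<in> U} \<subseteq> {x. x ` {..<l} \<in> U}" using U by blast
  qed simp
  finally show ?thesis by (simp add: random_point_set_def vimage_def)
qed

text \<open>Restrict the Poisson mixture to counts in \<open>K\<close>. Increasing events use it
  with the counts from \<open>m\<close> on, decreasing events with those up to
  \<open>m\<close>.\<close>

lemma prob_bernoulli_ge_random_point_set:
  assumes S: "finite S" "S \<noteq> {}" and v: "0 < v"
    and K: "\<And>k. k \<in> K \<Longrightarrow> measure_pmf.prob (random_point_set S m) U \<le> measure_pmf.prob (random_point_set S k) U"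
  shows "measure_pmf.prob (poisson_pmf v) K * measure_pmf.prob (random_point_set S m) U
    \<le> measure_pmf.prob (bernoulli_subset S (1 - exp (- v / real (card S)))) U"
proof -
  let ?P = "measure_pmf.prob (random_point_set S m) U"
  have "ennreal (measure_pmf.prob (poisson_pmf v) K * ?P) = ennreal ?P * emeasure (poisson_pmf v) K"
    by (simp add: measure_pmf.emeasure_eq_measure ennreal_mult mult.commute)
  also have "\<dots> = (\<integral>\<^sup>+k. ennreal ?P * indicator K k \<partial>poisson_pmf v)"
    by (simp add: nn_integral_cmult_indicator)
  also have "\<dots> \<le> (\<integral>\<^sup>+k. emeasure (random_point_set S k) U \<partial>poisson_pmf v)"
    using K by (intro nn_integral_mono) (auto simp: measure_pmf.emeasure_eq_measure indicator_def)
  also have "\<dots> = emeasure (bernoulli_subset S (1 - exp (- v / real (card S)))) U"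
    unfolding poisson_random_point_set[OF S v, symmetric] by simp
  finally show ?thesis by (simp add: measure_pmf.emeasure_eq_measure)
qed

text \<open>The event means at most \<open>m\<close> points if \<open>s > 1\<close> and at least
  \<open>m\<close> points if \<open>s < 1\<close>, so a single Markov inequality for
  \<open>(1 / s) ^ k\<close> bounds both unlikely sides of the mean \<open>s * m\<close>.\<close>

lemma poisson_power_tail:
  assumes s: "0 < s" and m: "0 < m"
  shows "measure_pmf.prob (poisson_pmf (s * real m)) {k. (1 / s) ^ m \<le> (1 / s) ^ k}
    \<le> exp (- real m * (s - 1 - ln s))"
proof -
  have "emeasure (poisson_pmf (s * real m)) {k. (1 / s) ^ m \<le> (1 / s) ^ k}
      = (\<integral>\<^sup>+k. indicator {k. (1 / s) ^ m \<le> (1 / s) ^ k} k \<partial>poisson_pmf (s * real m))"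
    by simp
  also have "\<dots> \<le> (\<integral>\<^sup>+k. ennreal (s ^ m) * ennreal ((1 / s) ^ k) \<partial>poisson_pmf (s * real m))"
  proof (rule nn_integral_mono)
    fix k
    show "indicator {k. (1 / s) ^ m \<le> (1 / s) ^ k} k \<le> ennreal (s ^ m) * ennreal ((1 / s) ^ k)"
    proof (cases "(1 / s) ^ m \<le> (1 / s) ^ k")
      case True
      then have "s ^ m * (1 / s) ^ m \<le> s ^ m * (1 / s) ^ k" using s by (intro mult_left_mono) auto
      then have "1 \<le> s ^ m * (1 / s) ^ k" using s by (simp add: power_divide)
      then show ?thesis using True s by (simp flip: ennreal_mult'')
    qed simp
  qed
  also have "\<dots> = ennreal (s ^ m) * ennreal (exp (s * real m * (1 / s - 1)))"
    using s m by (subst nn_integral_cmult) (auto simp: nn_integral_poisson_pmf_power)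
  also have "\<dots> = ennreal (s ^ m * exp (s * real m * (1 / s - 1)))"
    using s by (simp add: ennreal_mult)
  also have "s ^ m * exp (s * real m * (1 / s - 1)) = exp (- real m * (s - 1 - ln s))"
  proof -
    have "s ^ m = exp (real m * ln s)" using s by (simp add: exp_of_nat_mult)
    then show ?thesis using s by (simp add: field_simps flip: exp_add)
  qed
  finally show ?thesis by (simp add: measure_pmf.emeasure_eq_measure)
qed

lemma eventually_poisson_power_tail:
  assumes s: "0 < s" "s \<noteq> 1"
  shows "eventually (\<lambda>m. measure_pmf.prob (poisson_pmf (s * real m)) {k. (1 / s) ^ m \<le> (1 / s) ^ k} \<le> 1 / 2)
    sequentially"
proof -
  have "ln s \<noteq> s - 1" using s ln_eq_minus_one by blast
  then have \<kappa>: "s - 1 - ln s > 0" using ln_le_minus_one[OF s(1)] by linarith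
  have "eventually (\<lambda>m. real m \<ge> 1 / (s - 1 - ln s)) sequentially"
    using filterlim_real_sequentially by (simp add: filterlim_at_top)
  then show ?thesis using eventually_gt_at_top[of 0]
  proof eventually_elim
    case (elim m)
    have "real m * (s - 1 - ln s) \<ge> 1" using elim \<kappa> by (simp add: field_simps)
    then have "exp (- real m * (s - 1 - ln s)) \<le> exp (- 1)" by simp
    also have "\<dots> \<le> 1 / (2::real)" using exp_ge_add_one_self[of 1] by (simp add: exp_minus field_simps)
    finally show ?case using poisson_power_tail[OF s(1) elim(2)] by linarith
  qed
qed

lemma eventually_poisson_ge:
  assumes s: "1 < s"
  shows "eventually (\<lambda>m. measure_pmf.prob (poisson_pmf (s * real m)) {m..} \<ge> 1 / 2) sequentially"
proof -
  have "eventually (\<lambda>m. measure_pmf.prob (poisson_pmf (s * real m)) {k. (1 / s) ^ m \<le> (1 / s) ^ k} \<le> 1 / 2)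
    sequentially"
    using s by (intro eventually_poisson_power_tail) auto
  then show ?thesis
  proof eventually_elim
    case (elim m)
    have "measure_pmf.prob (poisson_pmf (s * real m)) (UNIV - {m..})
        \<le> measure_pmf.prob (poisson_pmf (s * real m)) {k. (1 / s) ^ m \<le> (1 / s) ^ k}"
      using s by (intro measure_pmf.finite_measure_mono) (auto intro!: power_decreasing)
    also note elim
    also have "measure_pmf.prob (poisson_pmf (s * real m)) (UNIV - {m..})
        = 1 - measure_pmf.prob (poisson_pmf (s * real m)) {m..}"
      using measure_pmf.prob_compl[of "{m..}"] by simp
    finally show ?case by simp
  qed
qed

lemma eventually_poisson_le:
  assumes s: "0 < s" "s < 1"
  shows "eventually (\<lambda>m. measure_pmf.prob (poisson_pmf (s * real m)) {..m} \<ge> 1 / 2) sequentially"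
proof -
  have "eventually (\<lambda>m. measure_pmf.prob (poisson_pmf (s * real m)) {k. (1 / s) ^ m \<le> (1 / s) ^ k} \<le> 1 / 2)
    sequentially"
    using s by (intro eventually_poisson_power_tail) auto
  then show ?thesis
  proof eventually_elim
    case (elim m)
    have "measure_pmf.prob (poisson_pmf (s * real m)) (UNIV - {..m})
        \<le> measure_pmf.prob (poisson_pmf (s * real m)) {k. (1 / s) ^ m \<le> (1 / s) ^ k}"
      using s by (intro measure_pmf.finite_measure_mono) (auto intro!: power_increasing)
    also note elim
    also have "measure_pmf.prob (poisson_pmf (s * real m)) (UNIV - {..m})
        = 1 - measure_pmf.prob (poisson_pmf (s * real m)) {..m}"
      using measure_pmf.prob_compl[of "{..m}"] by simp
    finally show ?case by simp
  qed
qed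

section \<open>Uniform points and their cells\<close>

text \<open>Rounding up gives half-open cells numbered from 1, like the vertices. The point 0 falls
  into cell 0 outside the grid, a null event.\<close>

definition cell :: "nat \<Rightarrow> real \<Rightarrow> nat" where
  "cell b u = nat \<lceil>real b * u\<rceil>"

lemma cell_mono: "u \<le> w \<Longrightarrow> cell b u \<le> cell b w"
  unfolding cell_def by (intro nat_mono ceiling_mono mult_left_mono) auto

lemma cell_vimage:
  assumes "1 \<le> k"
  shows "cell b -` {k} = {u. real k - 1 < real b * u \<and> real b * u \<le> real k}"
proof -
  have "cell b u = k \<longleftrightarrow> \<lceil>real b * u\<rceil> = int k" for u
    using assms unfolding cell_def by linarith
  then show ?thesis by (auto simp: ceiling_eq_iff)
qed

lemma cell_vimage_interval:
  assumes "1 \<le> k" "0 < b"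
  shows "cell b -` {k} = {(real k - 1) / real b <.. real k / real b}"
  using assms unfolding cell_vimage[OF assms(1)] by (auto simp: field_simps)

lemma prob_space_unit: "prob_space (uniform_measure lborel {0..1::real})"
  by (intro prob_space_uniform_measure) auto

lemma emeasure_cell:
  assumes "1 \<le> k" "k \<le> b"
  shows "emeasure (uniform_measure lborel {0..1}) (cell b -` {k}) = ennreal (1 / real b)"
proof -
  have b: "0 < b" using assms by simp
  have "{0..1} \<inter> {(real k - 1) / real b <.. real k / real b} = {(real k - 1) / real b <.. real k / real b}"
  proof -
    have "0 \<le> (real k - 1) / real b" "real k / real b \<le> 1" using assms b by auto
    then show ?thesis by auto
  qed
  moreover have "(real k - 1) / real b \<le> real k / real b" using b by (simp add: divide_right_mono)
  ultimately show ?thesis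
    unfolding cell_vimage_interval[OF assms(1) b] using b
    by (simp add: divide_ennreal_def flip: diff_divide_distrib)
qed

lemma sets_cell: "1 \<le> k \<Longrightarrow> 0 < b \<Longrightarrow> cell b -` {k} \<in> sets borel"
  by (simp add: cell_vimage_interval)

definition cells :: "nat \<Rightarrow> nat \<Rightarrow> nat \<Rightarrow> (nat \<Rightarrow> nat \<Rightarrow> real) \<Rightarrow> nat \<Rightarrow> nat \<Rightarrow> nat" where
  "cells d m b x = (\<lambda>j\<in>{..<m}. \<lambda>i\<in>{..<d}. cell b (x j i))"

lemma prob_space_uniform_points: "prob_space (uniform_points d m)"
  unfolding uniform_points_def by (intro prob_space_PiM prob_space_unit)

lemma space_uniform_points: "space (uniform_points d m) = (\<Pi>\<^sub>E j\<in>{..<m}. \<Pi>\<^sub>E i\<in>{..<d}. UNIV)"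
  by (simp add: uniform_points_def space_PiM)

lemma cells_eq_vimage:
  assumes "\<omega> \<in> (\<Pi>\<^sub>E j\<in>{..<m}. complete_edges d (\<lambda>_. b))"
  shows "{x \<in> space (uniform_points d m). cells d m b x = \<omega>}
    = (\<Pi>\<^sub>E j\<in>{..<m}. \<Pi>\<^sub>E i\<in>{..<d}. cell b -` {\<omega> j i})"
proof (intro set_eqI)
  fix x
  have ext: "\<omega> \<in> extensional {..<m}" "\<And>j. j < m \<Longrightarrow> \<omega> j \<in> extensional {..<d}"
    using assms by (auto simp: PiE_iff complete_edges_iff)
  have "cells d m b x = \<omega> \<longleftrightarrow> (\<forall>j<m. \<forall>i<d. cell b (x j i) = \<omega> j i)"
  proof
    assume eq: "cells d m b x = \<omega>"
    show "\<forall>j<m. \<forall>i<d. cell b (x j i) = \<omega> j i" unfolding eq[symmetric] by (simp add: cells_def)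
  next
    assume *: "\<forall>j<m. \<forall>i<d. cell b (x j i) = \<omega> j i"
    show "cells d m b x = \<omega>"
    proof (rule extensionalityI[of _ "{..<m}"])
      fix j assume "j \<in> {..<m}"
      then show "cells d m b x j = \<omega> j"
        using * ext(2)[of j] by (intro extensionalityI[of _ "{..<d}"]) (auto simp: cells_def)
    qed (use ext in \<open>auto simp: cells_def\<close>)
  qed
  then show "x \<in> {x \<in> space (uniform_points d m). cells d m b x = \<omega>} \<longleftrightarrow>
      x \<in> (\<Pi>\<^sub>E j\<in>{..<m}. \<Pi>\<^sub>E i\<in>{..<d}. cell b -` {\<omega> j i})"
    unfolding space_uniform_points by (simp add: PiE_iff Ball_def) blast
qed

lemma measure_cells_singleton:
  assumes b: "0 < b" and \<omega>: "\<omega> \<in> (\<Pi>\<^sub>E j\<in>{..<m}. complete_edges d (\<lambda>_. b))"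
  shows "{x \<in> space (uniform_points d m). cells d m b x = \<omega>} \<in> sets (uniform_points d m)"
    and "measure (uniform_points d m) {x \<in> space (uniform_points d m). cells d m b x = \<omega>}
      = pmf (random_points (complete_edges d (\<lambda>_. b)) m) \<omega>"
proof -
  let ?U = "uniform_measure lborel {0..1::real}"
  let ?B = "\<lambda>j. \<Pi>\<^sub>E i\<in>{..<d}. cell b -` {\<omega> j i}"
  interpret I: product_prob_space "\<lambda>_::nat. ?U" "{..<d}"
    unfolding product_prob_space_def product_prob_space_axioms_def product_sigma_finite_def
    using prob_space_unit prob_space_imp_sigma_finite by blast
  have P: "prob_space (PiM {..<d} (\<lambda>_. ?U))" by (intro prob_space_PiM prob_space_unit)
  interpret J: product_prob_space "\<lambda>_::nat. PiM {..<d} (\<lambda>_. ?U)" "{..<m}"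
    unfolding product_prob_space_def product_prob_space_axioms_def product_sigma_finite_def
    using P prob_space_imp_sigma_finite by blast
  interpret M: prob_space "uniform_points d m" by (rule prob_space_uniform_points)
  have w: "1 \<le> \<omega> j i" "\<omega> j i \<le> b" if "j < m" "i < d" for j i
    using \<omega> that by (auto simp: PiE_iff complete_edges_iff)
  have B: "?B j \<in> sets (PiM {..<d} (\<lambda>_. ?U))" if "j < m" for j
    by (intro sets_PiM_I_finite) (use w[OF that] b in \<open>auto intro!: sets_cell\<close>)
  have eB: "emeasure (PiM {..<d} (\<lambda>_. ?U)) (?B j) = ennreal ((1 / real b) ^ d)" if "j < m" for j
  proof -
    have "emeasure (PiM {..<d} (\<lambda>_. ?U)) (?B j) = (\<Prod>i<d. emeasure ?U (cell b -` {\<omega> j i}))"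
      by (intro I.emeasure_PiM) (use w[OF that] b in \<open>auto intro!: sets_cell\<close>)
    also have "\<dots> = (\<Prod>i<d. ennreal (1 / real b))"
      by (intro prod.cong refl emeasure_cell) (use w[OF that] in auto)
    finally show ?thesis by (simp add: ennreal_power)
  qed
  show "{x \<in> space (uniform_points d m). cells d m b x = \<omega>} \<in> sets (uniform_points d m)"
    unfolding cells_eq_vimage[OF \<omega>] unfolding uniform_points_def
    by (rule sets_PiM_I_finite) (use B in auto)
  have "emeasure (uniform_points d m) {x \<in> space (uniform_points d m). cells d m b x = \<omega>}
      = (\<Prod>j<m. emeasure (PiM {..<d} (\<lambda>_. ?U)) (?B j))"
    unfolding cells_eq_vimage[OF \<omega>] unfolding uniform_points_def
    by (rule J.emeasure_PiM) (use B in auto)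
  also have "\<dots> = (\<Prod>j<m. ennreal ((1 / real b) ^ d))"
    by (intro prod.cong refl eB) auto
  also have "\<dots> = ennreal (((1 / real b) ^ d) ^ m)" by (simp add: ennreal_power)
  finally have "measure (uniform_points d m) {x \<in> space (uniform_points d m). cells d m b x = \<omega>}
      = ((1 / real b) ^ d) ^ m"
    by (simp add: measure_def)
  also have "\<dots> = pmf (random_points (complete_edges d (\<lambda>_. b)) m) \<omega>"
  proof -
    have "\<omega> j = undefined" if "j \<notin> {..<m}" for j using \<omega> that by (auto simp: PiE_iff extensional_def)
    moreover have "pmf (pmf_of_set (complete_edges d (\<lambda>_. b))) (\<omega> j) = (1 / real b) ^ d" if "j < m" for j
    proof -
      have "\<omega> j \<in> complete_edges d (\<lambda>_. b)" using \<omega> that by (auto simp: PiE_iff)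
      moreover from this have "complete_edges d (\<lambda>_. b) \<noteq> {}" by blast
      ultimately show ?thesis by (simp add: card_complete_edges power_divide)
    qed
    ultimately show ?thesis unfolding random_points_def by (subst pmf_Pi') auto
  qed
  finally show "measure (uniform_points d m) {x \<in> space (uniform_points d m). cells d m b x = \<omega>}
      = pmf (random_points (complete_edges d (\<lambda>_. b)) m) \<omega>" .
qed

lemma complete_edges_cube_ne: "0 < b \<Longrightarrow> complete_edges d (\<lambda>_. b) \<noteq> {}"
  unfolding complete_edges_def by (simp add: PiE_eq_empty_iff)

lemma measure_cells:
  fixes E :: "(nat \<Rightarrow> nat \<Rightarrow> nat) set"
  assumes b: "0 < b" and E: "E \<subseteq> (\<Pi>\<^sub>E j\<in>{..<m}. complete_edges d (\<lambda>_. b))"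
  shows "{x \<in> space (uniform_points d m). cells d m b x \<in> E} \<in> sets (uniform_points d m)"
    and "measure (uniform_points d m) {x \<in> space (uniform_points d m). cells d m b x \<in> E}
      = measure_pmf.prob (random_points (complete_edges d (\<lambda>_. b)) m) E"
proof -
  interpret M: prob_space "uniform_points d m" by (rule prob_space_uniform_points)
  have fin: "finite E" by (rule finite_subset[OF E]) (intro finite_PiE, auto)
  have un: "{x \<in> space (uniform_points d m). cells d m b x \<in> E}
      = (\<Union>\<omega>\<in>E. {x \<in> space (uniform_points d m). cells d m b x = \<omega>})" by auto
  show "{x \<in> space (uniform_points d m). cells d m b x \<in> E} \<in> sets (uniform_points d m)"
    unfolding un by (intro sets.finite_UN fin measure_cells_singleton(1) b) (use E in auto)
  have "measure (uniform_points d m) {x \<in> space (uniform_points d m). cells d m b x \<in> E}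
      = (\<Sum>\<omega>\<in>E. measure (uniform_points d m) {x \<in> space (uniform_points d m). cells d m b x = \<omega>})"
    unfolding un
    by (intro M.finite_measure_finite_Union fin)
       (use E measure_cells_singleton(1)[OF b] in \<open>auto simp: disjoint_family_on_def\<close>)
  also have "\<dots> = (\<Sum>\<omega>\<in>E. pmf (random_points (complete_edges d (\<lambda>_. b)) m) \<omega>)"
    by (intro sum.cong refl measure_cells_singleton(2) b) (use E in auto)
  also have "\<dots> = measure_pmf.prob (random_points (complete_edges d (\<lambda>_. b)) m) E"
    using fin by (simp add: measure_measure_pmf_finite)
  finally show "measure (uniform_points d m) {x \<in> space (uniform_points d m). cells d m b x \<in> E}
      = measure_pmf.prob (random_points (complete_edges d (\<lambda>_. b)) m) E" .
qed

text \<open>The set \<open>A\<close> may be arbitrary: monotonicity asks for measurability of the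
  covering set only, which consists of cell events and a null set.\<close>

lemma measure_le_prob_random_points:
  assumes b: "0 < b" and A: "A \<subseteq> space (uniform_points d m)"
    and E: "\<And>x. x \<in> A \<Longrightarrow> cells d m b x \<in> (\<Pi>\<^sub>E j\<in>{..<m}. complete_edges d (\<lambda>_. b)) \<Longrightarrow> cells d m b x \<in> E"
  shows "measure (uniform_points d m) A \<le> measure_pmf.prob (random_points (complete_edges d (\<lambda>_. b)) m) E"
proof -
  interpret M: prob_space "uniform_points d m" by (rule prob_space_uniform_points)
  let ?\<Omega> = "\<Pi>\<^sub>E j\<in>{..<m}. complete_edges d (\<lambda>_. b)"
  let ?R = "random_points (complete_edges d (\<lambda>_. b)) m"
  let ?V = "\<lambda>E. {x \<in> space (uniform_points d m). cells d m b x \<in> E}"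
  have V: "?V (E \<inter> ?\<Omega>) \<in> sets (uniform_points d m)" "?V ?\<Omega> \<in> sets (uniform_points d m)"
    using measure_cells(1)[OF b, of "E \<inter> ?\<Omega>"] measure_cells(1)[OF b, of ?\<Omega>] by auto
  \<comment> \<open>Full mass on the grid shows that samples with a coordinate at 0 or outside
    \<open>[0, 1]\<close> form a null set.\<close>
  have "measure_pmf.prob ?R ?\<Omega> = measure_pmf.prob ?R UNIV"
    by (rule measure_prob_cong_0)
       (use set_pmf_random_points[OF finite_complete_edges complete_edges_cube_ne[OF b]] in
        \<open>auto simp: set_pmf_iff[symmetric] pmf_eq_0_set_pmf\<close>)
  then have full: "M.prob (?V ?\<Omega>) = 1" using measure_cells(2)[OF b, of ?\<Omega>] by simp
  have "M.prob A \<le> M.prob (?V (E \<inter> ?\<Omega>) \<union> (space (uniform_points d m) - ?V ?\<Omega>))"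
    by (rule M.finite_measure_mono) (use A E V in auto)
  also have "\<dots> \<le> M.prob (?V (E \<inter> ?\<Omega>)) + M.prob (space (uniform_points d m) - ?V ?\<Omega>)"
    by (rule measure_Un_le) (use V in auto)
  also have "M.prob (space (uniform_points d m) - ?V ?\<Omega>) = 0"
    using M.prob_compl[OF V(2)] full by simp
  also have "M.prob (?V (E \<inter> ?\<Omega>)) = measure_pmf.prob ?R (E \<inter> ?\<Omega>)"
    by (rule measure_cells(2)[OF b]) auto
  also have "\<dots> \<le> measure_pmf.prob ?R E" by (rule measure_pmf.finite_measure_mono) auto
  finally show ?thesis by simp
qed

section \<open>Chains of points versus matchings of cells\<close>

lemma card_le_longest_chain:
  assumes "J \<subseteq> {..<m}" "pairwise (\<lambda>j k. comparable d (x j) (x k)) J"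
  shows "card J \<le> longest_chain d m x"
  unfolding longest_chain_def
proof (rule Max_ge)
  show "finite (card ` {J. J \<subseteq> {..<m} \<and> pairwise (\<lambda>j k. comparable d (x j) (x k)) J})"
    by (rule finite_imageI, rule finite_subset[of _ "Pow {..<m}"]) auto
qed (use assms in blast)

lemma longest_chain_obtains:
  obtains J where "J \<subseteq> {..<m}" "pairwise (\<lambda>j k. comparable d (x j) (x k)) J" "card J = longest_chain d m x"
proof -
  have "longest_chain d m x \<in> card ` {J. J \<subseteq> {..<m} \<and> pairwise (\<lambda>j k. comparable d (x j) (x k)) J}"
    unfolding longest_chain_def
  proof (rule Max_in)
    show "finite (card ` {J. J \<subseteq> {..<m} \<and> pairwise (\<lambda>j k. comparable d (x j) (x k)) J})"
      by (rule finite_imageI, rule finite_subset[of _ "Pow {..<m}"]) auto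
    have "{} \<in> {J. J \<subseteq> {..<m} \<and> pairwise (\<lambda>j k. comparable d (x j) (x k)) J}" by simp
    then show "card ` {J. J \<subseteq> {..<m} \<and> pairwise (\<lambda>j k. comparable d (x j) (x k)) J} \<noteq> {}" by blast
  qed
  then show ?thesis using that by auto
qed

text \<open>Cell numbers are monotone in the coordinate, so strictly ordered cells force their
  points to be ordered. No condition on shared coordinates enters in this direction.\<close>

lemma max_noncrossing_cells_le_longest_chain:
  "max_noncrossing d (cells d m b x ` {..<m}) \<le> longest_chain d m x"
proof -
  obtain F where F: "F \<subseteq> cells d m b x ` {..<m}" "noncrossing_matching d F"
      "card F = max_noncrossing d (cells d m b x ` {..<m})"
    using max_noncrossing_obtains[of "cells d m b x ` {..<m}" d] by blast
  obtain J where J: "J \<subseteq> {..<m}" "inj_on (cells d m b x) J" "F = cells d m b x ` J"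
    using subset_image_inj F(1) by metis
  have "pairwise (\<lambda>j k. comparable d (x j) (x k)) J"
    unfolding pairwise_def
  proof (intro ballI impI)
    fix j k assume jk: "j \<in> J" "k \<in> J" "j \<noteq> k"
    have le: "comp_le d (x j) (x k)"
      if "strictly_below d (cells d m b x j) (cells d m b x k)" "j \<in> J" "k \<in> J" for j k
      unfolding comp_le_def
    proof (intro allI impI)
      fix i assume "i < d"
      then have "cell b (x j i) < cell b (x k i)"
        using that J(1) by (auto simp: strictly_below_def cells_def subset_iff)
      then show "x j i \<le> x k i" using cell_mono[of "x k i" "x j i" b] by linarith
    qed
    have "cells d m b x j \<noteq> cells d m b x k" using J(2) jk by (auto simp: inj_on_def)
    then have "strictly_below d (cells d m b x j) (cells d m b x k) \<or>
        strictly_below d (cells d m b x k) (cells d m b x j)"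
      using noncrossing_matchingD[OF F(2)] jk J(3) by blast
    then show "comparable d (x j) (x k)" using le jk by (auto simp: comparable_def)
  qed
  then have "card J \<le> longest_chain d m x" using J(1) by (rule card_le_longest_chain[rotated])
  then show ?thesis using F(3) J by (simp add: card_image)
qed

text \<open>Comparable points have weakly comparable cells; the order becomes strict once no two
  points share a cell coordinate.\<close>

lemma longest_chain_le_max_noncrossing_cells:
  assumes d: "0 < d" and conf: "conflicts d (cells d m b x) {..<m} = {}"
  shows "longest_chain d m x \<le> max_noncrossing d (cells d m b x ` {..<m})"
proof -
  let ?c = "cells d m b x"
  obtain J where J: "J \<subseteq> {..<m}" "pairwise (\<lambda>j k. comparable d (x j) (x k)) J" "card J = longest_chain d m x"
    by (rule longest_chain_obtains)
  have *: "strictly_below d (?c j) (?c k) \<or> strictly_below d (?c k) (?c j)"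
    if jk: "j \<in> J" "k \<in> J" "j \<noteq> k" for j k
  proof -
    have lt: "j < m" "k < m" using jk J(1) by auto
    have "(j, k) \<notin> conflicts d ?c {..<m}" using conf by simp
    then have ne: "?c j i \<noteq> ?c k i" if "i < d" for i using that lt jk by (auto simp: conflicts_def)
    have "comp_le d (x j) (x k) \<or> comp_le d (x k) (x j)"
      using J(2) jk by (auto simp: pairwise_def comparable_def)
    then have "(\<forall>i<d. ?c j i \<le> ?c k i) \<or> (\<forall>i<d. ?c k i \<le> ?c j i)"
      using lt by (auto simp: comp_le_def cells_def intro!: cell_mono)
    then show ?thesis using ne unfolding strictly_below_def by (metis le_neq_implies_less)
  qed
  then have "inj_on ?c J"
    using strictly_below_irrefl[OF d] by (intro inj_onI) metis
  moreover have "noncrossing_matching d (?c ` J)"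
    using * by (auto simp: noncrossing_matching_iff pairwise_def)
  ultimately show ?thesis
    using card_le_max_noncrossing[of "?c ` {..<m}" "?c ` J" d] J by (simp add: card_image image_mono)
qed

section \<open>Probability of shared cell coordinates\<close>

lemma pmf_of_set_cube:
  assumes b: "0 < b"
  shows "pmf_of_set (complete_edges d (\<lambda>_. b)) = Pi_pmf {..<d} undefined (\<lambda>_. pmf_of_set {1..b})"
proof -
  have "PiE_dflt {..<d} undefined (\<lambda>_. {1..b}) = complete_edges d (\<lambda>_. b)"
    by (auto simp: PiE_dflt_def complete_edges_iff extensional_def)
  then show ?thesis using b by (subst Pi_pmf_of_set) auto
qed

lemma prob_cube_coordinate:
  assumes b: "0 < b" and i: "i < d" and v: "v \<in> {1..b}"
  shows "measure_pmf.prob (pmf_of_set (complete_edges d (\<lambda>_. b))) {e. e i = v} = 1 / real b"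
proof -
  have "{e. e i = v} = Pi {..<d} (\<lambda>i'. if i' = i then {v} else UNIV)"
    using i by (auto simp: Pi_iff split: if_splits)
  then have "measure_pmf.prob (pmf_of_set (complete_edges d (\<lambda>_. b))) {e. e i = v}
      = (\<Prod>i'<d. measure_pmf.prob (pmf_of_set {1..b}) (if i' = i then {v} else UNIV))"
    unfolding pmf_of_set_cube[OF b] by (simp only: measure_Pi_pmf_Pi[OF finite_lessThan])
  also have "\<dots> = (\<Prod>i'<d. if i' = i then 1 / real b else 1)"
    using v b by (intro prod.cong) (auto simp: measure_pmf_single)
  finally show ?thesis using i by simp
qed

text \<open>The two coordinates are independent and uniform on \<open>b\<close> values, so they
  coincide with probability \<open>b\<close> times \<open>(1 / b)\<^sup>2\<close>.\<close>

lemma prob_random_points_coordinate_eq: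
  assumes b: "0 < b" and i: "i < d" and jk: "j < m" "k < m" "j \<noteq> k"
  shows "measure_pmf.prob (random_points (complete_edges d (\<lambda>_. b)) m) {\<omega>. \<omega> j i = \<omega> k i} \<le> 1 / real b"
proof -
  let ?R = "random_points (complete_edges d (\<lambda>_. b)) m"
  let ?S = "complete_edges d (\<lambda>_. b)"
  have supp: "set_pmf ?R = (\<Pi>\<^sub>E j\<in>{..<m}. ?S)"
    by (intro set_pmf_random_points complete_edges_cube_ne b finite_complete_edges)
  have "measure_pmf.prob ?R {\<omega>. \<omega> j i = \<omega> k i} = measure_pmf.prob ?R ({\<omega>. \<omega> j i = \<omega> k i} \<inter> set_pmf ?R)"
    by (simp add: measure_Int_set_pmf)
  also have "\<dots> \<le> measure_pmf.prob ?R (\<Union>v\<in>{1..b}. {\<omega>. \<omega> j i = v \<and> \<omega> k i = v})"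
  proof (rule measure_pmf.finite_measure_mono)
    show "{\<omega>. \<omega> j i = \<omega> k i} \<inter> set_pmf ?R \<subseteq> (\<Union>v\<in>{1..b}. {\<omega>. \<omega> j i = v \<and> \<omega> k i = v})"
    proof safe
      fix \<omega> assume "\<omega> \<in> set_pmf ?R" "\<omega> j i = \<omega> k i"
      then have "\<omega> j i \<in> {1..b}" using jk i by (auto simp: supp PiE_iff complete_edges_iff)
      then show "\<omega> \<in> (\<Union>v\<in>{1..b}. {\<omega>. \<omega> j i = v \<and> \<omega> k i = v})" using \<open>\<omega> j i = \<omega> k i\<close> by auto
    qed
  qed simp
  also have "\<dots> \<le> (\<Sum>v\<in>{1..b}. measure_pmf.prob ?R {\<omega>. \<omega> j i = v \<and> \<omega> k i = v})"
    by (rule measure_pmf.finite_measure_subadditive_finite) auto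
  also have "\<dots> = (\<Sum>v\<in>{1..b}. (1 / real b) * (1 / real b))"
  proof (rule sum.cong)
    fix v assume v: "v \<in> {1..b}"
    have "{\<omega>. \<omega> j i = v \<and> \<omega> k i = v} = Pi {..<m} (\<lambda>l. if l = j \<or> l = k then {e. e i = v} else UNIV)"
      using jk by (auto simp: Pi_iff split: if_splits)
    then have "measure_pmf.prob ?R {\<omega>. \<omega> j i = v \<and> \<omega> k i = v}
        = (\<Prod>l<m. measure_pmf.prob (pmf_of_set ?S) (if l = j \<or> l = k then {e. e i = v} else UNIV))"
      unfolding random_points_def by (simp only: measure_Pi_pmf_Pi[OF finite_lessThan])
    also have "\<dots> = (\<Prod>l<m. if l \<in> {j, k} then 1 / real b else 1)"
      using prob_cube_coordinate[OF b i v] by (intro prod.cong) auto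
    also have "\<dots> = (\<Prod>l\<in>{j, k}. 1 / real b)"
      using jk by (intro prod.mono_neutral_cong_right) auto
    finally show "measure_pmf.prob ?R {\<omega>. \<omega> j i = v \<and> \<omega> k i = v} = (1 / real b) * (1 / real b)"
      using jk by simp
  qed simp
  finally show ?thesis using b by simp
qed

text \<open>Union bound over two indices and a coordinate. For fixed \<open>m\<close> the bound
  vanishes as \<open>b\<close> grows, which removes the discretisation error.\<close>

lemma prob_conflicts_random_points_le:
  assumes b: "0 < b"
  shows "measure_pmf.prob (random_points (complete_edges d (\<lambda>_. b)) m) {\<omega>. conflicts d \<omega> {..<m} \<noteq> {}}
    \<le> real (m * m * d) / real b"
proof -
  let ?R = "random_points (complete_edges d (\<lambda>_. b)) m"
  let ?I = "{z \<in> {..<m} \<times> {..<m} \<times> {..<d}. fst z \<noteq> fst (snd z)}"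
  have fin: "finite ?I" by simp
  have "measure_pmf.prob ?R {\<omega>. conflicts d \<omega> {..<m} \<noteq> {}}
      \<le> measure_pmf.prob ?R (\<Union>z\<in>?I. {\<omega>. \<omega> (fst z) (snd (snd z)) = \<omega> (fst (snd z)) (snd (snd z))})"
  proof (rule measure_pmf.finite_measure_mono, rule subsetI)
    fix \<omega> assume "\<omega> \<in> {\<omega>. conflicts d \<omega> {..<m} \<noteq> {}}"
    then obtain j k i where "j < m" "k < m" "j \<noteq> k" "i < d" "\<omega> j i = \<omega> k i"
      by (auto simp: conflicts_def)
    then show "\<omega> \<in> (\<Union>z\<in>?I. {\<omega>. \<omega> (fst z) (snd (snd z)) = \<omega> (fst (snd z)) (snd (snd z))})"
      by (intro UN_I[of "(j, k, i)"]) auto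
  qed simp
  also have "\<dots> \<le> (\<Sum>z\<in>?I. measure_pmf.prob ?R {\<omega>. \<omega> (fst z) (snd (snd z)) = \<omega> (fst (snd z)) (snd (snd z))})"
    by (rule measure_pmf.finite_measure_subadditive_finite[OF fin]) auto
  also have "\<dots> \<le> (\<Sum>z\<in>?I. 1 / real b)"
    by (intro sum_mono prob_random_points_coordinate_eq b) auto
  also have "\<dots> = real (card ?I) / real b" by simp
  also have "\<dots> \<le> real (m * m * d) / real b"
  proof -
    have "card ?I \<le> card ({..<m} \<times> {..<m} \<times> {..<d})" by (rule card_mono) auto
    then have "card ?I \<le> m * m * d" by (simp add: mult.assoc)
    then show ?thesis by (intro divide_right_mono) (simp_all only: of_nat_le_iff of_nat_0_le_iff)
  qed
  finally show ?thesis .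
qed

text \<open>A lower bound on the longest chain is a finite union, over large enough index sets, of
  finite intersections of comparability events.\<close>

lemma measurable_longest_chain:
  "(\<lambda>x. real (longest_chain d m x)) \<in> borel_measurable (uniform_points d m)"
proof (rule borel_measurable_iff_ge[THEN iffD2], rule allI)
  fix a :: real
  let ?M = "uniform_points d m"
  have coord: "(\<lambda>x. x j i) \<in> borel_measurable ?M" if "j < m" "i < d" for j i
  proof -
    have "(\<lambda>x. x j) \<in> measurable ?M (PiM {..<d} (\<lambda>_. uniform_measure lborel {0..1::real}))"
      unfolding uniform_points_def by (rule measurable_component_singleton) (use that in simp)
    moreover have "(\<lambda>y. y i) \<in> measurable (PiM {..<d} (\<lambda>_. uniform_measure lborel {0..1::real}))
        (uniform_measure lborel {0..1::real})"
      by (rule measurable_component_singleton) (use that in simp)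
    ultimately have "(\<lambda>x. x j i) \<in> measurable ?M (uniform_measure lborel {0..1::real})"
      by (rule measurable_compose)
    then show ?thesis by (simp cong: measurable_cong_sets)
  qed
  have le: "{x \<in> space ?M. x j i \<le> x k i} \<in> sets ?M" if "j < m" "k < m" "i < d" for j k i
    using coord that by (intro borel_measurable_le) auto
  have comp: "{x \<in> space ?M. comparable d (x j) (x k)} \<in> sets ?M" if "j < m" "k < m" for j k
  proof -
    have *: "{x \<in> space ?M. \<forall>i\<in>{..<d}. x j i \<le> x k i} \<in> sets ?M" if "j < m" "k < m" for j k
      using le that by (intro sets.sets_Collect_finite_All) auto
    have "{x \<in> space ?M. comparable d (x j) (x k)}
        = {x \<in> space ?M. \<forall>i\<in>{..<d}. x j i \<le> x k i} \<union> {x \<in> space ?M. \<forall>i\<in>{..<d}. x k i \<le> x j i}"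
      by (auto simp: comparable_def comp_le_def)
    then show ?thesis using *[OF that] *[OF that(2,1)] by (simp only: sets.Un)
  qed
  have "{x \<in> space ?M. a \<le> real (longest_chain d m x)}
      = (\<Union>J\<in>{J. J \<subseteq> {..<m} \<and> a \<le> real (card J)}.
          {x \<in> space ?M. \<forall>z\<in>{z \<in> J \<times> J. fst z \<noteq> snd z}. comparable d (x (fst z)) (x (snd z))})"
  proof (intro set_eqI iffI)
    fix x assume x: "x \<in> {x \<in> space ?M. a \<le> real (longest_chain d m x)}"
    obtain J where "J \<subseteq> {..<m}" "pairwise (\<lambda>j k. comparable d (x j) (x k)) J" "card J = longest_chain d m x"
      by (rule longest_chain_obtains)
    then show "x \<in> (\<Union>J\<in>{J. J \<subseteq> {..<m} \<and> a \<le> real (card J)}.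
          {x \<in> space ?M. \<forall>z\<in>{z \<in> J \<times> J. fst z \<noteq> snd z}. comparable d (x (fst z)) (x (snd z))})"
      using x by (auto simp: pairwise_def intro!: exI[of _ J])
  next
    fix x assume "x \<in> (\<Union>J\<in>{J. J \<subseteq> {..<m} \<and> a \<le> real (card J)}.
          {x \<in> space ?M. \<forall>z\<in>{z \<in> J \<times> J. fst z \<noteq> snd z}. comparable d (x (fst z)) (x (snd z))})"
    then obtain J where "J \<subseteq> {..<m}" "a \<le> real (card J)" "x \<in> space ?M"
        "pairwise (\<lambda>j k. comparable d (x j) (x k)) J"
      by (auto simp: pairwise_def)
    then show "x \<in> {x \<in> space ?M. a \<le> real (longest_chain d m x)}"
      using card_le_longest_chain[of J m d x] by simp
  qed
  also have "\<dots> \<in> sets ?M"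
  proof (rule sets.finite_UN)
    show "finite {J. J \<subseteq> {..<m} \<and> a \<le> real (card J)}"
      by (rule finite_subset[of _ "Pow {..<m}"]) auto
    fix J assume J: "J \<in> {J. J \<subseteq> {..<m} \<and> a \<le> real (card J)}"
    then have "finite J" using finite_subset by auto
    show "{x \<in> space ?M. \<forall>z\<in>{z \<in> J \<times> J. fst z \<noteq> snd z}. comparable d (x (fst z)) (x (snd z))} \<in> sets ?M"
      using J \<open>finite J\<close> by (intro sets.sets_Collect_finite_All comp) auto
  qed
  finally show "{x \<in> space ?M. a \<le> real (longest_chain d m x)} \<in> sets ?M" .
qed

section \<open>The limit constant and the main theorem\<close>

lemma geom_mean_cube: "0 < d \<Longrightarrow> geom_mean d (\<lambda>_. b) = real b"
  by (cases "b = 0") (simp_all add: geom_mean_def powr_powr flip: powr_realpow)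

text \<open>The detour through finite subsets makes the event increasing: on infinite sets
  \<open>max_noncrossing\<close> is a maximum over an infinite set and hence meaningless.\<close>

definition long_matching :: "nat \<Rightarrow> real \<Rightarrow> (nat \<Rightarrow> nat) set set" where
  "long_matching d t = {Y. \<exists>X. X \<subseteq> Y \<and> finite X \<and> t \<le> real (max_noncrossing d X)}"

lemma long_matching_mono: "X \<subseteq> Y \<Longrightarrow> X \<in> long_matching d t \<Longrightarrow> Y \<in> long_matching d t"
  unfolding long_matching_def by blast

lemma long_matching_iff: "finite Y \<Longrightarrow> Y \<in> long_matching d t \<longleftrightarrow> t \<le> real (max_noncrossing d Y)"
proof
  assume Y: "finite Y" "Y \<in> long_matching d t"
  then obtain X where "X \<subseteq> Y" "t \<le> real (max_noncrossing d X)" by (auto simp: long_matching_def)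
  moreover have "max_noncrossing d X \<le> max_noncrossing d Y" using Y(1) calculation(1) by (rule max_noncrossing_mono)
  ultimately show "t \<le> real (max_noncrossing d Y)" by linarith
qed (auto simp: long_matching_def)

lemma prob_long_matching_mono:
  "k \<le> l \<Longrightarrow> measure_pmf.prob (random_point_set S k) (long_matching d t)
    \<le> measure_pmf.prob (random_point_set S l) (long_matching d t)"
  by (rule prob_random_point_set_mono) (auto intro: long_matching_mono)

lemma intensity_one_minus_exp: "intensity (1 - exp (- y)) = y"
  by (simp add: intensity_def)

section \<open>Tail bounds for chains of uniform points\<close>

lemma tendsto_exp_minus_powr:
  assumes "0 < \<kappa>" "0 < d"
  shows "(\<lambda>m. exp (- (\<kappa> * real m powr (1 / real d)))) \<longlonglongrightarrow> 0"
proof -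
  have "filterlim (\<lambda>x::real. x powr (1 / real d)) at_top at_top"
    using assms(2) by (intro real_powr_at_top) simp
  from filterlim_compose[OF this filterlim_real_sequentially]
  have "filterlim (\<lambda>m. \<kappa> * real m powr (1 / real d)) at_top sequentially"
    using assms(1) by (intro filterlim_tendsto_pos_mult_at_top[OF tendsto_const])
  then have "filterlim (\<lambda>m. - (\<kappa> * real m powr (1 / real d))) at_bot sequentially"
    by (simp add: filterlim_uminus_at_bot)
  then show ?thesis by (rule filterlim_compose[OF exp_at_bot])
qed

text \<open>With slightly more than \<open>m\<close> points on average, the Poisson count reaches
  \<open>m\<close> with probability at least 1/2, so an increasing event for \<open>m\<close> points
  costs at most a factor 2 against independent cells. There the supremum bounds the mean and the
  self-bounding tail applies, uniformly in the mesh \<open>b\<close>.\<close>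

lemma chain_limit_upper:
  assumes d: "0 < d" and \<delta>: "0 < \<delta>"
  shows "\<exists>\<kappa>>0. eventually (\<lambda>m. \<forall>A\<subseteq>space (uniform_points d m).
      (\<forall>x\<in>A. real (longest_chain d m x) \<ge> (chain_sup d + \<delta>) * real m powr (1 / real d)) \<longrightarrow>
      measure (uniform_points d m) A \<le> 2 * exp (- (\<kappa> * real m powr (1 / real d)))) sequentially"
proof -
  let ?c = "chain_sup d"
  have c: "?c > 0" by (rule chain_sup_pos[OF d])
  \<comment> \<open>Spends half of \<delta> on the surplus of points, since
    \<open>c * s = c + \<delta> / 2\<close>; the other half is left for the deviation.\<close>
  define s where "s = 1 + \<delta> / (2 * ?c)"
  have s: "1 < s" using c \<delta> by (simp add: s_def)
  have cs: "?c * s = ?c + \<delta> / 2" using c by (simp add: s_def algebra_simps)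
  define \<kappa> where "\<kappa> = \<delta>\<^sup>2 / (16 * (?c + \<delta>))"
  have \<kappa>: "\<kappa> > 0" using c \<delta> by (simp add: \<kappa>_def)
  have "eventually (\<lambda>m. \<forall>A\<subseteq>space (uniform_points d m).
      (\<forall>x\<in>A. real (longest_chain d m x) \<ge> (chain_sup d + \<delta>) * real m powr (1 / real d)) \<longrightarrow>
      measure (uniform_points d m) A \<le> 2 * exp (- (\<kappa> * real m powr (1 / real d)))) sequentially"
    using eventually_poisson_ge[OF s] eventually_gt_at_top[of 0]
  proof eventually_elim
    case (elim m)
    define R where "R = real m powr (1 / real d)"
    have R: "R > 0" using elim by (simp add: R_def)
    define v where "v = s * real m"
    have v: "v > 0" using s elim by (simp add: v_def)
    define t where "t = (?c + \<delta>) * R"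
    have tail: "measure_pmf.prob (random_point_set (complete_edges d (\<lambda>_. b)) m) (long_matching d t)
        \<le> 2 * exp (- (\<kappa> * R))" if b: "0 < b" for b
    proof -
      let ?S = "complete_edges d (\<lambda>_. b)"
      define p where "p = 1 - exp (- v / real (card ?S))"
      have card: "real (card ?S) = real b ^ d" by (simp add: card_complete_edges)
      have p: "0 < p" "p < 1" using v b by (auto simp: p_def card)
      have "mean_noncrossing d (\<lambda>_. b) p \<le> ?c * (real b * intensity p powr (1 / real d))"
        using mean_noncrossing_le_chain_sup[OF d _ p, of "\<lambda>_. b"] b by (simp add: geom_mean_cube[OF d])
      also have "intensity p = v / real b ^ d"
        using intensity_one_minus_exp[of "v / real b ^ d"] by (simp add: p_def card)
      also have "real b * (v / real b ^ d) powr (1 / real d) = v powr (1 / real d)"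
      proof -
        have "(real b ^ d) powr (1 / real d) = real b"
          using b d by (simp add: powr_powr flip: powr_realpow)
        then show ?thesis using b v by (simp add: powr_divide)
      qed
      also have "v powr (1 / real d) \<le> s * R"
      proof -
        have "s powr (1 / real d) \<le> s powr 1" using s d by (intro powr_mono) auto
        then show ?thesis using s R elim by (simp add: v_def R_def powr_mult)
      qed
      finally have mu: "mean_noncrossing d (\<lambda>_. b) p \<le> (?c + \<delta> / 2) * R"
        using c by (simp add: cs[symmetric])
      have t_eq: "t = (?c + \<delta> / 2) * R + \<delta> / 2 * R" by (simp add: t_def algebra_simps)
      have "measure_pmf.prob (bernoulli_subset ?S p) (long_matching d t)
          \<le> measure_pmf.prob (bernoulli_subset ?S p) {X. t \<le> real (max_noncrossing d X)}"
      proof (rule measure_pmf.finite_measure_mono_AE)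
        show "AE X in bernoulli_subset ?S p. X \<in> long_matching d t \<longrightarrow> X \<in> {X. t \<le> real (max_noncrossing d X)}"
          by (rule AE_bernoulli_subsetI)
             (use long_matching_iff finite_subset[OF _ finite_complete_edges] in blast)
      qed simp
      also have "\<dots> \<le> exp (- ((\<delta> / 2 * R)\<^sup>2 / (4 * ((?c + \<delta> / 2) * R + \<delta> / 2 * R))))"
        unfolding t_eq using mu p c \<delta> R
        by (intro self_bounding_upper_tail self_bounding_max_noncrossing) (auto simp: mean_noncrossing_def)
      also have "(\<delta> / 2 * R)\<^sup>2 / (4 * ((?c + \<delta> / 2) * R + \<delta> / 2 * R)) = \<kappa> * R"
        unfolding t_eq[symmetric] using c \<delta> R by (simp add: t_def \<kappa>_def power2_eq_square)
      finally have 1: "measure_pmf.prob (bernoulli_subset ?S p) (long_matching d t) \<le> exp (- (\<kappa> * R))" .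
      have "measure_pmf.prob (poisson_pmf v) {m..} * measure_pmf.prob (random_point_set ?S m) (long_matching d t)
          \<le> measure_pmf.prob (bernoulli_subset ?S p) (long_matching d t)"
        unfolding p_def
        by (rule prob_bernoulli_ge_random_point_set[OF finite_complete_edges complete_edges_cube_ne[OF b] v])
           (simp add: prob_long_matching_mono)
      moreover have "1 / 2 * measure_pmf.prob (random_point_set ?S m) (long_matching d t)
          \<le> measure_pmf.prob (poisson_pmf v) {m..} * measure_pmf.prob (random_point_set ?S m) (long_matching d t)"
        using elim(1) unfolding v_def by (intro mult_right_mono) auto
      ultimately show ?thesis using 1 by simp
    qed
    show ?case
    proof (intro allI impI)
      fix A assume A: "A \<subseteq> space (uniform_points d m)"
        "\<forall>x\<in>A. real (longest_chain d m x) \<ge> (chain_sup d + \<delta>) * real m powr (1 / real d)"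
      show "measure (uniform_points d m) A \<le> 2 * exp (- (\<kappa> * real m powr (1 / real d)))"
      \<comment> \<open>The mesh is chosen for each \<open>e\<close> so that conflicts have
        probability at most \<open>e\<close>; the main term does not depend on the mesh.\<close>
      proof (rule field_le_epsilon)
        fix e :: real assume e: "0 < e"
        obtain b where b: "real b > real (m * m * d) / e" using reals_Archimedean2 by blast
        moreover have "0 \<le> real (m * m * d) / e" using e by simp
        ultimately have "0 < real b" by linarith
        then have b0: "0 < b" by simp
        let ?R = "random_points (complete_edges d (\<lambda>_. b)) m"
        have "measure (uniform_points d m) A
            \<le> measure_pmf.prob ?R ({\<omega>. \<omega> ` {..<m} \<in> long_matching d t} \<union> {\<omega>. conflicts d \<omega> {..<m} \<noteq> {}})"
        proof (rule measure_le_prob_random_points[OF b0 A(1)])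
          fix x assume "x \<in> A"
          then have t: "t \<le> real (longest_chain d m x)" using A(2) by (simp add: t_def R_def)
          have "t \<le> real (max_noncrossing d (cells d m b x ` {..<m}))"
            if "conflicts d (cells d m b x) {..<m} = {}"
            using longest_chain_le_max_noncrossing_cells[OF d that] t by linarith
          then show "cells d m b x \<in> {\<omega>. \<omega> ` {..<m} \<in> long_matching d t} \<union> {\<omega>. conflicts d \<omega> {..<m} \<noteq> {}}"
            by (auto simp: long_matching_iff)
        qed
        also have "\<dots> \<le> measure_pmf.prob ?R {\<omega>. \<omega> ` {..<m} \<in> long_matching d t}
            + measure_pmf.prob ?R {\<omega>. conflicts d \<omega> {..<m} \<noteq> {}}"
          by (rule measure_Un_le) auto
        also have "measure_pmf.prob ?R {\<omega>. \<omega> ` {..<m} \<in> long_matching d t}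
            = measure_pmf.prob (random_point_set (complete_edges d (\<lambda>_. b)) m) (long_matching d t)"
          by (simp add: random_point_set_def vimage_def)
        also have "\<dots> \<le> 2 * exp (- (\<kappa> * R))" by (rule tail[OF b0])
        also have "measure_pmf.prob ?R {\<omega>. conflicts d \<omega> {..<m} \<noteq> {}} \<le> real (m * m * d) / real b"
          by (rule prob_conflicts_random_points_le[OF b0])
        also have "real (m * m * d) / real b \<le> e" using b b0 e by (simp add: field_simps)
        finally show "measure (uniform_points d m) A \<le> 2 * exp (- (\<kappa> * real m powr (1 / real d))) + e"
          by (simp add: R_def)
      qed
    qed
  qed
  then show ?thesis using \<kappa> by blast
qed

text \<open>The mirror image: with slightly fewer than \<open>m\<close> points on average, the
  decreasing event of having no long matching costs at most a factor 2. One fine mesh suffices,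
  because matchings of cells never exceed chains of points.\<close>

lemma chain_limit_lower:
  assumes d: "0 < d" and \<delta>: "0 < \<delta>" "\<delta> \<le> chain_sup d"
  shows "\<exists>\<kappa>>0. eventually (\<lambda>m. \<forall>A\<subseteq>space (uniform_points d m).
      (\<forall>x\<in>A. real (longest_chain d m x) < (chain_sup d - \<delta>) * real m powr (1 / real d)) \<longrightarrow>
      measure (uniform_points d m) A \<le> 2 * exp (- (\<kappa> * real m powr (1 / real d)))) sequentially"
proof -
  let ?c = "chain_sup d"
  have c: "?c > 0" by (rule chain_sup_pos[OF d])
  \<comment> \<open>In units of \<open>e * c\<close>, the mean loses at most three: from
    \<open>mean_noncrossing_lower\<close>, from the deficit \<open>s\<close> of points, and from
    replacing \<open>y\<close> by \<open>p\<close>. The fourth is the deviation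
    \<open>\<delta> / 4\<close>.\<close>
  define e where "e = \<delta> / (4 * ?c)"
  have e: "0 < e" "e \<le> 1 / 4" using c \<delta> by (auto simp: e_def)
  have ec: "4 * e * ?c = \<delta>" using c by (simp add: e_def)
  obtain B A where B: "B > 0" and A: "A > 0"
    and low: "\<And>n p. 0 < p \<Longrightarrow> p < 1 \<Longrightarrow> geom_mean d n * p powr (1 / real d) \<ge> A \<Longrightarrow>
      (\<forall>i<d. real (n i) \<ge> B * (geom_mean d n * p powr (1 / real d))) \<Longrightarrow>
      mean_noncrossing d n p \<ge> (1 - e) * ?c * (geom_mean d n * p powr (1 / real d))"
    using mean_noncrossing_lower[OF d, of e] e by fastforce
  define s where "s = 1 - e"
  have s: "0 < s" "s < 1" using e by (auto simp: s_def)
  define \<kappa> where "\<kappa> = \<delta>\<^sup>2 / (32 * ?c)"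
  have \<kappa>: "\<kappa> > 0" using c \<delta> by (simp add: \<kappa>_def)
  have "filterlim (\<lambda>x::real. x powr (1 / real d)) at_top at_top"
    using d by (intro real_powr_at_top) simp
  from filterlim_compose[OF this filterlim_real_sequentially]
  have "eventually (\<lambda>m. real m powr (1 / real d) \<ge> A / s\<^sup>2) sequentially"
    by (simp add: filterlim_at_top)
  then have "eventually (\<lambda>m. \<forall>A\<subseteq>space (uniform_points d m).
      (\<forall>x\<in>A. real (longest_chain d m x) < (chain_sup d - \<delta>) * real m powr (1 / real d)) \<longrightarrow>
      measure (uniform_points d m) A \<le> 2 * exp (- (\<kappa> * real m powr (1 / real d)))) sequentially"
    using eventually_poisson_le[OF s] eventually_gt_at_top[of 0]
  proof eventually_elim
    case (elim m)
    define R where "R = real m powr (1 / real d)"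
    have R: "R > 0" "R \<ge> A / s\<^sup>2" using elim by (auto simp: R_def)
    define v where "v = s * real m"
    have v: "v > 0" using s elim by (simp add: v_def)
    \<comment> \<open>The mesh depends on \<open>m\<close>: the first bound is the side condition of
      \<open>mean_noncrossing_lower\<close>, the second makes the occupation probability close to
      \<open>y\<close>.\<close>
    obtain b0 where b0: "real b0 > max (B * v powr (1 / real d)) (v / e)" using reals_Archimedean2 by blast
    define b where "b = Suc b0"
    have b: "0 < b" "real b \<ge> B * v powr (1 / real d)" "real b \<ge> v / e" using b0 by (auto simp: b_def)
    let ?S = "complete_edges d (\<lambda>_. b)"
    define y where "y = v / real b ^ d"
    define p where "p = 1 - exp (- v / real (card ?S))"
    define M where "M = real b * p powr (1 / real d)"
    have card: "real (card ?S) = real b ^ d" by (simp add: card_complete_edges)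
    have p_y: "p = 1 - exp (- y)" by (simp add: p_def y_def card)
    have y: "0 < y" "y \<le> e"
    proof -
      have "real b ^ 1 \<le> real b ^ d" using b d by (intro power_increasing) auto
      then have "v / real b ^ d \<le> v / real b" using v b by (intro divide_left_mono) auto
      also have "v / real b \<le> e" using b(1,3) e by (simp add: field_simps)
      finally show "y \<le> e" by (simp add: y_def)
    qed (use v b in \<open>simp add: y_def\<close>)
    have p: "0 < p" "p < 1" "p \<le> y" using y exp_ge_add_one_self[of "- y"] by (auto simp: p_y)
    have p_ge: "p \<ge> s * y"
    proof -
      have "s * y \<le> y - y\<^sup>2 / 2"
      proof -
        have "y * y \<le> y * e" "0 \<le> y * e" using y e by (auto intro: mult_left_mono)
        then show ?thesis by (simp add: s_def power2_eq_square algebra_simps)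
      qed
      then show ?thesis using exp_minus_le_quadratic[of y] y by (simp add: p_y)
    qed
    have b_root: "(real b ^ d) powr (1 / real d) = real b"
      using b d by (simp add: powr_powr flip: powr_realpow)
    have M_eq: "M = (real b ^ d * p) powr (1 / real d)"
      using p b by (simp add: M_def powr_mult b_root)
    have M_ge: "M \<ge> s\<^sup>2 * R"
    proof -
      have "s\<^sup>2 \<le> 1" using s by (intro power_le_one) auto
      then have "s\<^sup>2 powr 1 \<le> s\<^sup>2 powr (1 / real d)" using s d by (intro powr_mono') auto
      then have "s\<^sup>2 * R \<le> (s\<^sup>2) powr (1 / real d) * R" using R s by (intro mult_right_mono) auto
      also have "\<dots> = (s\<^sup>2 * real m) powr (1 / real d)" using s by (simp add: powr_mult R_def)
      also have "\<dots> = (real b ^ d * (s * y)) powr (1 / real d)"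
        using b by (simp add: y_def v_def power2_eq_square mult_ac)
      also have "\<dots> \<le> M" unfolding M_eq using p_ge s y by (intro powr_mono2 mult_left_mono) auto
      finally show ?thesis .
    qed
    have M_le: "M \<le> v powr (1 / real d)"
    proof -
      have "real b ^ d * p \<le> real b ^ d * y" using p by (intro mult_left_mono) auto
      also have "\<dots> = v" using b by (simp add: y_def)
      finally show ?thesis unfolding M_eq using p by (intro powr_mono2) auto
    qed
    define mu where "mu = mean_noncrossing d (\<lambda>_. b) p"
    have "mu \<ge> (1 - e) * ?c * M"
    proof -
      have "A \<le> s\<^sup>2 * R" using R(2) s by (simp add: field_simps)
      moreover have "B * M \<le> B * v powr (1 / real d)" using M_le B by (intro mult_left_mono) auto
      ultimately have "A \<le> M" "\<forall>i<d. B * M \<le> real b" using M_ge b(2) by auto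
      then show ?thesis
        using low[OF p(1,2), of "\<lambda>_. b"] unfolding mu_def geom_mean_cube[OF d] M_def[symmetric] by blast
    qed
    moreover have "(1 - 3 * e) * ?c * R \<le> (1 - e) * ?c * M"
    proof -
      have "(1 - 3 * e) \<le> (1 - e) * s\<^sup>2"
      proof -
        have "(1 - e) * s\<^sup>2 - (1 - 3 * e) = e\<^sup>2 * (3 - e)"
          by (simp add: s_def power2_eq_square algebra_simps)
        moreover have "e\<^sup>2 * (3 - e) \<ge> 0" using e by simp
        ultimately show ?thesis by linarith
      qed
      then have "(1 - 3 * e) * (?c * R) \<le> ((1 - e) * s\<^sup>2) * (?c * R)"
        using c R by (intro mult_right_mono) auto
      also have "\<dots> = ((1 - e) * ?c) * (s\<^sup>2 * R)" by simp
      also have "\<dots> \<le> ((1 - e) * ?c) * M" using M_ge c e by (intro mult_left_mono) auto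
      finally show ?thesis by (simp add: mult_ac)
    qed
    moreover have "(1 - 3 * e) * ?c = ?c - 3 / 4 * \<delta>" using ec by (simp add: algebra_simps)
    ultimately have mu_ge: "mu \<ge> (?c - 3 / 4 * \<delta>) * R" by simp
    have mu_pos: "mu > 0" unfolding mu_def using b p by (intro mean_noncrossing_pos) auto
    have mu_le: "mu \<le> ?c * R"
    proof -
      have "mu \<le> ?c * (real b * intensity p powr (1 / real d))"
        using mean_noncrossing_le_chain_sup[OF d _ p(1,2), of "\<lambda>_. b"] b
        by (simp add: geom_mean_cube[OF d] mu_def)
      also have "intensity p = v / real b ^ d"
        unfolding p_y intensity_one_minus_exp by (simp add: y_def)
      also have "real b * (v / real b ^ d) powr (1 / real d) = v powr (1 / real d)"
        using b v b_root by (simp add: powr_divide)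
      also have "v powr (1 / real d) \<le> R"
        unfolding R_def using s by (intro powr_mono2) (auto simp: v_def mult_left_le_one_le)
      finally show ?thesis using c by simp
    qed
    define t where "t = (?c - \<delta>) * R"
    define u where "u = mu - t"
    have u: "u \<ge> \<delta> / 4 * R" using mu_ge by (simp add: u_def t_def algebra_simps)
    have "0 \<le> \<delta> / 4 * R" using \<delta> R by simp
    then have u0: "u \<ge> 0" using u by linarith
    have "measure_pmf.prob (bernoulli_subset ?S p) (- long_matching d t)
        \<le> measure_pmf.prob (bernoulli_subset ?S p) {X. real (max_noncrossing d X) \<le> mu - u}"
    proof (rule measure_pmf.finite_measure_mono_AE)
      have "real (max_noncrossing d X) \<le> mu - u" if "X \<subseteq> ?S" "X \<notin> long_matching d t" for X
        using that long_matching_iff[OF finite_subset[OF that(1) finite_complete_edges], of d t]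
        by (simp add: u_def)
      then show "AE X in bernoulli_subset ?S p. X \<in> - long_matching d t \<longrightarrow>
          X \<in> {X. real (max_noncrossing d X) \<le> mu - u}"
        by (intro AE_bernoulli_subsetI) auto
    qed simp
    also have "\<dots> \<le> exp (- (u\<^sup>2 / (2 * mu)))"
      using p mu_pos u0
      by (intro self_bounding_lower_tail self_bounding_max_noncrossing) (auto simp: mean_noncrossing_def mu_def)
    also have "\<dots> \<le> exp (- (\<kappa> * R))"
    proof -
      have "\<kappa> * R = (\<delta> / 4 * R)\<^sup>2 / (2 * (?c * R))" using c R by (simp add: \<kappa>_def power2_eq_square)
      also have "\<dots> \<le> u\<^sup>2 / (2 * mu)"
        using u \<delta> R mu_pos mu_le by (intro frac_le power_mono) auto
      finally show ?thesis by simp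
    qed
    finally have 1: "measure_pmf.prob (bernoulli_subset ?S p) (- long_matching d t) \<le> exp (- (\<kappa> * R))" .
    have "measure_pmf.prob (random_point_set ?S m) (- long_matching d t)
        \<le> measure_pmf.prob (random_point_set ?S k) (- long_matching d t)" if "k \<in> {..m}" for k
    proof -
      have "measure_pmf.prob (random_point_set ?S k) (long_matching d t)
          \<le> measure_pmf.prob (random_point_set ?S m) (long_matching d t)"
        using that by (intro prob_long_matching_mono) simp
      then show ?thesis
        using measure_pmf.prob_compl[of "long_matching d t" "random_point_set ?S k"]
          measure_pmf.prob_compl[of "long_matching d t" "random_point_set ?S m"]
        by (simp add: Compl_eq_Diff_UNIV)
    qed
    then have "measure_pmf.prob (poisson_pmf v) {..m} * measure_pmf.prob (random_point_set ?S m) (- long_matching d t)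
        \<le> measure_pmf.prob (bernoulli_subset ?S p) (- long_matching d t)"
      unfolding p_def
      by (intro prob_bernoulli_ge_random_point_set[OF finite_complete_edges complete_edges_cube_ne[OF b(1)] v])
    moreover have "1 / 2 * measure_pmf.prob (random_point_set ?S m) (- long_matching d t)
        \<le> measure_pmf.prob (poisson_pmf v) {..m} * measure_pmf.prob (random_point_set ?S m) (- long_matching d t)"
      using elim(2) unfolding v_def by (intro mult_right_mono) auto
    ultimately have 2: "measure_pmf.prob (random_point_set ?S m) (- long_matching d t) \<le> 2 * exp (- (\<kappa> * R))"
      using 1 by simp
    show ?case
    proof (intro allI impI)
      fix A assume A: "A \<subseteq> space (uniform_points d m)"
        "\<forall>x\<in>A. real (longest_chain d m x) < (chain_sup d - \<delta>) * real m powr (1 / real d)"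
      have "measure (uniform_points d m) A
          \<le> measure_pmf.prob (random_points ?S m) {\<omega>. \<omega> ` {..<m} \<notin> long_matching d t}"
      proof (rule measure_le_prob_random_points[OF b(1) A(1)])
        fix x assume "x \<in> A"
        then have "real (longest_chain d m x) < t" using A(2) by (simp add: t_def R_def)
        then have "real (max_noncrossing d (cells d m b x ` {..<m})) < t"
          using max_noncrossing_cells_le_longest_chain[of d m b x] by linarith
        then show "cells d m b x \<in> {\<omega>. \<omega> ` {..<m} \<notin> long_matching d t}"
          by (simp add: long_matching_iff)
      qed
      also have "\<dots> = measure_pmf.prob (random_point_set ?S m) (- long_matching d t)"
        by (simp add: random_point_set_def vimage_def Compl_eq)
      finally show "measure (uniform_points d m) A \<le> 2 * exp (- (\<kappa> * real m powr (1 / real d)))"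
        using 2 by (simp add: R_def)
    qed
  qed
  then show ?thesis using \<kappa> by blast
qed

section \<open>Convergence in probability and the limit constant\<close>

lemma sets_longest_chain:
  assumes "B \<in> sets borel"
  shows "{x \<in> space (uniform_points d m). real (longest_chain d m x) \<in> B} \<in> sets (uniform_points d m)"
proof -
  have "{x \<in> space (uniform_points d m). real (longest_chain d m x) \<in> B}
      = (\<lambda>x. real (longest_chain d m x)) -` B \<inter> space (uniform_points d m)" by auto
  then show ?thesis using measurable_sets[OF measurable_longest_chain assms] by simp
qed

text \<open>The lower side has its own width \<open>\<delta>'\<close> because the lower estimate
  asks for a width of at most the constant itself.\<close>

lemma measure_deviation_le:
  fixes R c \<delta> \<delta>' a b :: real
  assumes R: "0 < R" and \<delta>: "\<delta>' \<le> \<delta>"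
    and upper: "\<And>A. A \<subseteq> space (uniform_points d m) \<Longrightarrow>
      (\<forall>x\<in>A. real (longest_chain d m x) \<ge> (c + \<delta>) * R) \<Longrightarrow> measure (uniform_points d m) A \<le> a"
    and lower: "\<And>A. A \<subseteq> space (uniform_points d m) \<Longrightarrow>
      (\<forall>x\<in>A. real (longest_chain d m x) < (c - \<delta>') * R) \<Longrightarrow> measure (uniform_points d m) A \<le> b"
  shows "measure (uniform_points d m)
      {x \<in> space (uniform_points d m). \<bar>real (longest_chain d m x) / R - c\<bar> > \<delta>} \<le> a + b"
proof -
  let ?M = "uniform_points d m"
  let ?A = "{x \<in> space ?M. \<bar>real (longest_chain d m x) / R - c\<bar> > \<delta>}"
  let ?A1 = "{x \<in> space ?M. real (longest_chain d m x) \<in> {(c + \<delta>) * R..}}"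
  let ?A2 = "{x \<in> space ?M. real (longest_chain d m x) \<in> {..<(c - \<delta>') * R}}"
  have sets: "?A1 \<in> sets ?M" "?A2 \<in> sets ?M"
    by (rule sets_longest_chain, simp)+
  have "?A \<subseteq> ?A1 \<union> ?A2"
  proof
    fix x assume x: "x \<in> ?A"
    then consider "real (longest_chain d m x) / R > c + \<delta>" | "real (longest_chain d m x) / R < c - \<delta>"
      by (auto simp: abs_if split: if_splits)
    then show "x \<in> ?A1 \<union> ?A2"
    proof cases
      case 1
      then have "real (longest_chain d m x) > (c + \<delta>) * R" using R by (simp add: pos_less_divide_eq)
      then show ?thesis using x by simp
    next
      case 2
      then have "real (longest_chain d m x) / R < c - \<delta>'" using \<delta> by linarith
      then have "real (longest_chain d m x) < (c - \<delta>') * R" using R by (simp add: pos_divide_less_eq)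
      then show ?thesis using x by simp
    qed
  qed
  then have "measure ?M ?A \<le> measure ?M (?A1 \<union> ?A2)"
    using prob_space_uniform_points[of d m] sets
    by (intro finite_measure.finite_measure_mono) (auto intro: prob_space.finite_measure)
  also have "\<dots> \<le> measure ?M ?A1 + measure ?M ?A2" using sets by (rule measure_Un_le)
  also have "measure ?M ?A1 \<le> a" by (rule upper) auto
  also have "measure ?M ?A2 \<le> b" by (rule lower) auto
  finally show ?thesis by simp
qed

lemma eventually_deviation_le:
  assumes d: "0 < d" and \<delta>: "0 < \<delta>"
  shows "\<exists>\<kappa>1>0. \<exists>\<kappa>2>0. eventually (\<lambda>m. measure (uniform_points d m)
      {x \<in> space (uniform_points d m).
        \<bar>real (longest_chain d m x) / real m powr (1 / real d) - chain_sup d\<bar> > \<delta>}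
      \<le> 2 * exp (- (\<kappa>1 * real m powr (1 / real d))) + 2 * exp (- (\<kappa>2 * real m powr (1 / real d)))) sequentially"
proof -
  let ?c = "chain_sup d"
  let ?R = "\<lambda>m. real m powr (1 / real d)"
  define \<delta>' where "\<delta>' = min \<delta> ?c"
  have \<delta>': "0 < \<delta>'" "\<delta>' \<le> ?c" "\<delta>' \<le> \<delta>" using \<delta> chain_sup_pos[OF d] by (simp_all add: \<delta>'_def)
  from chain_limit_upper[OF d \<delta>] obtain \<kappa>1 where \<kappa>1: "\<kappa>1 > 0"
    and up: "eventually (\<lambda>m. \<forall>A\<subseteq>space (uniform_points d m).
      (\<forall>x\<in>A. real (longest_chain d m x) \<ge> (?c + \<delta>) * ?R m) \<longrightarrow>
      measure (uniform_points d m) A \<le> 2 * exp (- (\<kappa>1 * ?R m))) sequentially"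
    by (elim exE conjE)
  from chain_limit_lower[OF d \<delta>'(1,2)] obtain \<kappa>2 where \<kappa>2: "\<kappa>2 > 0"
    and low: "eventually (\<lambda>m. \<forall>A\<subseteq>space (uniform_points d m).
      (\<forall>x\<in>A. real (longest_chain d m x) < (?c - \<delta>') * ?R m) \<longrightarrow>
      measure (uniform_points d m) A \<le> 2 * exp (- (\<kappa>2 * ?R m))) sequentially"
    by (elim exE conjE)
  have "eventually (\<lambda>m. measure (uniform_points d m)
      {x \<in> space (uniform_points d m). \<bar>real (longest_chain d m x) / ?R m - ?c\<bar> > \<delta>}
      \<le> 2 * exp (- (\<kappa>1 * ?R m)) + 2 * exp (- (\<kappa>2 * ?R m))) sequentially"
    using up low eventually_gt_at_top[of 0]
  proof eventually_elim
    case (elim m)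
    have "?R m > 0" using elim(3) by simp
    then show ?case
      by (rule measure_deviation_le[OF _ \<delta>'(3)]) (use elim(1,2) in simp_all)
  qed
  then show ?thesis using \<kappa>1 \<kappa>2 by (intro exI conjI)
qed

lemma deviation_tendsto_0:
  assumes d: "0 < d" and \<delta>: "0 < \<delta>"
  shows "(\<lambda>m. measure (uniform_points d m) {x \<in> space (uniform_points d m).
    \<bar>real (longest_chain d m x) / real m powr (1 / real d) - chain_sup d\<bar> > \<delta>}) \<longlonglongrightarrow> 0"
proof -
  from eventually_deviation_le[OF d \<delta>] obtain \<kappa>1 \<kappa>2 where \<kappa>: "\<kappa>1 > 0" "\<kappa>2 > 0"
    and bound: "eventually (\<lambda>m. measure (uniform_points d m) {x \<in> space (uniform_points d m).
        \<bar>real (longest_chain d m x) / real m powr (1 / real d) - chain_sup d\<bar> > \<delta>}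
      \<le> 2 * exp (- (\<kappa>1 * real m powr (1 / real d))) + 2 * exp (- (\<kappa>2 * real m powr (1 / real d))))
      sequentially"
    by (elim exE conjE)
  have lim: "(\<lambda>m. 2 * exp (- (\<kappa>1 * real m powr (1 / real d))) + 2 * exp (- (\<kappa>2 * real m powr (1 / real d))))
      \<longlonglongrightarrow> 0"
    by (intro tendsto_add_zero tendsto_mult_right_zero tendsto_exp_minus_powr d \<kappa>)
  show ?thesis by (rule Lim_null_comparison[OF _ lim]) (simp add: bound)
qed

lemma chain_limit_chain_sup: "0 < d \<Longrightarrow> chain_limit d (chain_sup d)"
  unfolding chain_limit_def using deviation_tendsto_0 by blast

text \<open>No number is within a third of \<open>\<bar>a - b\<bar>\<close> of both candidates, so
  the two deviation events cover the space and their probabilities cannot both tend to 0. The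
  definite description in \<open>chain_const\<close> rests on this.\<close>

lemma chain_limit_unique:
  assumes "chain_limit d a" "chain_limit d b"
  shows "a = b"
proof (rule ccontr)
  assume "a \<noteq> b"
  define \<delta> where "\<delta> = \<bar>a - b\<bar> / 3"
  have \<delta>: "\<delta> > 0" using \<open>a \<noteq> b\<close> by (simp add: \<delta>_def)
  let ?X = "\<lambda>m x. real (longest_chain d m x) / real m powr (1 / real d)"
  let ?A = "\<lambda>c m. {x \<in> space (uniform_points d m). \<bar>?X m x - c\<bar> > \<delta>}"
  have lim: "(\<lambda>m. measure (uniform_points d m) (?A a m) + measure (uniform_points d m) (?A b m)) \<longlonglongrightarrow> 0 + 0"
    using assms \<delta> unfolding chain_limit_def by (intro tendsto_add) blast+
  have "1 \<le> measure (uniform_points d m) (?A a m) + measure (uniform_points d m) (?A b m)" for m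
  proof -
    have sets: "?A c m \<in> sets (uniform_points d m)" for c
    proof -
      have "{y. \<bar>y / real m powr (1 / real d) - c\<bar> > \<delta>} \<in> sets borel" by measurable
      from sets_longest_chain[OF this, of d m] show ?thesis by (simp only: mem_Collect_eq)
    qed
    have "\<bar>y - a\<bar> > \<delta> \<or> \<bar>y - b\<bar> > \<delta>" for y
      using \<open>a \<noteq> b\<close> unfolding \<delta>_def by (auto simp: abs_if field_simps split: if_splits)
    then have "space (uniform_points d m) = ?A a m \<union> ?A b m" by auto
    then have "1 = measure (uniform_points d m) (?A a m \<union> ?A b m)"
      using prob_space.prob_space[OF prob_space_uniform_points, of d m] by simp
    also have "\<dots> \<le> measure (uniform_points d m) (?A a m) + measure (uniform_points d m) (?A b m)" using sets[of a] sets[of b] by (rule measure_Un_le)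
    finally show ?thesis .
  qed
  then have "(1::real) \<le> 0 + 0" by (intro tendsto_lowerbound[OF lim]) auto
  then show False by simp
qed

lemma chain_const_eq: "0 < d \<Longrightarrow> chain_const d = chain_sup d"
  unfolding chain_const_def
  by (rule the_equality) (auto intro: chain_limit_chain_sup chain_limit_unique)

section \<open>Estimates for the random hypergraph\<close>

lemma random_hypergraph_eq: "random_hypergraph d n p = bernoulli_subset (complete_edges d n) p"
  by (simp add: random_hypergraph_def bernoulli_subset_def)

lemma intensity_le:
  assumes "0 < p" "0 < \<delta>" "p \<le> \<delta> / (1 + \<delta>)"
  shows "p < 1" "intensity p \<le> (1 + \<delta>) * p"
proof -
  have "\<delta> / (1 + \<delta>) < 1" using assms by simp
  then show p1: "p < 1" using assms by linarith
  have "ln (1 / (1 - p)) \<le> 1 / (1 - p) - 1" using p1 by (intro ln_le_minus_one) simp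
  then have "intensity p \<le> 1 / (1 - p) - 1" using p1 by (simp add: intensity_def ln_div)
  also have "\<dots> = p / (1 - p)" using p1 by (simp add: field_simps)
  also have "\<dots> \<le> (1 + \<delta>) * p"
  proof -
    have "1 / (1 + \<delta>) \<le> 1 - p" using assms by (simp add: field_simps)
    then have "1 \<le> (1 + \<delta>) * (1 - p)" using assms by (simp add: field_simps)
    then have "p * 1 \<le> p * ((1 + \<delta>) * (1 - p))" using assms by (intro mult_left_mono) auto
    then show ?thesis using p1 by (simp add: pos_divide_le_eq mult_ac)
  qed
  finally show "intensity p \<le> (1 + \<delta>) * p" .
qed

text \<open>Every class is at most \<open>S\<close>, so \<open>n i\<close> is at least
  \<open>N ^ d / S ^ (d - 1)\<close>. With \<open>S\<close> at most
  \<open>K * p powr (- \<eta>) * N\<close> this leaves \<open>N\<close> times a power of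
  \<open>p\<close>, which beats \<open>B * N * p powr (1 / d)\<close> for small
  \<open>p\<close>.\<close>

lemma class_size_lower_bound:
  assumes d: "2 \<le> d" and \<eta>: "\<eta> < 1 / (2 * real d * (real d - 1))"
    and g: "g \<in> O[at_top](\<lambda>t. t powr \<eta>)" and B: "0 < (B::real)"
  shows "\<exists>p0>0. \<forall>n p. (\<forall>i<d. n i > 0) \<and> 0 < p \<and> p \<le> p0 \<and>
      real (\<Sum>i<d. n i) \<le> g (1 / p) * geom_mean d n \<longrightarrow>
      (\<forall>i<d. B * (geom_mean d n * p powr (1 / real d)) \<le> real (n i))"
proof -
  from g obtain K where K: "K > 0" "eventually (\<lambda>t. norm (g t) \<le> K * norm (t powr \<eta>)) at_top"
    by (rule landau_o.bigE)
  then obtain t0 where t0: "\<And>t. t \<ge> t0 \<Longrightarrow> norm (g t) \<le> K * norm (t powr \<eta>)"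
    by (auto simp: eventually_at_top_linorder)
  \<comment> \<open>The power of \<open>p\<close> that is left over; the bound on \<eta> makes it
    positive.\<close>
  define \<gamma> where "\<gamma> = 1 / real d - \<eta> * real (d - 1)"
  have \<gamma>: "\<gamma> > 0"
  proof -
    have "\<eta> * (real d - 1) < 1 / (2 * real d * (real d - 1)) * (real d - 1)"
      using \<eta> d by (intro mult_strict_right_mono) auto
    also have "\<dots> = 1 / (2 * real d)" using d by simp
    also have "\<dots> < 1 / real d" using d by (simp add: field_simps)
    finally show ?thesis using d by (simp add: \<gamma>_def of_nat_diff)
  qed
  define T where "T = max 1 t0"
  have T: "T > 0" "t0 \<le> T" by (auto simp: T_def)
  \<comment> \<open>The first term brings \<open>1 / p\<close> into the range of the growth bound on
    \<open>g\<close>; the second is the solution of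
    \<open>B * K ^ (d - 1) * p powr \<gamma> = 1\<close>.\<close>
  define p0 where "p0 = min (1 / T) ((1 / (B * K ^ (d - 1))) powr (1 / \<gamma>))"
  have p0: "p0 > 0" using B K T by (simp add: p0_def)
  have "B * (geom_mean d n * p powr (1 / real d)) \<le> real (n i)"
    if n: "\<forall>i<d. n i > 0" and p: "0 < p" "p \<le> p0"
      and S: "real (\<Sum>i<d. n i) \<le> g (1 / p) * geom_mean d n" and i: "i < d" for n p i
  proof -
    define N where "N = geom_mean d n"
    define S where "S = real (\<Sum>i<d. n i)"
    define G where "G = K * p powr (- \<eta>)"
    have N: "N > 0" using geom_mean_pos[of d n] n by (simp add: N_def)
    have G: "G > 0" using K p by (simp add: G_def)
    have "1 / p \<ge> t0"
    proof -
      have "p \<le> 1 / T" using p by (simp add: p0_def)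
      then have "T \<le> 1 / p" using p T by (simp add: field_simps)
      then show ?thesis using T by simp
    qed
    then have "g (1 / p) \<le> K * (1 / p) powr \<eta>" using t0[of "1 / p"] by (auto simp: abs_le_iff)
    also have "(1 / p) powr \<eta> = p powr (- \<eta>)" using p by (simp add: powr_minus powr_divide inverse_eq_divide)
    finally have "S \<le> G * N" using S N unfolding S_def[symmetric] N_def[symmetric] G_def
      by (meson less_imp_le mult_right_mono order_trans)
    have "N ^ d = real (\<Prod>j<d. n j)" using d by (simp add: N_def geom_mean_power del: of_nat_prod)
    also have "(\<Prod>j<d. n j) = n i * (\<Prod>j\<in>{..<d} - {i}. n j)" using i by (intro prod.remove) auto
    also have "real \<dots> \<le> real (n i) * S ^ (d - 1)"
    proof -
      have "(\<Prod>j\<in>{..<d} - {i}. real (n j)) \<le> (\<Prod>j\<in>{..<d} - {i}. S)"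
      proof (rule prod_mono)
        fix j assume "j \<in> {..<d} - {i}"
        then have "n j \<le> (\<Sum>i<d. n i)" by (intro member_le_sum) auto
        then show "0 \<le> real (n j) \<and> real (n j) \<le> S" unfolding S_def by (simp only: of_nat_le_iff) simp
      qed
      then show ?thesis using i by (simp add: mult_left_mono)
    qed
    also have "\<dots> \<le> real (n i) * (G * N) ^ (d - 1)"
      using \<open>S \<le> G * N\<close> by (intro mult_left_mono power_mono) (auto simp: S_def simp del: of_nat_sum)
    finally have "N * N ^ (d - 1) \<le> (real (n i) * G ^ (d - 1)) * N ^ (d - 1)"
      using d by (simp add: power_mult_distrib mult_ac flip: power_Suc)
    then have N_le: "N \<le> real (n i) * G ^ (d - 1)" using N by simp
    have "B * p powr (1 / real d) * G ^ (d - 1) \<le> 1"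
    proof -
      have "G ^ (d - 1) = K ^ (d - 1) * p powr (- \<eta> * real (d - 1))"
        using p by (simp add: G_def power_mult_distrib powr_powr flip: powr_realpow)
      then have "B * p powr (1 / real d) * G ^ (d - 1) = (B * K ^ (d - 1)) * p powr \<gamma>"
        using p by (simp add: \<gamma>_def mult_ac flip: powr_add)
      also have "\<dots> \<le> (B * K ^ (d - 1)) * ((1 / (B * K ^ (d - 1))) powr (1 / \<gamma>)) powr \<gamma>"
        using p B K \<gamma> by (intro mult_left_mono powr_mono2) (auto simp: p0_def)
      also have "\<dots> = 1" using B K \<gamma> by (simp add: powr_powr)
      finally show ?thesis .
    qed
    then have "real (n i) * (B * p powr (1 / real d) * G ^ (d - 1)) \<le> real (n i) * 1"
      by (intro mult_left_mono) auto
    moreover have "B * p powr (1 / real d) * N \<le> B * p powr (1 / real d) * (real (n i) * G ^ (d - 1))"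
      using N_le B by (intro mult_left_mono) auto
    ultimately show ?thesis by (simp add: N_def mult_ac)
  qed
  then show ?thesis using p0 by blast
qed

lemma mean_noncrossing_asymptotic:
  assumes d: "2 \<le> d" and \<eta>: "\<eta> < 1 / (2 * real d * (real d - 1))"
    and g: "g \<in> O[at_top](\<lambda>t. t powr \<eta>)" and \<delta>: "0 < \<delta>" "\<delta> \<le> 1"
  shows "\<exists>p0>0. \<exists>A>0. \<forall>n p. (\<forall>i<d. n i > 0) \<and> 0 < p \<and> p \<le> p0 \<and>
      geom_mean d n * p powr (1 / real d) \<ge> A \<and> real (\<Sum>i<d. n i) \<le> g (1 / p) * geom_mean d n \<longrightarrow>
      p < 1 \<and>
      (1 - \<delta>) * (chain_sup d * geom_mean d n * p powr (1 / real d)) \<le> mean_noncrossing d n p \<and>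
      mean_noncrossing d n p \<le> (1 + \<delta>) * (chain_sup d * geom_mean d n * p powr (1 / real d))"
proof -
  have d0: "0 < d" using d by simp
  let ?c = "chain_sup d"
  have c: "?c > 0" by (rule chain_sup_pos[OF d0])
  obtain B A where B: "B > 0" and A: "A > 0"
    and low: "\<And>n p. 0 < p \<Longrightarrow> p < 1 \<Longrightarrow> geom_mean d n * p powr (1 / real d) \<ge> A \<Longrightarrow>
      (\<forall>i<d. real (n i) \<ge> B * (geom_mean d n * p powr (1 / real d))) \<Longrightarrow>
      mean_noncrossing d n p \<ge> (1 - \<delta>) * ?c * (geom_mean d n * p powr (1 / real d))"
    using mean_noncrossing_lower[OF d0 \<delta>] by fastforce
  obtain p1 where p1: "p1 > 0" and size: "\<And>n p. (\<forall>i<d. n i > 0) \<and> 0 < p \<and> p \<le> p1 \<and>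
      real (\<Sum>i<d. n i) \<le> g (1 / p) * geom_mean d n \<Longrightarrow>
      (\<forall>i<d. B * (geom_mean d n * p powr (1 / real d)) \<le> real (n i))"
    using class_size_lower_bound[OF d \<eta> g B] by blast
  define p0 where "p0 = min p1 (\<delta> / (1 + \<delta>))"
  have p0: "p0 > 0" using p1 \<delta> by (simp add: p0_def)
  have "p < 1 \<and>
      (1 - \<delta>) * (?c * geom_mean d n * p powr (1 / real d)) \<le> mean_noncrossing d n p \<and>
      mean_noncrossing d n p \<le> (1 + \<delta>) * (?c * geom_mean d n * p powr (1 / real d))"
    if n: "\<forall>i<d. n i > 0" and p: "0 < p" "p \<le> p0" and M: "geom_mean d n * p powr (1 / real d) \<ge> A"
      and S: "real (\<Sum>i<d. n i) \<le> g (1 / p) * geom_mean d n" for n p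
  proof -
    have int: "p < 1" "intensity p \<le> (1 + \<delta>) * p"
      using intensity_le[of p \<delta>] p \<delta> by (auto simp: p0_def)
    have "\<forall>i<d. B * (geom_mean d n * p powr (1 / real d)) \<le> real (n i)"
      using size[of n p] n p S by (simp add: p0_def)
    then have "mean_noncrossing d n p \<ge> (1 - \<delta>) * ?c * (geom_mean d n * p powr (1 / real d))"
      using low[OF p(1) int(1) M] by blast
    moreover have "mean_noncrossing d n p \<le> (1 + \<delta>) * (?c * geom_mean d n * p powr (1 / real d))"
    proof -
      have "intensity p powr (1 / real d) \<le> ((1 + \<delta>) * p) powr (1 / real d)"
        using int intensity_pos[OF p(1) int(1)] by (intro powr_mono2) auto
      also have "\<dots> = (1 + \<delta>) powr (1 / real d) * p powr (1 / real d)"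
        using \<delta> p by (simp add: powr_mult)
      also have "\<dots> \<le> (1 + \<delta>) powr 1 * p powr (1 / real d)"
        using \<delta> d by (intro mult_right_mono powr_mono) auto
      finally have ip: "intensity p powr (1 / real d) \<le> (1 + \<delta>) * p powr (1 / real d)" using \<delta> by simp
      have "mean_noncrossing d n p \<le> ?c * (geom_mean d n * intensity p powr (1 / real d))"
        using n by (intro mean_noncrossing_le_chain_sup d0 p int) auto
      also have "\<dots> \<le> ?c * (geom_mean d n * ((1 + \<delta>) * p powr (1 / real d)))"
        using c ip geom_mean_pos[of d n] n by (intro mult_left_mono) (auto intro: less_imp_le)
      finally show ?thesis by (simp add: mult_ac)
    qed
    ultimately show ?thesis using int by (simp add: mult_ac)
  qed
  then show ?thesis using p0 A by blast
qed

text \<open>The mean is off by at most \<open>\<epsilon> / 4 * M\<close> and by at most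
  \<open>M / 4\<close>, which leaves deviations of at least \<open>3 / 4 * \<epsilon> * M\<close>.
  The exponents come out as 9/40 and 9/64 times the target expressions, and 1/8 is a round number
  below both.\<close>

lemma self_bounding_relative_tails:
  fixes Z :: "'a set \<Rightarrow> nat"
  assumes S: "finite S" and p: "0 \<le> p" "p \<le> 1" and Z: "self_bounding S Z"
    and mu: "mu = measure_pmf.expectation (bernoulli_subset S p) (\<lambda>X. real (Z X))"
    and M: "0 < M" and \<epsilon>: "0 < \<epsilon>" and \<delta>: "\<delta> = min \<epsilon> 1 / 4"
    and le: "(1 - \<delta>) * M \<le> mu" "mu \<le> (1 + \<delta>) * M"
  shows "measure_pmf.prob (bernoulli_subset S p) {X. real (Z X) \<le> (1 - \<epsilon>) * M} \<le> exp (- (1 / 8) * \<epsilon>\<^sup>2 * M)"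
    and "measure_pmf.prob (bernoulli_subset S p) {X. real (Z X) \<ge> (1 + \<epsilon>) * M}
      \<le> exp (- (1 / 8) * (\<epsilon>\<^sup>2 / (1 + \<epsilon>)) * M)"
proof -
  have \<delta>': "0 < \<delta>" "\<delta> \<le> \<epsilon> / 4" "\<delta> \<le> 1 / 4" using \<epsilon> by (auto simp: \<delta>)
  have mu0: "mu > 0"
  proof -
    have "0 < (1 - \<delta>) * M" using \<delta>' M by simp
    then show ?thesis using le by linarith
  qed
  have \<delta>M: "\<delta> * M \<le> \<epsilon> / 4 * M" "\<delta> * M \<le> 1 / 4 * M" using \<delta>' M by (auto intro: mult_right_mono)
  show "measure_pmf.prob (bernoulli_subset S p) {X. real (Z X) \<le> (1 - \<epsilon>) * M} \<le> exp (- (1 / 8) * \<epsilon>\<^sup>2 * M)"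
  proof (cases "\<epsilon> \<le> 1")
    \<comment> \<open>For \<epsilon> above 1 the threshold is negative and the event is
      empty.\<close>
    case False
    then have "(1 - \<epsilon>) * M < 0" using M by (simp add: mult_neg_pos)
    then have "\<not> real (Z X) \<le> (1 - \<epsilon>) * M" for X by (metis not_le of_nat_0_le_iff order_less_le_trans)
    then show ?thesis by simp
  next
    case True
    define t where "t = mu - (1 - \<epsilon>) * M"
    have t: "t \<ge> 3 / 4 * \<epsilon> * M" using le(1) \<delta>M by (simp add: t_def algebra_simps)
    have e0: "0 \<le> 3 / 4 * \<epsilon> * M" using \<epsilon> M by simp
    have "measure_pmf.prob (bernoulli_subset S p) {X. real (Z X) \<le> mu - t} \<le> exp (- (t\<^sup>2 / (2 * mu)))"
      using t e0 by (intro self_bounding_lower_tail S p Z mu mu0) linarith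
    also have "\<dots> \<le> exp (- ((3 / 4 * \<epsilon> * M)\<^sup>2 / (2 * (5 / 4 * M))))"
    proof -
      have "mu \<le> 5 / 4 * M" using le(2) \<delta>M by (simp add: algebra_simps)
      then have "(3 / 4 * \<epsilon> * M)\<^sup>2 / (2 * (5 / 4 * M)) \<le> t\<^sup>2 / (2 * mu)"
        using t e0 mu0 by (intro frac_le power_mono) auto
      then show ?thesis by simp
    qed
    also have "(3 / 4 * \<epsilon> * M)\<^sup>2 / (2 * (5 / 4 * M)) = 9 / 40 * (\<epsilon>\<^sup>2 * M)"
      using M by (simp add: power2_eq_square)
    also have "exp (- (9 / 40 * (\<epsilon>\<^sup>2 * M))) \<le> exp (- (1 / 8) * \<epsilon>\<^sup>2 * M)"
    proof -
      have "0 \<le> \<epsilon>\<^sup>2 * M" using M by simp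
      then show ?thesis by (simp add: mult.commute)
    qed
    finally show ?thesis by (simp add: t_def)
  qed
  define t where "t = 3 / 4 * \<epsilon> * M"
  have t: "0 \<le> t" using \<epsilon> M by (simp add: t_def)
  have "measure_pmf.prob (bernoulli_subset S p) {X. real (Z X) \<ge> (1 + \<epsilon>) * M}
      \<le> measure_pmf.prob (bernoulli_subset S p) {X. real (Z X) \<ge> mu + t}"
  proof (rule measure_pmf.finite_measure_mono)
    have "mu + t \<le> (1 + \<epsilon>) * M" using le(2) \<delta>M by (simp add: t_def algebra_simps)
    then show "{X. real (Z X) \<ge> (1 + \<epsilon>) * M} \<subseteq> {X. real (Z X) \<ge> mu + t}" by auto
  qed simp
  also have "\<dots> \<le> exp (- (t\<^sup>2 / (4 * (mu + t))))"
    by (intro self_bounding_upper_tail S p Z mu0 t) (simp add: mu)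
  also have "\<dots> \<le> exp (- (t\<^sup>2 / (4 * ((1 + \<epsilon>) * M))))"
  proof -
    have "mu + t \<le> (1 + \<epsilon>) * M" using le(2) \<delta>M by (simp add: t_def algebra_simps)
    then have "t\<^sup>2 / (4 * ((1 + \<epsilon>) * M)) \<le> t\<^sup>2 / (4 * (mu + t))"
      using mu0 t by (intro divide_left_mono) auto
    then show ?thesis by simp
  qed
  also have "t\<^sup>2 / (4 * ((1 + \<epsilon>) * M)) = 9 / 64 * (\<epsilon>\<^sup>2 / (1 + \<epsilon>) * M)"
    using M \<epsilon> by (simp add: t_def power2_eq_square)
  also have "exp (- (9 / 64 * (\<epsilon>\<^sup>2 / (1 + \<epsilon>) * M))) \<le> exp (- (1 / 8) * (\<epsilon>\<^sup>2 / (1 + \<epsilon>)) * M)"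
  proof -
    have *: "- (9 / 64 * (x * M)) \<le> - (1 / 8) * x * M" if "0 \<le> x" for x
      using mult_nonneg_nonneg[OF less_imp_le[OF M] that] by simp
    show ?thesis unfolding exp_le_cancel_iff using \<epsilon> by (intro *) simp
  qed
  finally show "measure_pmf.prob (bernoulli_subset S p) {X. real (Z X) \<ge> (1 + \<epsilon>) * M}
      \<le> exp (- (1 / 8) * (\<epsilon>\<^sup>2 / (1 + \<epsilon>)) * M)" .
qed

lemma is_median_interval:
  assumes "is_median D m" "measure_pmf.prob D {..a} < 1 / 2" "measure_pmf.prob D {b..} < 1 / 2"
  shows "m \<in> {a..b}"
proof (rule ccontr)
  assume "m \<notin> {a..b}"
  then consider "m < a" | "b < m" by force
  then show False
  proof cases
    case 1
    then have "measure_pmf.prob D {..m} \<le> measure_pmf.prob D {..a}"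
      by (intro measure_pmf.finite_measure_mono) auto
    then show False using assms by (simp add: is_median_def)
  next
    case 2
    then have "measure_pmf.prob D {m..} \<le> measure_pmf.prob D {b..}"
      by (intro measure_pmf.finite_measure_mono) auto
    then show False using assms by (simp add: is_median_def)
  qed
qed

theorem theorem7:
  "\<exists>C>0. \<forall>(d::nat)\<ge>2. \<forall>(\<epsilon>::real)>0. \<forall>(\<eta>::real) (g :: real \<Rightarrow> real).
     0 \<le> \<eta> \<and> \<eta> < 1 / (2 * real d * (real d - 1)) \<and> g \<in> O[at_top](\<lambda>t. t powr \<eta>) \<longrightarrow>
     (\<exists>(p0::real)>0. \<exists>(A::real)>0. \<forall>(n :: nat \<Rightarrow> nat) (p::real).
        let N = real (\<Prod>i<d. n i) powr (1 / real d);
            S = real (\<Sum>i<d. n i);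
            M = chain_const d * N * p powr (1 / real d);
            D = L_pmf d n p
        in (\<forall>i<d. n i > 0) \<and> 0 < p \<and> p \<le> p0 \<and> N * p powr (1 / real d) \<ge> A \<and> S \<le> g (1 / p) * N \<longrightarrow>
           ((1 - \<epsilon>) * M \<le> measure_pmf.expectation D (\<lambda>x. x) \<and>
            measure_pmf.expectation D (\<lambda>x. x) \<le> (1 + \<epsilon>) * M) \<and>
           (\<forall>m. is_median D m \<longrightarrow> m \<in> {(1 - \<epsilon>) * M .. (1 + \<epsilon>) * M}) \<and>
           measure_pmf.prob D {..(1 - \<epsilon>) * M} \<le> exp (- C * \<epsilon>\<^sup>2 * M) \<and>
           measure_pmf.prob D {(1 + \<epsilon>) * M..} \<le> exp (- C * (\<epsilon>\<^sup>2 / (1 + \<epsilon>)) * M))"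
proof (rule exI[of _ "1 / 8"], intro conjI allI impI)
  fix d :: nat and \<epsilon> \<eta> :: real and g :: "real \<Rightarrow> real"
  assume d: "2 \<le> d" and \<epsilon>: "0 < \<epsilon>"
    and h: "0 \<le> \<eta> \<and> \<eta> < 1 / (2 * real d * (real d - 1)) \<and> g \<in> O[at_top](\<lambda>t. t powr \<eta>)"
  define \<delta> where "\<delta> = min \<epsilon> 1 / 4"
  have \<delta>: "0 < \<delta>" "\<delta> \<le> 1" "\<delta> \<le> \<epsilon>" using \<epsilon> by (auto simp: \<delta>_def)
  let ?c = "chain_sup d"
  have c: "?c > 0" using d by (intro chain_sup_pos) simp
  have const: "chain_const d = ?c" using d by (intro chain_const_eq) simp
  obtain p0 A where p0: "p0 > 0" and A: "A > 0" and mean: "\<And>n p. (\<forall>i<d. n i > 0) \<and> 0 < p \<and> p \<le> p0 \<and>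
      geom_mean d n * p powr (1 / real d) \<ge> A \<and> real (\<Sum>i<d. n i) \<le> g (1 / p) * geom_mean d n \<Longrightarrow>
      p < 1 \<and>
      (1 - \<delta>) * (?c * geom_mean d n * p powr (1 / real d)) \<le> mean_noncrossing d n p \<and>
      mean_noncrossing d n p \<le> (1 + \<delta>) * (?c * geom_mean d n * p powr (1 / real d))"
    using mean_noncrossing_asymptotic[OF d _ _ \<delta>(1,2), of \<eta> g] h by blast
  \<comment> \<open>The second term raises both tail exponents to at least 2; as
    \<open>exp (- 2) < 1 / 2\<close>, no median can lie outside the interval.\<close>
  define A' where "A' = max A (16 * (1 + \<epsilon>) / (\<epsilon>\<^sup>2 * ?c))"
  have A': "A' > 0" "A \<le> A'" "16 * (1 + \<epsilon>) / (\<epsilon>\<^sup>2 * ?c) \<le> A'" using A by (auto simp: A'_def)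
  have main: "((1 - \<epsilon>) * M \<le> measure_pmf.expectation (L_pmf d n p) (\<lambda>x. x) \<and>
      measure_pmf.expectation (L_pmf d n p) (\<lambda>x. x) \<le> (1 + \<epsilon>) * M) \<and>
      (\<forall>m. is_median (L_pmf d n p) m \<longrightarrow> m \<in> {(1 - \<epsilon>) * M .. (1 + \<epsilon>) * M}) \<and>
      measure_pmf.prob (L_pmf d n p) {..(1 - \<epsilon>) * M} \<le> exp (- (1 / 8) * \<epsilon>\<^sup>2 * M) \<and>
      measure_pmf.prob (L_pmf d n p) {(1 + \<epsilon>) * M..} \<le> exp (- (1 / 8) * (\<epsilon>\<^sup>2 / (1 + \<epsilon>)) * M)"
    if n: "\<forall>i<d. n i > 0" and p: "0 < p" "p \<le> p0" and big: "geom_mean d n * p powr (1 / real d) \<ge> A'"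
      and S: "real (\<Sum>i<d. n i) \<le> g (1 / p) * geom_mean d n"
      and M_def: "M = ?c * geom_mean d n * p powr (1 / real d)" for n p M
  proof -
    let ?G = "complete_edges d n"
    have le: "p < 1" "(1 - \<delta>) * M \<le> mean_noncrossing d n p" "mean_noncrossing d n p \<le> (1 + \<delta>) * M"
      using mean[of n p] n p big A'(2) S unfolding M_def by auto
    have M_ge: "M \<ge> 16 * (1 + \<epsilon>) / \<epsilon>\<^sup>2"
    proof -
      have "16 * (1 + \<epsilon>) / \<epsilon>\<^sup>2 = ?c * (16 * (1 + \<epsilon>) / (\<epsilon>\<^sup>2 * ?c))" using c by simp
      also have "\<dots> \<le> ?c * (geom_mean d n * p powr (1 / real d))"
        using A'(3) big c by (intro mult_left_mono) auto
      finally show ?thesis by (simp add: M_def mult_ac)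
    qed
    have "16 * (1 + \<epsilon>) / \<epsilon>\<^sup>2 > 0" using \<epsilon> by simp
    then have M: "M > 0" using M_ge by linarith
    have prob: "measure_pmf.prob (L_pmf d n p) E
        = measure_pmf.prob (bernoulli_subset ?G p) {X. real (max_noncrossing d X) \<in> E}" for E
      by (simp add: L_pmf_def random_hypergraph_eq vimage_def)
    have expct: "measure_pmf.expectation (L_pmf d n p) (\<lambda>x. x) = mean_noncrossing d n p"
      by (simp add: L_pmf_def random_hypergraph_eq mean_noncrossing_def)
    note tails = self_bounding_relative_tails[OF finite_complete_edges _ _
        self_bounding_max_noncrossing[OF finite_complete_edges] mean_noncrossing_def M \<epsilon> \<delta>_def le(2,3)]
    have lower: "measure_pmf.prob (L_pmf d n p) {..(1 - \<epsilon>) * M} \<le> exp (- (1 / 8) * \<epsilon>\<^sup>2 * M)"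
      using tails(1) p le(1) by (simp add: prob)
    have upper: "measure_pmf.prob (L_pmf d n p) {(1 + \<epsilon>) * M..} \<le> exp (- (1 / 8) * (\<epsilon>\<^sup>2 / (1 + \<epsilon>)) * M)"
      using tails(2) p le(1) by (simp add: prob)
    have exp2: "exp (- 2) < (1 / 2 :: real)"
      using exp_ge_add_one_self[of 2] by (simp add: exp_minus field_simps)
    have big2: "2 \<le> 1 / 8 * (\<epsilon>\<^sup>2 / (1 + \<epsilon>)) * M"
    proof -
      have "1 / 8 * (\<epsilon>\<^sup>2 / (1 + \<epsilon>)) * (16 * (1 + \<epsilon>) / \<epsilon>\<^sup>2) \<le> 1 / 8 * (\<epsilon>\<^sup>2 / (1 + \<epsilon>)) * M"
        using M_ge \<epsilon> by (intro mult_left_mono) auto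
      moreover have "1 / 8 * (x / y) * (16 * y / x) = 2" if "x \<noteq> 0" "y \<noteq> 0" for x y :: real
        using that by simp
      from this[of "\<epsilon>\<^sup>2" "1 + \<epsilon>"]
      have "1 / 8 * (\<epsilon>\<^sup>2 / (1 + \<epsilon>)) * (16 * (1 + \<epsilon>) / \<epsilon>\<^sup>2) = 2" using \<epsilon> by simp
      ultimately show ?thesis by linarith
    qed
    have "\<epsilon>\<^sup>2 / (1 + \<epsilon>) \<le> \<epsilon>\<^sup>2" using \<epsilon> by (simp add: pos_divide_le_eq)
    then have "1 / 8 * (\<epsilon>\<^sup>2 / (1 + \<epsilon>)) * M \<le> 1 / 8 * \<epsilon>\<^sup>2 * M"
      using M by (intro mult_right_mono mult_left_mono) auto
    then have "- (1 / 8) * \<epsilon>\<^sup>2 * M \<le> - 2" using big2 by linarith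
    then have "exp (- (1 / 8) * \<epsilon>\<^sup>2 * M) \<le> exp (- 2)" by (simp only: exp_le_cancel_iff)
    then have lower2: "measure_pmf.prob (L_pmf d n p) {..(1 - \<epsilon>) * M} < 1 / 2"
      using lower exp2 by linarith
    have "exp (- (1 / 8) * (\<epsilon>\<^sup>2 / (1 + \<epsilon>)) * M) \<le> exp (- 2)" using big2 by simp
    then have upper2: "measure_pmf.prob (L_pmf d n p) {(1 + \<epsilon>) * M..} < 1 / 2"
      using upper exp2 by linarith
    have "(1 - \<epsilon>) * M \<le> (1 - \<delta>) * M" "(1 + \<delta>) * M \<le> (1 + \<epsilon>) * M"
      using \<delta>(3) M by (auto intro: mult_right_mono)
    then show ?thesis
      using le lower upper is_median_interval[OF _ lower2 upper2] unfolding expct by auto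
  qed
  show "\<exists>(p0::real)>0. \<exists>(A::real)>0. \<forall>(n :: nat \<Rightarrow> nat) (p::real).
        let N = real (\<Prod>i<d. n i) powr (1 / real d);
            S = real (\<Sum>i<d. n i);
            M = chain_const d * N * p powr (1 / real d);
            D = L_pmf d n p
        in (\<forall>i<d. n i > 0) \<and> 0 < p \<and> p \<le> p0 \<and> N * p powr (1 / real d) \<ge> A \<and> S \<le> g (1 / p) * N \<longrightarrow>
           ((1 - \<epsilon>) * M \<le> measure_pmf.expectation D (\<lambda>x. x) \<and>
            measure_pmf.expectation D (\<lambda>x. x) \<le> (1 + \<epsilon>) * M) \<and>
           (\<forall>m. is_median D m \<longrightarrow> m \<in> {(1 - \<epsilon>) * M .. (1 + \<epsilon>) * M}) \<and>
           measure_pmf.prob D {..(1 - \<epsilon>) * M} \<le> exp (- (1 / 8) * \<epsilon>\<^sup>2 * M) \<and>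
           measure_pmf.prob D {(1 + \<epsilon>) * M..} \<le> exp (- (1 / 8) * (\<epsilon>\<^sup>2 / (1 + \<epsilon>)) * M)"
    unfolding Let_def const geom_mean_def[symmetric]
  proof (rule exI[of _ p0], intro conjI p0 exI[of _ A'] A'(1) allI impI)
  qed (use main in \<open>blast+\<close>)
qed simp

thm_deps theorem7

end
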